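(* Let $M$ be a smooth manifold of dimension $2n+1$. The assignment $\eta\mapsto L_\eta$ is a one-to-one correspondence between contact $1$-forms on $M$ and $\mathcal{E}^1(M)$-Dirac structures $L$ satisfying, for every $x\in M$, $$L_x\cap\big((T_xM\times\mathbb{R})\oplus\{0\}\big)=\{0\}\quad\text{and}\quad L_x\cap\big(\{0\}\oplus(T_x^*M\times\mathbb{R})\big)=\{0\}.$$
   Context: $M$ is a smooth manifold. Let $\mathcal{E}^1(M)=(TM\times\mathbb{R})\oplus(T^*M\times\mathbb{R})$, a real vector bundle over $M$; its sections are written $(X,f)+(\alpha,g)$ with $X$ a vector field, $\alpha$ a $1$-form and $f,g\in C^\infty(M)$. It carries the symmetric bilinear form $$\langle (X_1,f_1)+(\alpha_1,g_1),\,(X_2,f_2)+(\alpha_2,g_2)\rangle=\tfrac12\big(i_{X_2}\alpha_1+i_{X_1}\alpha_2+f_1g_2+f_2g_1\big).$$ For $k\ge 1$, $\alpha\in\Omega^k(M)$, $\beta\in\Omega^{k-1}(M)$ put $\widetilde d(\alpha,\beta)=(d\alpha,\,(-1)^k\alpha+d\beta)$, and for $f\in C^\infty(M)$ put $\widetilde d f=(df,f)$. For a vector field $X$ and $f\in C^\infty(M)$ put $i_{(X,f)}(\alpha,\beta)=(i_X\alpha+(-1)^{k+1}f\beta,\ i_X\beta)$ (for $k=1$ this is the function $i_{(X,f)}(\alpha,g)=\alpha(X)+fg$). Put $\widetilde{\mathcal L}_{(X,f)}=i_{(X,f)}\circ\widetilde d+\widetilde d\circ i_{(X,f)}$. The extended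 Courant bracket on $\Gamma(\mathcal{E}^1(M))$ is $$[(X_1,f_1)+(\alpha_1,g_1),(X_2,f_2)+(\alpha_2,g_2)]=([X_1,X_2],\,X_1\cdot f_2-X_2\cdot f_1)+\widetilde{\mathcal L}_{(X_1,f_1)}(\alpha_2,g_2)-i_{(X_2,f_2)}\widetilde d(\alpha_1,g_1).$$ An $\mathcal{E}^1(M)$-Dirac structure is a sub-bundle $L\subset\mathcal{E}^1(M)$ that is maximally isotropic with respect to $\langle\cdot,\cdot\rangle$ and such that $\Gamma(L)$ is closed under the extended Courant bracket. For a $1$-form $\eta$ on $M$, $L_\eta$ is the $\mathcal{E}^1(M)$-Dirac structure with fibres $(L_\eta)_x=\{(X,f)_x+(i_Xd\eta+f\eta,\,-i_X\eta)_x : X \text{ a vector field on } M,\ f\in C^\infty(M)\}$. A $1$-form $\eta$ on a $(2n+1)$-dimensional manifold is contact if $\eta\wedge(d\eta)^n\neq0$ at every point. *)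

theory Defs
  imports "HOL-Analysis.Analysis" "HOL-Combinatorics.Permutations" "HOL-Library.Function_Algebras"
begin

text \<open>Pointwise real vector space structure on function types, so that \<open>subspace\<close>, \<open>span\<close> and
  \<open>independent\<close> apply to tangent vectors and covectors.\<close>

instantiation "fun" :: (type, scaleR) scaleR
begin
definition scaleR_fun :: "real \<Rightarrow> ('a \<Rightarrow> 'b) \<Rightarrow> 'a \<Rightarrow> 'b"
  where "scaleR_fun c f = (\<lambda>x. c *\<^sub>R f x)"
instance ..
end

instance "fun" :: (type, real_vector) real_vector
  by standard (auto simp: scaleR_fun_def scaleR_add_left scaleR_add_right)


section \<open>Smooth manifolds\<close>

text \<open>\<open>Ck_on k S f\<close>: \<open>f\<close> is of class \<open>C\<^sup>k\<close> on \<open>S\<close>; only used for open \<open>S\<close>.\<close>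

primrec Ck_on :: "nat \<Rightarrow> 'a::real_normed_vector set \<Rightarrow> ('a \<Rightarrow> 'b::real_normed_vector) \<Rightarrow> bool" where
  "Ck_on 0 S f \<longleftrightarrow> continuous_on S f"
| "Ck_on (Suc k) S f \<longleftrightarrow>
     (\<forall>x\<in>S. f differentiable (at x)) \<and> (\<forall>v. Ck_on k S (\<lambda>x. frechet_derivative f (at x) v))"

definition smooth_on :: "'a::real_normed_vector set \<Rightarrow> ('a \<Rightarrow> 'b::real_normed_vector) \<Rightarrow> bool"
  where "smooth_on S f \<longleftrightarrow> (\<forall>k. Ck_on k S f)"

text \<open>A chart is a pair \<open>(U, \<phi>)\<close>, of which only the values of \<open>\<phi>\<close> on \<open>U\<close> matter. The manifold is the
  whole type \<open>'m\<close> with a smooth structure given by an atlas \<open>A\<close> (not necessarily maximal);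
  its dimension is \<open>DIM('e)\<close>.\<close>

type_synonym ('m, 'e) atlas = "('m set \<times> ('m \<Rightarrow> 'e)) set"

definition smooth_manifold ::
    "('m::{t2_space,second_countable_topology}, 'e::euclidean_space) atlas \<Rightarrow> bool" where
  "smooth_manifold A \<longleftrightarrow>
     (\<forall>(U, \<phi>)\<in>A. open U \<and> open (\<phi> ` U) \<and> homeomorphism U (\<phi> ` U) \<phi> (inv_into U \<phi>)) \<and>
     (\<Union>(U, \<phi>)\<in>A. U) = UNIV \<and>
     (\<forall>(U, \<phi>)\<in>A. \<forall>(V, \<psi>)\<in>A. smooth_on (\<phi> ` (U \<inter> V)) (\<psi> \<circ> inv_into U \<phi>))"

text \<open>Functions, vector fields and forms below are total on \<open>'m\<close>; the parameter \<open>W\<close> is the open set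
  on which smoothness is required.\<close>

definition smooth_fun_on ::
    "('m, 'e::euclidean_space) atlas \<Rightarrow> 'm set \<Rightarrow> ('m \<Rightarrow> real) \<Rightarrow> bool" where
  "smooth_fun_on A W f \<longleftrightarrow> (\<forall>(U, \<phi>)\<in>A. smooth_on (\<phi> ` (U \<inter> W)) (f \<circ> inv_into U \<phi>))"

abbreviation smooth_fun :: "('m, 'e::euclidean_space) atlas \<Rightarrow> ('m \<Rightarrow> real) \<Rightarrow> bool"
  where "smooth_fun A \<equiv> smooth_fun_on A UNIV"


section \<open>Tangent vectors, vector fields and forms\<close>

text \<open>Tangent vectors at \<open>p\<close> are the derivations at \<open>p\<close> of the algebra of smooth functions. Since
  functions are total, they are made to vanish on non-smooth arguments, so that equality of
  tangent vectors is equality on smooth functions. In the same way covectors vanish off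
  \<open>T\<^sub>pM\<close>.\<close>

type_synonym 'm tvec = "('m \<Rightarrow> real) \<Rightarrow> real"
type_synonym 'm covec = "'m tvec \<Rightarrow> real"

definition tangent_space :: "('m, 'e::euclidean_space) atlas \<Rightarrow> 'm \<Rightarrow> 'm tvec set" where
  "tangent_space A p = {v.
     (\<forall>f g. smooth_fun A f \<longrightarrow> smooth_fun A g \<longrightarrow> v (\<lambda>x. f x + g x) = v f + v g) \<and>
     (\<forall>c f. smooth_fun A f \<longrightarrow> v (\<lambda>x. c * f x) = c * v f) \<and>
     (\<forall>f g. smooth_fun A f \<longrightarrow> smooth_fun A g \<longrightarrow> v (\<lambda>x. f x * g x) = v f * g p + f p * v g) \<and>
     (\<forall>f. \<not> smooth_fun A f \<longrightarrow> v f = 0)}"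

definition cotangent_space :: "('m, 'e::euclidean_space) atlas \<Rightarrow> 'm \<Rightarrow> 'm covec set" where
  "cotangent_space A p = {\<xi>.
     (\<forall>v\<in>tangent_space A p. \<forall>w\<in>tangent_space A p. \<xi> (v + w) = \<xi> v + \<xi> w) \<and>
     (\<forall>c. \<forall>v\<in>tangent_space A p. \<xi> (c *\<^sub>R v) = c * \<xi> v) \<and>
     (\<forall>v. v \<notin> tangent_space A p \<longrightarrow> \<xi> v = 0)}"

definition vector_field_on ::
    "('m, 'e::euclidean_space) atlas \<Rightarrow> 'm set \<Rightarrow> ('m \<Rightarrow> 'm tvec) \<Rightarrow> bool" where
  "vector_field_on A W X \<longleftrightarrow>
     (\<forall>p\<in>W. X p \<in> tangent_space A p) \<and>
     (\<forall>f. smooth_fun A f \<longrightarrow> smooth_fun_on A W (\<lambda>p. X p f))"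

abbreviation vector_field :: "('m, 'e::euclidean_space) atlas \<Rightarrow> ('m \<Rightarrow> 'm tvec) \<Rightarrow> bool"
  where "vector_field A \<equiv> vector_field_on A UNIV"

definition one_form_on ::
    "('m, 'e::euclidean_space) atlas \<Rightarrow> 'm set \<Rightarrow> ('m \<Rightarrow> 'm covec) \<Rightarrow> bool" where
  "one_form_on A W \<alpha> \<longleftrightarrow>
     (\<forall>p\<in>W. \<alpha> p \<in> cotangent_space A p) \<and>
     (\<forall>X. vector_field A X \<longrightarrow> smooth_fun_on A W (\<lambda>p. \<alpha> p (X p)))"

abbreviation one_form :: "('m, 'e::euclidean_space) atlas \<Rightarrow> ('m \<Rightarrow> 'm covec) \<Rightarrow> bool"
  where "one_form A \<equiv> one_form_on A UNIV"

definition two_form ::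
    "('m, 'e::euclidean_space) atlas \<Rightarrow> ('m \<Rightarrow> 'm tvec \<Rightarrow> 'm covec) \<Rightarrow> bool" where
  "two_form A \<omega> \<longleftrightarrow>
     (\<forall>p. \<forall>v\<in>tangent_space A p.
        \<omega> p v \<in> cotangent_space A p \<and> (\<lambda>w. \<omega> p w v) \<in> cotangent_space A p \<and> \<omega> p v v = 0) \<and>
     (\<forall>p v. v \<notin> tangent_space A p \<longrightarrow> \<omega> p v = 0) \<and>
     (\<forall>X Y. vector_field A X \<longrightarrow> vector_field A Y \<longrightarrow> smooth_fun A (\<lambda>p. \<omega> p (X p) (Y p)))"

definition lie_bracket :: "('m \<Rightarrow> 'm tvec) \<Rightarrow> ('m \<Rightarrow> 'm tvec) \<Rightarrow> 'm \<Rightarrow> 'm tvec" where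
  "lie_bracket X Y = (\<lambda>p f. X p (\<lambda>q. Y q f) - Y p (\<lambda>q. X q f))"

definition d_fun :: "('m, 'e::euclidean_space) atlas \<Rightarrow> ('m \<Rightarrow> real) \<Rightarrow> 'm \<Rightarrow> 'm covec" where
  "d_fun A f = (\<lambda>p v. if v \<in> tangent_space A p then v f else 0)"

text \<open>The exterior derivative of a \<open>1\<close>-form, by its invariant formula; the normalization
  (no factor 1/2) is the one for which Cartan's formula \<open>L\<^sub>X = i\<^sub>X d + d i\<^sub>X\<close> holds.\<close>

definition d_form ::
    "('m, 'e::euclidean_space) atlas \<Rightarrow> ('m \<Rightarrow> 'm covec) \<Rightarrow> 'm \<Rightarrow> 'm tvec \<Rightarrow> 'm covec" where
  "d_form A \<alpha> = (THE \<omega>. two_form A \<omega> \<and>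
     (\<forall>X Y. vector_field A X \<longrightarrow> vector_field A Y \<longrightarrow>
        (\<forall>p. \<omega> p (X p) (Y p) =
               X p (\<lambda>q. \<alpha> q (Y q)) - Y p (\<lambda>q. \<alpha> q (X q)) - \<alpha> p (lie_bracket X Y p))))"


section \<open>Contact forms\<close>

text \<open>An alternating \<open>k\<close>-form on a vector space is represented as a function of a sequence of vectors
  that depends on the entries \<open>0, \<dots>, k - 1\<close> only.\<close>

definition wedge ::
    "nat \<Rightarrow> nat \<Rightarrow> ((nat \<Rightarrow> 'v) \<Rightarrow> real) \<Rightarrow> ((nat \<Rightarrow> 'v) \<Rightarrow> real) \<Rightarrow> (nat \<Rightarrow> 'v) \<Rightarrow> real" where
  "wedge k l a b = (\<lambda>v.
     (\<Sum>\<sigma> | \<sigma> permutes {..<k + l}.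
        of_int (sign \<sigma>) * a (\<lambda>i. v (\<sigma> i)) * b (\<lambda>i. v (\<sigma> (k + i)))) / (fact k * fact l))"

primrec wedge_power :: "nat \<Rightarrow> ((nat \<Rightarrow> 'v) \<Rightarrow> real) \<Rightarrow> nat \<Rightarrow> (nat \<Rightarrow> 'v) \<Rightarrow> real" where
  "wedge_power k a 0 = (\<lambda>v. 1)"
| "wedge_power k a (Suc m) = wedge k (k * m) a (wedge_power k a m)"

definition contact_form ::
    "('m, 'e::euclidean_space) atlas \<Rightarrow> nat \<Rightarrow> ('m \<Rightarrow> 'm covec) \<Rightarrow> bool" where
  "contact_form A n \<eta> \<longleftrightarrow> one_form A \<eta> \<and>
     (\<forall>p. \<exists>v. (\<forall>i<2 * n + 1. v i \<in> tangent_space A p) \<and>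
        wedge 1 (2 * n) (\<lambda>u. \<eta> p (u 0))
          (wedge_power 2 (\<lambda>u. d_form A \<eta> p (u 0) (u 1)) n) v \<noteq> 0)"


section \<open>The bundle and the extended Courant bracket\<close>

text \<open>An element \<open>(v, a) + (\<xi>, b)\<close> of the fibre over \<open>p\<close> is the tuple \<open>((v, a), (\<xi>, b))\<close>; a section
  \<open>(X, f) + (\<alpha>, g)\<close> is the tuple \<open>((X, f), (\<alpha>, g))\<close> of its component fields.\<close>

type_synonym 'm E1_elem = "('m tvec \<times> real) \<times> ('m covec \<times> real)"
type_synonym 'm E1_section =
  "(('m \<Rightarrow> 'm tvec) \<times> ('m \<Rightarrow> real)) \<times> (('m \<Rightarrow> 'm covec) \<times> ('m \<Rightarrow> real))"

definition E1_fibre :: "('m, 'e::euclidean_space) atlas \<Rightarrow> 'm \<Rightarrow> 'm E1_elem set" where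
  "E1_fibre A p = (tangent_space A p \<times> UNIV) \<times> (cotangent_space A p \<times> UNIV)"

fun E1_pairing :: "'m E1_elem \<Rightarrow> 'm E1_elem \<Rightarrow> real" where
  "E1_pairing ((v1, a1), (\<xi>1, b1)) ((v2, a2), (\<xi>2, b2)) =
     1 / 2 * (\<xi>1 v2 + \<xi>2 v1 + a1 * b2 + a2 * b1)"

fun value_at :: "'m E1_section \<Rightarrow> 'm \<Rightarrow> 'm E1_elem" where
  "value_at ((X, f), (\<alpha>, g)) p = ((X p, f p), (\<alpha> p, g p))"

definition E1_sections_on ::
    "('m, 'e::euclidean_space) atlas \<Rightarrow> 'm set \<Rightarrow> 'm E1_section set" where
  "E1_sections_on A W = {((X, f), (\<alpha>, g)) | X f \<alpha> g.
     vector_field_on A W X \<and> smooth_fun_on A W f \<and> one_form_on A W \<alpha> \<and> smooth_fun_on A W g}"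

definition tilde_d_fun ::
    "('m, 'e::euclidean_space) atlas \<Rightarrow> ('m \<Rightarrow> real) \<Rightarrow> ('m \<Rightarrow> 'm covec) \<times> ('m \<Rightarrow> real)" where
  "tilde_d_fun A f = (d_fun A f, f)"

text \<open>The operators \<open>d~\<close> for \<open>k = 1\<close>, and \<open>i\<close> for \<open>k = 1\<close> and \<open>k = 2\<close>, are those occurring in the
  bracket; sums and differences are pointwise.\<close>

fun tilde_d_form ::
    "('m, 'e::euclidean_space) atlas \<Rightarrow> ('m \<Rightarrow> 'm covec) \<times> ('m \<Rightarrow> real) \<Rightarrow>
     ('m \<Rightarrow> 'm tvec \<Rightarrow> 'm covec) \<times> ('m \<Rightarrow> 'm covec)" where
  "tilde_d_form A (\<alpha>, g) = (d_form A \<alpha>, - \<alpha> + d_fun A g)"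

fun contract1 ::
    "('m \<Rightarrow> 'm tvec) \<times> ('m \<Rightarrow> real) \<Rightarrow> ('m \<Rightarrow> 'm covec) \<times> ('m \<Rightarrow> real) \<Rightarrow> 'm \<Rightarrow> real" where
  "contract1 (X, f) (\<alpha>, g) = (\<lambda>p. \<alpha> p (X p) + f p * g p)"

fun contract2 ::
    "('m \<Rightarrow> 'm tvec) \<times> ('m \<Rightarrow> real) \<Rightarrow> ('m \<Rightarrow> 'm tvec \<Rightarrow> 'm covec) \<times> ('m \<Rightarrow> 'm covec) \<Rightarrow>
     ('m \<Rightarrow> 'm covec) \<times> ('m \<Rightarrow> real)" where
  "contract2 (X, f) (\<omega>, \<beta>) = ((\<lambda>p. \<omega> p (X p) - f p *\<^sub>R \<beta> p), (\<lambda>p. \<beta> p (X p)))"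

definition tilde_Lie ::
    "('m, 'e::euclidean_space) atlas \<Rightarrow> ('m \<Rightarrow> 'm tvec) \<times> ('m \<Rightarrow> real) \<Rightarrow>
     ('m \<Rightarrow> 'm covec) \<times> ('m \<Rightarrow> real) \<Rightarrow> ('m \<Rightarrow> 'm covec) \<times> ('m \<Rightarrow> real)" where
  "tilde_Lie A Xf \<alpha>g =
     contract2 Xf (tilde_d_form A \<alpha>g) + tilde_d_fun A (contract1 Xf \<alpha>g)"

fun courant_bracket ::
    "('m, 'e::euclidean_space) atlas \<Rightarrow> 'm E1_section \<Rightarrow> 'm E1_section \<Rightarrow> 'm E1_section" where
  "courant_bracket A ((X1, f1), (\<alpha>1, g1)) ((X2, f2), (\<alpha>2, g2)) =
     ((lie_bracket X1 X2, (\<lambda>p. X1 p f2 - X2 p f1)),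
      tilde_Lie A (X1, f1) (\<alpha>2, g2) - contract2 (X2, f2) (tilde_d_form A (\<alpha>1, g1)))"


section \<open>Dirac structures\<close>

text \<open>A family of subspaces of the fibres is a sub-bundle if it has constant rank and is locally
  spanned by a frame of smooth local sections.\<close>

definition subbundle ::
    "('m::topological_space, 'e::euclidean_space) atlas \<Rightarrow> ('m \<Rightarrow> 'm E1_elem set) \<Rightarrow> bool" where
  "subbundle A L \<longleftrightarrow> (\<exists>r::nat. \<forall>x. \<exists>W s. open W \<and> x \<in> W \<and>
     (\<forall>i<r. s i \<in> E1_sections_on A W) \<and>
     (\<forall>y\<in>W. inj_on (\<lambda>i. value_at (s i) y) {..<r} \<and>
             independent ((\<lambda>i. value_at (s i) y) ` {..<r}) \<and>
             L y = span ((\<lambda>i. value_at (s i) y) ` {..<r})))"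

definition isotropic ::
    "('m, 'e::euclidean_space) atlas \<Rightarrow> 'm \<Rightarrow> 'm E1_elem set \<Rightarrow> bool" where
  "isotropic A p V \<longleftrightarrow> subspace V \<and> V \<subseteq> E1_fibre A p \<and> (\<forall>u\<in>V. \<forall>v\<in>V. E1_pairing u v = 0)"

definition maximally_isotropic ::
    "('m, 'e::euclidean_space) atlas \<Rightarrow> 'm \<Rightarrow> 'm E1_elem set \<Rightarrow> bool" where
  "maximally_isotropic A p V \<longleftrightarrow>
     isotropic A p V \<and> (\<forall>V'. isotropic A p V' \<longrightarrow> V \<subseteq> V' \<longrightarrow> V' = V)"

definition sections_of ::
    "('m, 'e::euclidean_space) atlas \<Rightarrow> ('m \<Rightarrow> 'm E1_elem set) \<Rightarrow> 'm E1_section set" where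
  "sections_of A L = {e \<in> E1_sections_on A UNIV. \<forall>p. value_at e p \<in> L p}"

definition dirac_structure ::
    "('m::topological_space, 'e::euclidean_space) atlas \<Rightarrow> ('m \<Rightarrow> 'm E1_elem set) \<Rightarrow> bool" where
  "dirac_structure A L \<longleftrightarrow> subbundle A L \<and> (\<forall>p. maximally_isotropic A p (L p)) \<and>
     (\<forall>e1\<in>sections_of A L. \<forall>e2\<in>sections_of A L. courant_bracket A e1 e2 \<in> sections_of A L)"

definition L_of :: "('m, 'e::euclidean_space) atlas \<Rightarrow> ('m \<Rightarrow> 'm covec) \<Rightarrow> 'm \<Rightarrow> 'm E1_elem set" where
  "L_of A \<eta> = (\<lambda>x. {((X x, f x), (d_form A \<eta> x (X x) + f x *\<^sub>R \<eta> x, - \<eta> x (X x))) | X f.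
     vector_field A X \<and> smooth_fun A f})"

end

theory Submission
  imports Defs
begin

text \<open>
  Write \<open>V\<close> for the bundle \<open>TM \<times> \<real>\<close>. A \<open>1\<close>-form \<open>\<eta>\<close> defines on each fibre of \<open>V\<close> the skew form
  \<open>\<Omega>((X, f), (Y, g)) = d\<eta>(X, Y) + f \<eta>(Y) - g \<eta>(X)\<close>, which is \<open>d~(\<eta>, 0)\<close>, and \<open>L\<^sub>\<eta>\<close> is the graph of
  \<open>\<Omega>\<close> as a map from \<open>V\<close> to its dual. Being the graph of a skew form on the whole of \<open>V\<close>, it is maximally
  isotropic and meets \<open>{0} \<oplus> V\<^sup>*\<close> only in \<open>0\<close>; it is closed under the bracket because \<open>d d\<eta> = 0\<close>
  (\<open>ext_d_closed\<close>, \<open>L_of_involutive\<close>).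

  It meets \<open>V \<oplus> {0}\<close> only in \<open>0\<close> exactly when \<open>\<Omega>\<close> is nondegenerate, and that is the contact
  condition: up to a positive factor, the value of \<open>\<eta> \<and> (d\<eta>)\<^sup>n\<close> on \<open>v\<^sub>0, \<dots>, v\<^sub>2\<^sub>n\<close> is the
  Pfaffian of \<open>\<Omega>\<close> on the \<open>2n + 2\<close> vectors \<open>(0, 1), (v\<^sub>0, 0), \<dots>, (v\<^sub>2\<^sub>n, 0)\<close>. A Pfaffian vanishes iff
  its matrix has a kernel (\<open>pf_nonzero_iff\<close>), whence \<open>contact_iff_nondeg\<close>.

  Conversely, let \<open>L\<close> be an \<open>\<E>\<^sup>1(M)\<close>-Dirac structure with \<open>L \<inter> ({0} \<oplus> V\<^sup>*) = 0\<close>. If the projection of a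
  fibre of \<open>L\<close> to \<open>V\<close> were not onto, a covector vanishing on its image could be added to the fibre without
  losing isotropy, against maximality; so \<open>L\<close> is the graph of a skew form on \<open>V\<close> (\<open>L_total\<close>). This form can be
  written \<open>\<omega>(X, Y) + f \<eta>(Y) - g \<eta>(X)\<close> on \<open>(X, f)\<close> and \<open>(Y, g)\<close>. Here \<open>\<omega>\<close> and \<open>\<eta>\<close> are smooth, since a
  smooth frame of \<open>L\<close> projects to a frame of \<open>V\<close> (\<open>smooth_graph\<close>). The function component of the bracket of the
  sections over \<open>(X, 0)\<close> and \<open>(Y, 0)\<close> then says precisely that \<open>\<omega> = d\<eta>\<close> (\<open>d_eta\<close>), so \<open>L = L\<^sub>\<eta>\<close>.

  Most of the work is in the foundations: derivations at a point are spanned by coordinate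
  derivatives (\<open>local_frame\<close>, through cutoff functions and Hadamard's lemma), and the invariant formula for
  \<open>d\<eta>\<close> is tensorial and therefore does define a \<open>2\<close>-form (\<open>two_form_d\<close>).
\<close>

section \<open>Calculus of smooth maps\<close>

lemma Ck_on_cong:
  assumes "open S" "\<And>x. x \<in> S \<Longrightarrow> f x = g x" "Ck_on k S f"
  shows "Ck_on k S g"
  using assms(2,3)
proof (induction k arbitrary: f g)
  case 0
  then show ?case by (auto cong: continuous_on_cong)
next
  case (Suc k)
  have d: "f differentiable (at x)" if "x \<in> S" for x using Suc.prems that by auto
  have eq: "frechet_derivative f (at x) = frechet_derivative g (at x)" if "x \<in> S" for x
    using frechet_derivative_transform_within_open[OF d[OF that] assms(1) that] Suc.prems(1) by auto
  have "g differentiable (at x)" if "x \<in> S" for x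
    using d[OF that] has_derivative_transform_within_open[OF _ assms(1) that, of f _ UNIV g] Suc.prems(1)
    unfolding differentiable_def by blast
  moreover have "Ck_on k S (\<lambda>x. frechet_derivative g (at x) v)" for v
    by (rule Suc.IH[of "\<lambda>x. frechet_derivative f (at x) v"]) (use Suc.prems eq in auto)
  ultimately show ?case by auto
qed

text \<open>The recursion for \<open>Ck_on\<close> uses the chosen derivative
  \<open>frechet_derivative\<close>; this form lets any formula for the derivative serve.\<close>

lemma Ck_on_SucI:
  assumes "open S" "\<And>x. x \<in> S \<Longrightarrow> (f has_derivative f' x) (at x)"
    and "\<And>v. Ck_on k S (\<lambda>x. f' x v)"
  shows "Ck_on (Suc k) S f"
proof -
  have "frechet_derivative f (at x) = f' x" if "x \<in> S" for x
    using frechet_derivative_at[OF assms(2)[OF that]] by simp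
  then have "Ck_on k S (\<lambda>x. frechet_derivative f (at x) v)" for v
    by (intro Ck_on_cong[OF assms(1) _ assms(3)[of v]]) auto
  then show ?thesis using assms(2) by (auto simp: differentiable_def)
qed

lemma Ck_on_SucE:
  assumes "Ck_on (Suc k) S f"
  obtains f' where "\<And>x. x \<in> S \<Longrightarrow> (f has_derivative f' x) (at x)" "\<And>v. Ck_on k S (\<lambda>x. f' x v)"
proof (rule that[of "\<lambda>x. frechet_derivative f (at x)"])
  show "(f has_derivative frechet_derivative f (at x)) (at x)" if "x \<in> S" for x
    using assms that by (auto simp: frechet_derivative_works)
qed (use assms in auto)

lemma Ck_on_subset: "Ck_on k S f \<Longrightarrow> T \<subseteq> S \<Longrightarrow> Ck_on k T f"
  by (induction k arbitrary: f) (auto intro: continuous_on_subset)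

lemma Ck_on_SucD: "Ck_on (Suc k) S f \<Longrightarrow> Ck_on k S f"
proof (induction k arbitrary: f)
  case 0
  then show ?case
    by (auto intro!: continuous_at_imp_continuous_on dest: differentiable_imp_continuous_within)
next
  case (Suc k)
  then show ?case by (metis Ck_on.simps(2))
qed

lemma Ck_on_openI:
  assumes "\<And>x. x \<in> S \<Longrightarrow> \<exists>T. open T \<and> x \<in> T \<and> Ck_on k T f"
  shows "Ck_on k S f"
  using assms
proof (induction k arbitrary: f)
  case 0
  then have "isCont f x" if "x \<in> S" for x
    using that by (metis Ck_on.simps(1) continuous_on_eq_continuous_at)
  then show ?case by (simp add: continuous_at_imp_continuous_on)
next
  case (Suc k)
  show ?case
    unfolding Ck_on.simps
  proof (intro conjI ballI allI)
    show "f differentiable (at x)" if "x \<in> S" for x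
      using Suc.prems[OF that] by auto
    show "Ck_on k S (\<lambda>x. frechet_derivative f (at x) v)" for v
      by (rule Suc.IH) (use Suc.prems in \<open>metis Ck_on.simps(2)\<close>)
  qed
qed

lemma Ck_on_const: "open S \<Longrightarrow> Ck_on k S (\<lambda>x. c)"
proof (induction k arbitrary: c)
  case (Suc k)
  then show ?case by (intro Ck_on_SucI[where f' = "\<lambda>x v. 0"]) auto
qed auto

lemma Ck_on_linear: "open S \<Longrightarrow> bounded_linear f \<Longrightarrow> Ck_on k S f"
proof (cases k)
  case (Suc j)
  assume "open S" "bounded_linear f"
  then show ?thesis unfolding Suc
    by (intro Ck_on_SucI[where f' = "\<lambda>x. f"] Ck_on_const bounded_linear_imp_has_derivative) auto
qed (auto intro: linear_continuous_on)

lemma Ck_on_add: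
  assumes "open S"
  shows "Ck_on k S f \<Longrightarrow> Ck_on k S g \<Longrightarrow> Ck_on k S (\<lambda>x. f x + g x)"
proof (induction k arbitrary: f g)
  case (Suc k)
  obtain f' where f': "\<And>x. x \<in> S \<Longrightarrow> (f has_derivative f' x) (at x)" "\<And>v. Ck_on k S (\<lambda>x. f' x v)"
    by (rule Ck_on_SucE[OF Suc.prems(1)]) blast
  obtain g' where g': "\<And>x. x \<in> S \<Longrightarrow> (g has_derivative g' x) (at x)" "\<And>v. Ck_on k S (\<lambda>x. g' x v)"
    by (rule Ck_on_SucE[OF Suc.prems(2)]) blast
  show ?case
    by (intro Ck_on_SucI[where f' = "\<lambda>x v. f' x v + g' x v"] assms Suc.IH f' g' has_derivative_add)
qed (auto intro: continuous_on_add)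

lemma Ck_on_bilinear:
  assumes "open S" "bounded_bilinear B"
  shows "Ck_on k S f \<Longrightarrow> Ck_on k S g \<Longrightarrow> Ck_on k S (\<lambda>x. B (f x) (g x))"
proof (induction k arbitrary: f g)
  case 0
  then show ?case by (auto intro: bounded_bilinear.continuous_on[OF assms(2)])
next
  case (Suc k)
  obtain f' where f': "\<And>x. x \<in> S \<Longrightarrow> (f has_derivative f' x) (at x)" "\<And>v. Ck_on k S (\<lambda>x. f' x v)"
    by (rule Ck_on_SucE[OF Suc.prems(1)]) blast
  obtain g' where g': "\<And>x. x \<in> S \<Longrightarrow> (g has_derivative g' x) (at x)" "\<And>v. Ck_on k S (\<lambda>x. g' x v)"
    by (rule Ck_on_SucE[OF Suc.prems(2)]) blast
  show ?case
    by (intro Ck_on_SucI[where f' = "\<lambda>x v. B (f x) (g' x v) + B (f' x v) (g x)"] assms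
        Suc.IH f' g' bounded_bilinear.FDERIV[OF assms(2)] Ck_on_add
        Ck_on_SucD[OF Suc.prems(1)] Ck_on_SucD[OF Suc.prems(2)])
qed

lemmas Ck_on_mult = Ck_on_bilinear[OF _ bounded_bilinear_mult]

lemma Ck_on_sum:
  assumes "open S" "\<And>i. i \<in> I \<Longrightarrow> Ck_on k S (f i)"
  shows "Ck_on k S (\<lambda>x. \<Sum>i\<in>I. f i x)"
  using assms(2)
  by (induction I rule: infinite_finite_induct) (auto intro: Ck_on_const Ck_on_add assms(1))

lemma Ck_on_inverse:
  fixes f :: "'a::real_normed_vector \<Rightarrow> real"
  assumes "open S" "\<And>x. x \<in> S \<Longrightarrow> f x \<noteq> 0"
  shows "Ck_on k S f \<Longrightarrow> Ck_on k S (\<lambda>x. inverse (f x))"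
proof (induction k)
  case 0
  then show ?case using assms(2) by (auto intro: continuous_on_inverse)
next
  case (Suc k)
  obtain f' where f': "\<And>x. x \<in> S \<Longrightarrow> (f has_derivative f' x) (at x)" "\<And>v. Ck_on k S (\<lambda>x. f' x v)"
    by (rule Ck_on_SucE[OF Suc.prems(1)]) blast
  have i: "Ck_on k S (\<lambda>x. inverse (f x))"
    by (rule Suc.IH[OF Ck_on_SucD[OF Suc.prems]])
  show ?case
  proof (rule Ck_on_SucI[where f' = "\<lambda>x v. (-1) * (inverse (f x) * f' x v * inverse (f x))", OF assms(1)])
    show "((\<lambda>x. inverse (f x)) has_derivative (\<lambda>v. -1 * (inverse (f x) * f' x v * inverse (f x)))) (at x)"
      if "x \<in> S" for x
      using Deriv.has_derivative_inverse[OF assms(2) f'(1), OF that that] by simp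
    show "Ck_on k S (\<lambda>x. -1 * (inverse (f x) * f' x v * inverse (f x)))" for v
      by (intro Ck_on_mult Ck_on_const assms i f')
  qed
qed

text \<open>Expanding the inner derivative in a basis turns the chain rule into a sum of products of
  directional derivatives, each of which is covered by the induction hypothesis.\<close>

lemma Ck_on_compose:
  fixes f :: "'b::euclidean_space \<Rightarrow> 'c::real_normed_vector"
  assumes "open S" "open T" "g ` S \<subseteq> T"
  shows "Ck_on k T f \<Longrightarrow> Ck_on k S g \<Longrightarrow> Ck_on k S (\<lambda>x. f (g x))"
proof (induction k arbitrary: f)
  case 0
  then show ?case using assms by (auto intro: continuous_on_compose2)
next
  case (Suc k)
  obtain f' where f': "\<And>x. x \<in> T \<Longrightarrow> (f has_derivative f' x) (at x)" "\<And>v. Ck_on k T (\<lambda>x. f' x v)"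
    by (rule Ck_on_SucE[OF Suc.prems(1)]) blast
  obtain g' where g': "\<And>x. x \<in> S \<Longrightarrow> (g has_derivative g' x) (at x)" "\<And>v. Ck_on k S (\<lambda>x. g' x v)"
    by (rule Ck_on_SucE[OF Suc.prems(2)]) blast
  have gk: "Ck_on k S g" by (rule Ck_on_SucD[OF Suc.prems(2)])
  show ?case
  proof (rule Ck_on_SucI[where f' = "\<lambda>x v. \<Sum>b\<in>Basis. (g' x v \<bullet> b) *\<^sub>R f' (g x) b", OF assms(1)])
    fix x assume x: "x \<in> S"
    then have gx: "g x \<in> T" using assms by auto
    have lin: "linear (f' (g x))" using f'(1)[OF gx] by (rule has_derivative_linear)
    have "f' (g x) (g' x v) = (\<Sum>b\<in>Basis. (g' x v \<bullet> b) *\<^sub>R f' (g x) b)" for v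
      by (subst euclidean_representation[symmetric, of "g' x v"])
        (simp only: linear_sum[OF lin] linear_cmul[OF lin])
    then show "((\<lambda>x. f (g x)) has_derivative (\<lambda>v. \<Sum>b\<in>Basis. (g' x v \<bullet> b) *\<^sub>R f' (g x) b)) (at x)"
      using has_derivative_compose[OF g'(1)[OF x] f'(1)[OF gx]] by simp
  next
    fix v
    show "Ck_on k S (\<lambda>x. \<Sum>b\<in>Basis. (g' x v \<bullet> b) *\<^sub>R f' (g x) b)"
      by (intro Ck_on_sum Ck_on_bilinear[OF _ bounded_bilinear_scaleR]
          Ck_on_bilinear[OF _ bounded_bilinear_inner] Ck_on_const assms g' Suc.IH f' gk)
  qed
qed

lemma smooth_on_cong:
  assumes "open S" "\<And>x. x \<in> S \<Longrightarrow> f x = g x" "smooth_on S f"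
  shows "smooth_on S g"
  unfolding smooth_on_def
proof
  show "Ck_on k S g" for k
    by (rule Ck_on_cong[OF assms(1,2)]) (use assms(3) in \<open>auto simp: smooth_on_def\<close>)
qed

lemma smooth_on_subset: "smooth_on S f \<Longrightarrow> T \<subseteq> S \<Longrightarrow> smooth_on T f"
  unfolding smooth_on_def using Ck_on_subset by blast

lemma smooth_on_openI:
  assumes "\<And>x. x \<in> S \<Longrightarrow> \<exists>T. open T \<and> x \<in> T \<and> smooth_on T f"
  shows "smooth_on S f"
  unfolding smooth_on_def
proof
  show "Ck_on k S f" for k
    by (rule Ck_on_openI) (use assms in \<open>unfold smooth_on_def, blast\<close>)
qed

lemma smooth_on_const: "open S \<Longrightarrow> smooth_on S (\<lambda>x. c)"
  by (simp add: smooth_on_def Ck_on_const)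

lemma smooth_on_linear: "open S \<Longrightarrow> bounded_linear f \<Longrightarrow> smooth_on S f"
  by (simp add: smooth_on_def Ck_on_linear)

lemma smooth_on_add:
  "open S \<Longrightarrow> smooth_on S f \<Longrightarrow> smooth_on S g \<Longrightarrow> smooth_on S (\<lambda>x. f x + g x)"
  by (simp add: smooth_on_def Ck_on_add)

lemma smooth_on_mult:
  fixes f g :: "'a::real_normed_vector \<Rightarrow> real"
  shows "open S \<Longrightarrow> smooth_on S f \<Longrightarrow> smooth_on S g \<Longrightarrow> smooth_on S (\<lambda>x. f x * g x)"
  by (simp add: smooth_on_def Ck_on_mult)

lemma smooth_on_inverse:
  fixes f :: "'a::real_normed_vector \<Rightarrow> real"
  shows "open S \<Longrightarrow> (\<And>x. x \<in> S \<Longrightarrow> f x \<noteq> 0) \<Longrightarrow> smooth_on S f \<Longrightarrow> smooth_on S (\<lambda>x. inverse (f x))"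
  by (simp add: smooth_on_def Ck_on_inverse)

lemma smooth_on_compose:
  fixes f :: "'b::euclidean_space \<Rightarrow> 'c::real_normed_vector"
  shows "open S \<Longrightarrow> open T \<Longrightarrow> g ` S \<subseteq> T \<Longrightarrow> smooth_on T f \<Longrightarrow> smooth_on S g \<Longrightarrow>
    smooth_on S (\<lambda>x. f (g x))"
  by (simp add: smooth_on_def Ck_on_compose)

lemma smooth_on_directional_derivative:
  "smooth_on S f \<Longrightarrow> smooth_on S (\<lambda>x. frechet_derivative f (at x) v)"
  unfolding smooth_on_def by (metis Ck_on.simps(2))

lemma smooth_on_differentiable: "smooth_on S f \<Longrightarrow> x \<in> S \<Longrightarrow> f differentiable (at x)"
  unfolding smooth_on_def by (metis Ck_on.simps(2))

lemma smooth_on_continuous: "smooth_on S f \<Longrightarrow> continuous_on S f"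
  unfolding smooth_on_def by (metis Ck_on.simps(1))

section \<open>Cutoff functions\<close>

text \<open>The functions \<open>t\<^sup>-\<^sup>n exp(-1/t)\<close>, extended by \<open>0\<close>. With the
  parameter \<open>n\<close> the family is closed under differentiation up to linear combinations
  (\<open>flat_deriv\<close>), so that smoothness is an induction over the order.\<close>

definition flat :: "nat \<Rightarrow> real \<Rightarrow> real" where
  "flat n t = (if t > 0 then exp (- inverse t) * inverse t ^ n else 0)"

lemma flat_tendsto_0: "(flat n \<longlongrightarrow> 0) (at 0)"
proof -
  have "((\<lambda>s. s ^ n / exp s) \<longlongrightarrow> 0) (at_top :: real filter)"
    by (rule tendsto_power_div_exp_0)
  then have "((\<lambda>t::real. inverse t ^ n / exp (inverse t)) \<longlongrightarrow> 0) (at_right 0)"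
    by (rule filterlim_compose[OF _ filterlim_inverse_at_top_right])
  then have r: "(flat n \<longlongrightarrow> 0) (at_right 0)"
    by (rule Lim_transform_eventually)
      (auto simp: eventually_at_right_less flat_def exp_minus field_simps
        intro!: eventually_mono[OF eventually_at_right_less])
  have "((\<lambda>t::real. 0::real) \<longlongrightarrow> 0) (at_left 0)" by simp
  then have l: "(flat n \<longlongrightarrow> 0) (at_left 0)"
    by (rule Lim_transform_eventually)
      (auto simp: flat_def eventually_at_filter)
  from l r show ?thesis by (simp add: filterlim_split_at)
qed

lemma flat_deriv:
  "(flat n has_real_derivative (flat (n + 2) t - real n * flat (n + 1) t)) (at t)"
proof (cases "t = 0")
  case True
  have "((\<lambda>h. (flat n (0 + h) - flat n 0) / h) \<longlongrightarrow> 0) (at 0)"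
    by (rule Lim_transform_eventually[OF flat_tendsto_0[of "Suc n"]])
      (auto simp: eventually_at_filter flat_def divide_simps)
  then show ?thesis using True by (simp add: DERIV_def flat_def)
next
  case False
  show ?thesis
  proof (cases "t > 0")
    case True
    have "((\<lambda>s. exp (- s) * s ^ n) has_real_derivative
        (exp (- s) * (real n * s ^ (n - 1)) - exp (- s) * s ^ n)) (at s)" for s :: real
      by (auto intro!: derivative_eq_intros)
    from DERIV_chain2[OF this DERIV_inverse, of t]
    have "((\<lambda>t. exp (- inverse t) * inverse t ^ n) has_real_derivative
        (flat (n + 2) t - real n * flat (n + 1) t)) (at t)"
      using True by (cases n) (auto simp: flat_def algebra_simps elim!: DERIV_cong)
    then show ?thesis
      by (rule DERIV_cong_ev[THEN iffD1, rotated -1])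
        (use True in \<open>auto simp: flat_def intro!: eventually_nhds_in_open[of "{0<..}", THEN eventually_mono]\<close>)
  next
    case f: False
    then have "t < 0" using False by simp
    have "((\<lambda>t. 0) has_real_derivative
        (flat (n + 2) t - real n * flat (n + 1) t)) (at t)"
      using f by (auto simp: flat_def)
    then show ?thesis
      by (rule DERIV_cong_ev[THEN iffD1, rotated -1])
        (use \<open>t < 0\<close> in \<open>auto simp: flat_def intro!: eventually_nhds_in_open[of "{..<0}", THEN eventually_mono]\<close>)
  qed
qed

lemma Ck_on_flat: "Ck_on k UNIV (flat n)"
proof (induction k arbitrary: n)
  case 0
  have "isCont (flat n) t" for t by (rule DERIV_isCont[OF flat_deriv])
  then show ?case by (simp add: continuous_at_imp_continuous_on)
next
  case (Suc k)
  have eq: "(\<lambda>t. (flat (n + 2) t - real n * flat (n + 1) t) * v)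
      = (\<lambda>t. (flat (n + 2) t + (- real n) * flat (n + 1) t) * v)" for v by auto
  show ?case
    by (rule Ck_on_SucI[where f' = "\<lambda>t v. (flat (n + 2) t - real n * flat (n + 1) t) * v"])
      (auto simp only: eq open_UNIV flat_deriv[unfolded has_field_derivative_def]
        intro!: Ck_on_add Ck_on_mult Ck_on_const Suc)
qed

lemma smooth_on_flat: "smooth_on UNIV (flat n)"
  by (simp add: smooth_on_def Ck_on_flat)

text \<open>The quotient \<open>u / (u + w)\<close>, where \<open>u\<close> vanishes outside the large ball,
  \<open>w\<close> vanishes on the small one, and never both at once.\<close>

lemma smooth_cutoff:
  fixes a :: "'a::euclidean_space"
  assumes "0 < r" "r < R"
  obtains \<rho> :: "'a \<Rightarrow> real" where "smooth_on UNIV \<rho>" "\<And>x. dist x a \<le> r \<Longrightarrow> \<rho> x = 1"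
    "\<And>x. dist x a \<ge> R \<Longrightarrow> \<rho> x = 0"
proof
  \<comment> \<open>The squared distance is smooth at the centre, unlike the distance.\<close>
  define q where "q x = (x - a) \<bullet> (x - a)" for x :: 'a
  have q: "q x = (dist x a)\<^sup>2" for x by (simp add: q_def dist_norm power2_norm_eq_inner)
  have id: "Ck_on k UNIV (\<lambda>x::'a. x + - a)" for k
    by (intro Ck_on_add Ck_on_const Ck_on_linear bounded_linear_ident) auto
  have "smooth_on UNIV (\<lambda>x::'a. (x + - a) \<bullet> (x + - a))"
    unfolding smooth_on_def by (intro allI Ck_on_bilinear[OF _ bounded_bilinear_inner] id open_UNIV)
  then have sq: "smooth_on UNIV q" by (simp add: q_def[abs_def])
  define u where "u x = flat 0 (R\<^sup>2 + (-1) * q x)" for x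
  define w where "w x = flat 0 (q x + - (r\<^sup>2))" for x
  have su: "smooth_on UNIV u" unfolding u_def
    by (rule smooth_on_compose[OF _ _ _ smooth_on_flat]) (auto simp only: open_UNIV subset_UNIV intro!: smooth_on_add smooth_on_mult smooth_on_const sq)
  have sw: "smooth_on UNIV w" unfolding w_def
    by (rule smooth_on_compose[OF _ _ _ smooth_on_flat]) (auto simp only: open_UNIV subset_UNIV intro!: smooth_on_add smooth_on_const sq)
  have pos: "u x + w x \<noteq> 0" for x
  proof -
    have "r\<^sup>2 < R\<^sup>2" using assms by (simp add: power_strict_mono)
    then consider "R\<^sup>2 + (-1) * q x > 0" | "q x + - (r\<^sup>2) > 0" by fastforce
    then have "u x > 0 \<and> w x \<ge> 0 \<or> u x \<ge> 0 \<and> w x > 0"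
      by cases (auto simp: u_def w_def flat_def)
    then show ?thesis by auto
  qed
  show "smooth_on UNIV (\<lambda>x. u x * inverse (u x + w x))"
    by (intro smooth_on_mult smooth_on_inverse smooth_on_add su sw pos open_UNIV)
  show "u x * inverse (u x + w x) = 1" if "dist x a \<le> r" for x
  proof -
    have "q x \<le> r\<^sup>2" using that by (simp add: q power_mono)
    then show ?thesis using pos[of x] by (simp add: w_def flat_def)
  qed
  show "u x * inverse (u x + w x) = 0" if "dist x a \<ge> R" for x
  proof -
    have "q x \<ge> R\<^sup>2" using that assms by (simp add: q power_mono)
    then show ?thesis by (simp add: u_def flat_def)
  qed
qed

section \<open>Hadamard's lemma\<close>

text \<open>The weight \<open>t\<^sup>m\<close> is there for the induction: differentiating under the integral
  sign produces one more factor \<open>t\<close>.\<close>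

lemma Ck_on_ray_integral:
  fixes u :: "'a::euclidean_space \<Rightarrow> real"
  assumes "smooth_on (ball a r) u"
  shows "Ck_on k (ball a r) (\<lambda>x. integral (cbox 0 1) (\<lambda>t::real. t ^ m * u (a + t *\<^sub>R (x - a))))"
  using assms
proof (induction k arbitrary: m u)
  have ray: "a + t *\<^sub>R (x - a) \<in> ball a r" if "x \<in> ball a r" "t \<in> cbox 0 1" for x and t :: real
  proof -
    have "norm (t *\<^sub>R (x - a)) \<le> norm (x - a)"
      using that(2) by (simp add: mult_left_le_one_le)
    then show ?thesis using that(1) by (simp add: dist_norm norm_minus_commute)
  qed
  have cont: "continuous_on (ball a r \<times> cbox 0 1) (\<lambda>(x, t::real). t ^ m * u (a + t *\<^sub>R (x - a)))"
    if "smooth_on (ball a r) u" for m and u :: "'a \<Rightarrow> real"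
    unfolding split_beta
    by (intro continuous_intros continuous_on_compose2[OF smooth_on_continuous[OF that]])
      (use ray in auto)
  {
    case 0
    show ?case unfolding Ck_on.simps by (rule integral_continuous_on_param[OF cont[OF 0]])
  next
    case (Suc k)
    let ?D = "\<lambda>y v. frechet_derivative u (at y) v"
    have D: "(u has_derivative ?D y) (at y)" if "y \<in> ball a r" for y
      using smooth_on_differentiable[OF Suc.prems that] by (simp add: frechet_derivative_works)
    define F where "F x t = (\<Sum>b\<in>Basis. (t ^ Suc m * ?D (a + t *\<^sub>R (x - a)) b) *\<^sub>R blinfun_inner_left b)"
      for x and t :: real
    have F: "blinfun_apply (F x t) v = t ^ Suc m * ?D (a + t *\<^sub>R (x - a)) v"
      if "x \<in> ball a r" "t \<in> cbox 0 1" for x t v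
    proof -
      have lin: "linear (?D (a + t *\<^sub>R (x - a)))"
        using D[OF ray[OF that]] by (rule has_derivative_linear)
      have "?D (a + t *\<^sub>R (x - a)) v = (\<Sum>b\<in>Basis. (v \<bullet> b) *\<^sub>R ?D (a + t *\<^sub>R (x - a)) b)"
        by (subst euclidean_representation[symmetric, of v])
          (simp only: linear_sum[OF lin] linear_cmul[OF lin])
      then show ?thesis
        by (simp add: F_def blinfun.sum_left blinfun.scaleR_left sum_distrib_left mult_ac)
    qed
    have contF: "continuous_on (ball a r \<times> cbox 0 1) (\<lambda>(x, t). F x t)"
      unfolding F_def split_beta
      by (intro continuous_intros cont[unfolded split_beta] smooth_on_directional_derivative Suc.prems)
    have contF1: "continuous_on (cbox 0 1) (F x)" if "x \<in> ball a r" for x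
    proof -
      have "Pair x ` cbox 0 1 \<subseteq> ball a r \<times> cbox 0 1" using that by auto
      from continuous_on_compose2[OF contF _ this] show ?thesis
        by (simp add: continuous_on_Pair del: cbox_interval)
    qed
    show ?case
    proof (rule Ck_on_SucI[where f' = "\<lambda>x v. integral (cbox 0 1) (\<lambda>t. t ^ Suc m * ?D (a + t *\<^sub>R (x - a)) v)"])
      show "Ck_on k (ball a r) (\<lambda>x. integral (cbox 0 1) (\<lambda>t. t ^ Suc m * ?D (a + t *\<^sub>R (x - a)) v))" for v
        by (rule Suc.IH) (intro smooth_on_directional_derivative Suc.prems)
      fix x assume x: "x \<in> ball a r"
      have "((\<lambda>x. integral (cbox 0 1) (\<lambda>t. t ^ m * u (a + t *\<^sub>R (x - a)))) has_derivative
         integral (cbox 0 1) (F x)) (at x within ball a r)"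
      proof (rule leibniz_rule)
        fix y and t :: real assume y: "y \<in> ball a r" and t: "t \<in> cbox 0 1"
        have "((\<lambda>y. a + t *\<^sub>R (y - a)) has_derivative (\<lambda>v. t *\<^sub>R v)) (at y within ball a r)"
          by (auto intro!: derivative_eq_intros)
        from has_derivative_compose[OF this D[OF ray[OF y t]]]
        have "((\<lambda>y. u (a + t *\<^sub>R (y - a))) has_derivative (\<lambda>v. ?D (a + t *\<^sub>R (y - a)) (t *\<^sub>R v)))
          (at y within ball a r)" .
        from has_derivative_mult_right[OF this, of "t ^ m"]
        show "((\<lambda>y. t ^ m * u (a + t *\<^sub>R (y - a))) has_derivative blinfun_apply (F y t))
          (at y within ball a r)"
          by (rule has_derivative_eq_rhs)
            (auto simp: F[OF y t] linear_cmul[OF has_derivative_linear[OF D[OF ray[OF y t]]]])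
      next
        fix y assume y: "y \<in> ball a r"
        show "(\<lambda>t. t ^ m * u (a + t *\<^sub>R (y - a))) integrable_on cbox 0 1"
        proof (rule integrable_continuous)
          have "Pair y ` cbox 0 1 \<subseteq> ball a r \<times> cbox 0 1" using y by auto
          from continuous_on_compose2[OF cont[OF Suc.prems] _ this]
          show "continuous_on (cbox 0 1) (\<lambda>t. t ^ m * u (a + t *\<^sub>R (y - a)))"
            by (simp add: continuous_on_Pair del: cbox_interval)
        qed
      qed (use x contF in auto)
      moreover have "blinfun_apply (integral (cbox 0 1) (F x)) =
          (\<lambda>v. integral (cbox 0 1) (\<lambda>t. t ^ Suc m * ?D (a + t *\<^sub>R (x - a)) v))"
        unfolding blinfun_apply_integral[OF integrable_continuous[OF contF1[OF x]]]
        by (intro ext integral_cong F[OF x])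
      ultimately show "((\<lambda>x. integral (cbox 0 1) (\<lambda>t. t ^ m * u (a + t *\<^sub>R (x - a)))) has_derivative
         (\<lambda>v. integral (cbox 0 1) (\<lambda>t. t ^ Suc m * ?D (a + t *\<^sub>R (x - a)) v))) (at x)"
        using at_within_open[OF x open_ball] by metis
    qed simp
  }
qed

text \<open>Integrate the derivative of \<open>g\<close> along the ray from \<open>a\<close> to
  \<open>x\<close>.\<close>

lemma Hadamard_lemma:
  fixes g :: "'a::euclidean_space \<Rightarrow> real"
  assumes g: "smooth_on (ball a r) g"
  obtains h where "\<And>b. smooth_on (ball a r) (h b)"
    "\<And>x. x \<in> ball a r \<Longrightarrow> g x = g a + (\<Sum>b\<in>Basis. ((x - a) \<bullet> b) * h b x)"
    "\<And>b. h b a = frechet_derivative g (at a) b"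
proof
  let ?D = "\<lambda>y v. frechet_derivative g (at y) v"
  define h where "h b x = integral (cbox 0 1) (\<lambda>t::real. t ^ 0 * ?D (a + t *\<^sub>R (x - a)) b)" for b x
  show "smooth_on (ball a r) (h b)" for b
    unfolding smooth_on_def h_def
    by (intro allI Ck_on_ray_integral smooth_on_directional_derivative g)
  show "h b a = ?D a b" for b by (simp add: h_def)
  fix x assume x: "x \<in> ball a r"
  have ray: "a + t *\<^sub>R (x - a) \<in> ball a r" if "t \<in> {0..1}" for t :: real
  proof -
    have "norm (t *\<^sub>R (x - a)) \<le> norm (x - a)"
      using that by (simp add: mult_left_le_one_le)
    then show ?thesis using x by (simp add: dist_norm norm_minus_commute)
  qed
  have D: "(g has_derivative ?D y) (at y)" if "y \<in> ball a r" for y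
    using smooth_on_differentiable[OF g that] by (simp add: frechet_derivative_works)
  have "((\<lambda>t. ?D (a + t *\<^sub>R (x - a)) (x - a)) has_integral
      (g (a + 1 *\<^sub>R (x - a)) - g (a + 0 *\<^sub>R (x - a)))) {0..1::real}"
  proof (rule fundamental_theorem_of_calculus)
    fix t :: real assume t: "t \<in> {0..1}"
    have "((\<lambda>t. a + t *\<^sub>R (x - a)) has_derivative (\<lambda>s. s *\<^sub>R (x - a))) (at t within {0..1})"
      by (auto intro!: derivative_eq_intros)
    from has_derivative_compose[OF this D[OF ray[OF t]]]
    show "((\<lambda>t. g (a + t *\<^sub>R (x - a))) has_vector_derivative ?D (a + t *\<^sub>R (x - a)) (x - a)) (at t within {0..1})"
      unfolding has_vector_derivative_def
      by (rule has_derivative_eq_rhs)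
        (auto simp: linear_cmul[OF has_derivative_linear[OF D[OF ray[OF t]]]])
  qed simp
  then have 1: "integral {0..1} (\<lambda>t::real. ?D (a + t *\<^sub>R (x - a)) (x - a)) = g x - g a"
    by (simp add: integral_unique)
  have int: "(\<lambda>t::real. ?D (a + t *\<^sub>R (x - a)) b) integrable_on {0..1}" for b
    by (intro integrable_continuous_interval continuous_intros
        continuous_on_compose2[OF smooth_on_continuous[OF smooth_on_directional_derivative[OF g]]])
      (use ray in auto)
  have "?D (a + t *\<^sub>R (x - a)) (x - a) = (\<Sum>b\<in>Basis. ((x - a) \<bullet> b) * ?D (a + t *\<^sub>R (x - a)) b)"
    if "t \<in> {0..1}" for t
  proof -
    have lin: "linear (?D (a + t *\<^sub>R (x - a)))"
      using D[OF ray[OF that]] by (rule has_derivative_linear)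
    show ?thesis
      by (subst (2) euclidean_representation[symmetric])
        (simp only: linear_sum[OF lin] linear_cmul[OF lin] real_scaleR_def)
  qed
  then have "integral {0..1} (\<lambda>t::real. ?D (a + t *\<^sub>R (x - a)) (x - a)) =
      integral {0..1} (\<lambda>t::real. \<Sum>b\<in>Basis. ((x - a) \<bullet> b) * ?D (a + t *\<^sub>R (x - a)) b)"
    by (intro integral_cong) auto
  also have "\<dots> = (\<Sum>b\<in>Basis. ((x - a) \<bullet> b) * h b x)"
    by (subst integral_sum) (auto simp: h_def intro!: integrable_on_mult_right int)
  finally show "g x = g a + (\<Sum>b\<in>Basis. ((x - a) \<bullet> b) * h b x)"
    using 1 by simp
qed

section \<open>Antisymmetrization, wedge powers and Pfaffians\<close>

abbreviation swap :: "nat \<Rightarrow> nat \<Rightarrow> nat \<Rightarrow> nat" where "swap \<equiv> Transposition.transpose"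

lemma sum_permutes_right:
  assumes q: "q permutes S"
  shows "(\<Sum>p | p permutes S. f (p \<circ> q)) = (\<Sum>p | p permutes S. f p)"
  by (rule sum.reindex_bij_witness[of _ "\<lambda>p. p \<circ> inv q" "\<lambda>p. p \<circ> q"])
    (auto simp: comp_assoc permutes_inv_o[OF q] intro: permutes_compose q permutes_inv)

lemma sum_permutes_left:
  assumes q: "q permutes S"
  shows "(\<Sum>p | p permutes S. f (q \<circ> p)) = (\<Sum>p | p permutes S. f p)"
  by (rule sum.reindex_bij_witness[of _ "\<lambda>p. inv q \<circ> p" "\<lambda>p. q \<circ> p"])
    (auto simp: comp_assoc[symmetric] permutes_inv_o[OF q] intro: permutes_compose q permutes_inv)

lemma sign_comp:
  assumes "p permutes {..<N::nat}" "q permutes {..<N}"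
  shows "sign (p \<circ> q) = sign p * sign q"
  using assms by (intro sign_compose permutes_imp_permutation[of "{..<N}"]) auto

text \<open>A permutation of the first \<open>l\<close> indices, moved to act on the indices from
  \<open>k\<close> on.\<close>

definition shift :: "nat \<Rightarrow> (nat \<Rightarrow> nat) \<Rightarrow> nat \<Rightarrow> nat" where
  "shift k \<tau> j = (if j < k then j else k + \<tau> (j - k))"

lemma shift_simps [simp]: "j < k \<Longrightarrow> shift k \<tau> j = j" "shift k \<tau> (k + j) = k + \<tau> j"
  by (auto simp: shift_def)

lemma shift_eq_map_permutation:
  assumes "\<tau> permutes {..<l}"
  shows "shift k \<tau> = map_permutation {..<l} ((+) k) \<tau>"
proof
  fix j
  have inj: "inj_on ((+) k) {..<l}" by (simp add: inj_on_def)
  have im: "(+) k ` {..<l} = {k..<k+l}"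
    by (auto simp: lessThan_atLeast0 image_add_atLeastLessThan)
  show "shift k \<tau> j = map_permutation {..<l} ((+) k) \<tau> j"
  proof (cases "j \<in> {k..<k+l}")
    case True
    then obtain i where "i \<in> {..<l}" "j = k + i" using im by blast
    then show ?thesis using map_permutation_apply[OF inj, of i \<tau>] by (simp add: shift_def)
  next
    case False
    then have "map_permutation {..<l} ((+) k) \<tau> j = j"
      unfolding map_permutation_def restrict_id_def im by (rule if_not_P)
    moreover have "\<tau> (j - k) = j - k" if "\<not> j < k"
      using False that by (intro permutes_not_in[OF assms]) auto
    ultimately show ?thesis by (auto simp: shift_def)
  qed
qed

lemma shift_permutes:
  assumes "\<tau> permutes {..<l}"
  shows "shift k \<tau> permutes {..<k + l}" "sign (shift k \<tau>) = sign \<tau>"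
proof -
  have b: "bij_betw ((+) k) {..<l} {k..<k+l}"
    by (rule bij_betwI[of _ _ _ "\<lambda>j. j - k"]) auto
  have "shift k \<tau> permutes {k..<k+l}"
    unfolding shift_eq_map_permutation[OF assms] by (rule map_permutation_permutes[OF b assms])
  then show "shift k \<tau> permutes {..<k + l}" by (rule permutes_subset) auto
  show "sign (shift k \<tau>) = sign \<tau>"
    unfolding shift_eq_map_permutation[OF assms]
    by (rule sign_map_permutation) (use assms in \<open>auto simp: inj_on_def\<close>)
qed

lemma sum_permutes_shift:
  "(\<Sum>\<sigma> | \<sigma> permutes {..<k + l} \<and> (\<forall>i<k. \<sigma> i = i). f \<sigma>) = (\<Sum>\<tau> | \<tau> permutes {..<l}. f (shift k \<tau>))"
proof (rule sum.reindex_bij_witness[of _ "shift k" "\<lambda>\<sigma> j. \<sigma> (k + j) - k"])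
  fix \<sigma> assume "\<sigma> \<in> {\<sigma>. \<sigma> permutes {..<k + l} \<and> (\<forall>i<k. \<sigma> i = i)}"
  then have \<sigma>: "\<sigma> permutes {..<k + l}" "\<And>i. i < k \<Longrightarrow> \<sigma> i = i" by auto
  have ge: "\<sigma> j \<ge> k" if "j \<ge> k" for j
  proof (rule ccontr)
    assume "\<not> k \<le> \<sigma> j"
    then have "\<sigma> (\<sigma> j) = \<sigma> j" "\<sigma> j < k" using \<sigma>(2) by auto
    then show False using injD[OF permutes_inj[OF \<sigma>(1)], of "\<sigma> j" j] that by simp
  qed
  show eq: "shift k (\<lambda>j. \<sigma> (k + j) - k) = \<sigma>"
    using \<sigma>(2) ge by (auto simp: shift_def fun_eq_iff)
  then show "f (shift k (\<lambda>j. \<sigma> (k + j) - k)) = f \<sigma>" by simp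
  show "(\<lambda>j. \<sigma> (k + j) - k) \<in> {\<tau>. \<tau> permutes {..<l}}"
  proof (simp, rule bij_imp_permutes)
    have "inj_on (\<lambda>j. \<sigma> (k + j) - k) {..<l}"
    proof (rule inj_onI)
      fix i j assume "\<sigma> (k + i) - k = \<sigma> (k + j) - k"
      then have "\<sigma> (k + i) = \<sigma> (k + j)" using ge[of "k+i"] ge[of "k+j"] by simp
      then show "i = j" using injD[OF permutes_inj[OF \<sigma>(1)], of "k + i" "k + j"] by simp
    qed
    moreover have "(\<lambda>j. \<sigma> (k + j) - k) ` {..<l} \<subseteq> {..<l}"
    proof (rule image_subsetI)
      fix j assume "j \<in> {..<l}"
      then have "\<sigma> (k + j) < k + l" using permutes_in_image[OF \<sigma>(1), of "k + j"] by simp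
      then show "\<sigma> (k + j) - k \<in> {..<l}" using ge[of "k+j"] by simp
    qed
    ultimately show "bij_betw (\<lambda>j. \<sigma> (k + j) - k) {..<l} {..<l}"
      by (simp add: bij_betw_def endo_inj_surj)
    fix j assume "j \<notin> {..<l}"
    then show "\<sigma> (k + j) - k = j" using permutes_not_in[OF \<sigma>(1), of "k + j"] by simp
  qed
next
  fix \<tau> assume "\<tau> \<in> {\<tau>. \<tau> permutes {..<l}}"
  then show "shift k \<tau> \<in> {\<sigma>. \<sigma> permutes {..<k + l} \<and> (\<forall>i<k. \<sigma> i = i)}"
    using shift_permutes by auto
  show "(\<lambda>j. shift k \<tau> (k + j) - k) = \<tau>" by simp
qed

definition alt :: "nat \<Rightarrow> ((nat \<Rightarrow> 'v) \<Rightarrow> real) \<Rightarrow> (nat \<Rightarrow> 'v) \<Rightarrow> real" where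
  "alt N t v = (\<Sum>\<sigma> | \<sigma> permutes {..<N}. of_int (sign \<sigma>) * t (v \<circ> \<sigma>))"

text \<open>Antisymmetrizing a part of the arguments before antisymmetrizing all of them only multiplies by
  the number of partial permutations, since each partial permutation can be absorbed in the full
  sum. This is how nested wedge products flatten to a single sum over permutations.\<close>

lemma alt_absorb:
  assumes "\<And>v w. (\<And>i. i < k \<Longrightarrow> v i = w i) \<Longrightarrow> a v = a w"
  shows "alt (k + l) (\<lambda>v. a v * alt l t (\<lambda>i. v (k + i))) v =
    fact l * alt (k + l) (\<lambda>v. a v * t (\<lambda>i. v (k + i))) v"
proof -
  let ?P = "{\<sigma>. \<sigma> permutes {..<k + l}}" and ?Q = "{\<tau>. \<tau> permutes {..<l}}"
  let ?g = "\<lambda>\<rho>. of_int (sign \<rho>) * (a (v \<circ> \<rho>) * t (\<lambda>i. (v \<circ> \<rho>) (k + i)))"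
  have *: "of_int (sign \<sigma>) * (a (v \<circ> \<sigma>) * (of_int (sign \<tau>) * t ((\<lambda>i. (v \<circ> \<sigma>) (k + i)) \<circ> \<tau>)))
     = ?g (\<sigma> \<circ> shift k \<tau>)" if "\<sigma> \<in> ?P" "\<tau> \<in> ?Q" for \<sigma> \<tau>
  proof -
    have "a (v \<circ> \<sigma>) = a (v \<circ> (\<sigma> \<circ> shift k \<tau>))" by (rule assms) simp
    moreover have "(\<lambda>i. (v \<circ> \<sigma>) (k + i)) \<circ> \<tau> = (\<lambda>i. (v \<circ> (\<sigma> \<circ> shift k \<tau>)) (k + i))" by auto
    moreover have "sign (\<sigma> \<circ> shift k \<tau>) = sign \<sigma> * sign \<tau>"
      using that shift_permutes[of \<tau> l k] by (simp add: sign_comp)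
    ultimately show ?thesis by simp
  qed
  have "alt (k + l) (\<lambda>v. a v * alt l t (\<lambda>i. v (k + i))) v =
      (\<Sum>\<sigma>\<in>?P. \<Sum>\<tau>\<in>?Q. of_int (sign \<sigma>) * (a (v \<circ> \<sigma>) * (of_int (sign \<tau>) * t ((\<lambda>i. (v \<circ> \<sigma>) (k + i)) \<circ> \<tau>))))"
    by (simp add: alt_def sum_distrib_left)
  also have "\<dots> = (\<Sum>\<sigma>\<in>?P. \<Sum>\<tau>\<in>?Q. ?g (\<sigma> \<circ> shift k \<tau>))"
    using * by (intro sum.cong refl) blast
  also have "\<dots> = (\<Sum>\<tau>\<in>?Q. \<Sum>\<sigma>\<in>?P. ?g (\<sigma> \<circ> shift k \<tau>))"
    by (rule sum.swap)
  also have "\<dots> = (\<Sum>\<tau>\<in>?Q. \<Sum>\<sigma>\<in>?P. ?g \<sigma>)"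
    using shift_permutes(1)[of _ l k] by (intro sum.cong refl sum_permutes_right) auto
  also have "\<dots> = fact l * alt (k + l) (\<lambda>v. a v * t (\<lambda>i. v (k + i))) v"
    by (simp add: alt_def card_permutations)
  finally show ?thesis .
qed

lemma wedge_eq_alt:
  assumes "\<And>v w. (\<And>i. i < k \<Longrightarrow> v i = w i) \<Longrightarrow> a v = a w"
    and "\<And>v. b v = c * alt l t v"
  shows "wedge k l a b v = c / fact k * alt (k + l) (\<lambda>v. a v * t (\<lambda>i. v (k + i))) v"
proof -
  have "wedge k l a b v = c * alt (k + l) (\<lambda>v. a v * alt l t (\<lambda>i. v (k + i))) v / (fact k * fact l)"
    by (simp add: wedge_def alt_def[of "k + l"] assms(2) sum_distrib_left o_def mult_ac)
  then show ?thesis using alt_absorb[of k a l t v, OF assms(1)] by simp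
qed

text \<open>Only the sign of the normalizing constant matters for the contact condition, so it is left
  unspecified.\<close>

lemma wedge_power_eq_alt:
  "\<exists>c>0. \<forall>v. wedge_power 2 (\<lambda>u. \<omega> (u 0) (u 1)) m v =
     c * alt (2 * m) (\<lambda>v. \<Prod>i<m. \<omega> (v (2 * i)) (v (Suc (2 * i)))) v"
proof (induction m)
  case 0
  have "alt 0 (\<lambda>v. 1) v = 1" for v :: "nat \<Rightarrow> 'a" by (simp add: alt_def)
  then show ?case by (intro exI[of _ 1]) simp
next
  case (Suc m)
  then obtain c where c: "c > 0" "\<And>v. wedge_power 2 (\<lambda>u. \<omega> (u 0) (u 1)) m v =
     c * alt (2 * m) (\<lambda>v. \<Prod>i<m. \<omega> (v (2 * i)) (v (Suc (2 * i)))) v" by auto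
  have "wedge_power 2 (\<lambda>u. \<omega> (u 0) (u 1)) (Suc m) v =
      c / fact 2 * alt (2 * Suc m) (\<lambda>v. \<Prod>i<Suc m. \<omega> (v (2 * i)) (v (Suc (2 * i)))) v" for v
    using wedge_eq_alt[of 2 "\<lambda>u. \<omega> (u 0) (u 1)", OF _ c(2), of v]
    by (simp add: prod.lessThan_Suc_shift del: prod.lessThan_Suc)
  then show ?case using c(1) by (intro exI[of _ "c / fact 2"]) simp
qed

text \<open>The classical Pfaffian of a skew \<open>2m \<times> 2m\<close> matrix, times \<open>2\<^sup>m
  m!\<close>.\<close>

definition pf :: "nat \<Rightarrow> (nat \<Rightarrow> nat \<Rightarrow> real) \<Rightarrow> real" where
  "pf m a = (\<Sum>\<sigma> | \<sigma> permutes {..<2 * m}. of_int (sign \<sigma>) * (\<Prod>i<m. a (\<sigma> (2 * i)) (\<sigma> (Suc (2 * i)))))"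

abbreviation pf_term :: "nat \<Rightarrow> (nat \<Rightarrow> nat \<Rightarrow> real) \<Rightarrow> (nat \<Rightarrow> nat) \<Rightarrow> real" where
  "pf_term m a \<sigma> \<equiv> of_int (sign \<sigma>) * (\<Prod>i<m. a (\<sigma> (2 * i)) (\<sigma> (Suc (2 * i))))"

lemma pf_term_flip:
  assumes skew: "\<And>i j. a i j = - a j i" and "i < m" and \<sigma>: "\<sigma> permutes {..<2 * m}"
  shows "pf_term m a (\<sigma> \<circ> swap (2 * i) (Suc (2 * i))) = pf_term m a \<sigma>"
proof -
  let ?\<rho> = "swap (2 * i) (Suc (2 * i))"
  have \<rho>: "?\<rho> permutes {..<2 * m}" using assms(2) by (intro permutes_swap_id) auto
  have "(\<Prod>k<m. a ((\<sigma> \<circ> ?\<rho>) (2 * k)) ((\<sigma> \<circ> ?\<rho>) (Suc (2 * k)))) =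
      (\<Prod>k<m. (if k = i then -1 else 1) * a (\<sigma> (2 * k)) (\<sigma> (Suc (2 * k))))"
  proof (rule prod.cong[OF refl])
    fix k
    show "a ((\<sigma> \<circ> ?\<rho>) (2 * k)) ((\<sigma> \<circ> ?\<rho>) (Suc (2 * k))) =
      (if k = i then -1 else 1) * a (\<sigma> (2 * k)) (\<sigma> (Suc (2 * k)))"
    proof (cases "k = i")
      case True
      then show ?thesis using skew[of "\<sigma> (Suc (2 * i))" "\<sigma> (2 * i)"] by simp
    next
      case False
      moreover have "2 * k \<noteq> Suc (2 * i)" "Suc (2 * k) \<noteq> 2 * i" by presburger+
      ultimately have "?\<rho> (2 * k) = 2 * k" "?\<rho> (Suc (2 * k)) = Suc (2 * k)"
        by (auto simp: Transposition.transpose_def)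
      then show ?thesis using False by simp
    qed
  qed
  also have "\<dots> = - (\<Prod>k<m. a (\<sigma> (2 * k)) (\<sigma> (Suc (2 * k))))"
    using assms(2) by (simp add: prod.distrib prod.delta)
  finally show ?thesis by (simp add: sign_comp[OF \<sigma> \<rho>] sign_swap_id)
qed

lemma pf_term_swap_pairs:
  assumes "i < m" and \<sigma>: "\<sigma> permutes {..<2 * m}"
  shows "pf_term m a (\<sigma> \<circ> (swap 0 (2 * i) \<circ> swap 1 (Suc (2 * i)))) = pf_term m a \<sigma>"
proof (cases "i = 0")
  case False
  let ?\<rho> = "swap 0 (2 * i) \<circ> swap 1 (Suc (2 * i))"
  have 1: "swap 0 (2 * i) permutes {..<2 * m}" "swap 1 (Suc (2 * i)) permutes {..<2 * m}"
    using assms(1) by (auto intro!: permutes_swap_id)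
  have "?\<rho> permutes {..<2*m}" by (intro permutes_compose 1)
  have sg: "sign ?\<rho> = 1" using False by (simp only: sign_comp[OF 1] sign_swap_id) simp
  have odd: "2 * j \<noteq> Suc (2 * k)" "Suc (2 * k) \<noteq> 2 * j" "2 * j \<noteq> 1" for j k :: nat by presburger+
  have \<rho>: "?\<rho> (2 * k) = 2 * swap 0 i k"
    "?\<rho> (Suc (2 * k)) = Suc (2 * swap 0 i k)" for k
    using odd by (auto simp: Transposition.transpose_def)
  have "(\<Prod>k<m. a ((\<sigma> \<circ> ?\<rho>) (2 * k)) ((\<sigma> \<circ> ?\<rho>) (Suc (2 * k)))) =
      (\<Prod>k<m. a (\<sigma> (2 * swap 0 i k)) (\<sigma> (Suc (2 * swap 0 i k))))"
    by (simp only: o_apply[of \<sigma>] \<rho>)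
  also have "\<dots> = (\<Prod>k<m. a (\<sigma> (2 * k)) (\<sigma> (Suc (2 * k))))"
    using assms(1) by (intro prod.reindex_bij_betw permutes_imp_bij permutes_swap_id) auto
  finally show ?thesis
    using sign_comp[OF \<sigma> \<open>?\<rho> permutes {..<2*m}\<close>] sg by simp
qed simp

text \<open>Permuting the pairs and flipping a pair leaves every signed monomial unchanged, and these
  symmetries act transitively on the positions. So the index \<open>0\<close> may be assumed to
  stand in position \<open>0\<close>.\<close>

lemma pf_expand:
  assumes skew: "\<And>i j. a i j = - a j i" and m: "m > 0"
  shows "pf m a = 2 * m * (\<Sum>\<sigma> | \<sigma> permutes {..<2 * m} \<and> \<sigma> 0 = 0. pf_term m a \<sigma>)"
proof -
  let ?P = "{\<sigma>. \<sigma> permutes {..<2 * m}}"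
  define S where "S k = (\<Sum>\<sigma>\<in>?P. if \<sigma> k = 0 then pf_term m a \<sigma> else 0)" for k
  have fin: "finite ?P" by (simp add: finite_permutations)
  have inv: "S k = S (\<rho> k)" if \<rho>: "\<rho> permutes {..<2 * m}"
    and "\<And>\<sigma>. \<sigma> permutes {..<2 * m} \<Longrightarrow> pf_term m a (\<sigma> \<circ> \<rho>) = pf_term m a \<sigma>" for \<rho> k
  proof -
    have "S k = (\<Sum>\<sigma>\<in>?P. if (\<sigma> \<circ> \<rho>) k = 0 then pf_term m a (\<sigma> \<circ> \<rho>) else 0)"
      unfolding S_def by (rule sum_permutes_right[OF \<rho>, symmetric])
    also have "\<dots> = S (\<rho> k)"
      unfolding S_def using that(2) by (intro sum.cong) auto
    finally show ?thesis .
  qed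
  have Seven: "S (2 * i) = S 0" if "i < m" for i
  proof -
    have \<rho>: "swap 0 (2 * i) \<circ> swap 1 (Suc (2 * i)) permutes {..<2 * m}"
      using that by (auto intro!: permutes_swap_id permutes_compose)
    show ?thesis using inv[OF \<rho> pf_term_swap_pairs[OF that], of "2 * i"]
      by (simp add: Transposition.transpose_def split: if_splits) presburger?
  qed
  have Sodd: "S (Suc (2 * i)) = S 0" if "i < m" for i
  proof -
    have \<rho>: "swap (2 * i) (Suc (2 * i)) permutes {..<2 * m}"
      using that by (auto intro!: permutes_swap_id)
    show ?thesis using inv[OF \<rho> pf_term_flip[OF skew that], of "Suc (2 * i)"] Seven[OF that] by simp
  qed
  have Sk: "S k = S 0" if "k < 2 * m" for k
    using Seven[of "k div 2"] Sodd[of "k div 2"] that by (cases "even k") (auto elim!: evenE oddE)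
  have "pf m a = (\<Sum>\<sigma>\<in>?P. \<Sum>k<2 * m. if \<sigma> k = 0 then pf_term m a \<sigma> else 0)"
    unfolding pf_def
  proof (rule sum.cong[OF refl])
    fix \<sigma> assume "\<sigma> \<in> ?P"
    then have \<sigma>: "\<sigma> permutes {..<2 * m}" by simp
    have "inv \<sigma> 0 < 2 * m" using permutes_in_image[OF permutes_inv[OF \<sigma>], of 0] m by simp
    moreover have "\<sigma> k = 0 \<longleftrightarrow> k = inv \<sigma> 0" for k using permutes_inverses[OF \<sigma>] by metis
    ultimately show "pf_term m a \<sigma> = (\<Sum>k<2 * m. if \<sigma> k = 0 then pf_term m a \<sigma> else 0)" by simp
  qed
  also have "(\<Sum>\<sigma>\<in>?P. \<Sum>k<2 * m. if \<sigma> k = 0 then pf_term m a \<sigma> else 0) = (\<Sum>k<2 * m. S k)"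
    unfolding S_def by (rule sum.swap)
  also have "\<dots> = (\<Sum>k<2 * m. S 0)" by (intro sum.cong refl Sk) simp
  also have "S 0 = (\<Sum>\<sigma> | \<sigma> permutes {..<2 * m} \<and> \<sigma> 0 = 0. pf_term m a \<sigma>)"
    unfolding S_def by (rule sum.mono_neutral_cong_right) (use fin in auto)
  finally show ?thesis by simp
qed

text \<open>In this form the sum is recognizable as \<open>\<eta> \<and> (d\<eta>)\<^sup>n\<close> when row
  \<open>0\<close> contains the values of \<open>\<eta>\<close> and the other entries those of
  \<open>d\<eta>\<close>.\<close>

lemma pf_expand_shift:
  fixes a :: "nat \<Rightarrow> nat \<Rightarrow> real"
  assumes skew: "\<And>i j. a i j = - a j i"
  shows "pf (Suc n) a = 2 * Suc n * (\<Sum>\<tau> | \<tau> permutes {..<Suc (2 * n)}. of_int (sign \<tau>) *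
    (a 0 (Suc (\<tau> 0)) * (\<Prod>i<n. a (Suc (\<tau> (Suc (2 * i)))) (Suc (\<tau> (Suc (Suc (2 * i))))))))"
proof -
  have [simp]: "shift (Suc 0) \<tau> (Suc j) = Suc (\<tau> j)" for \<tau> j by (simp add: shift_def)
  have "(\<Sum>\<sigma> | \<sigma> permutes {..<2 * Suc n} \<and> \<sigma> 0 = 0. pf_term (Suc n) a \<sigma>) =
    (\<Sum>\<tau> | \<tau> permutes {..<Suc (2 * n)}. pf_term (Suc n) a (shift 1 \<tau>))"
    using sum_permutes_shift[where k = 1 and l = "Suc (2 * n)" and f = "pf_term (Suc n) a"] by simp
  also have "\<dots> = (\<Sum>\<tau> | \<tau> permutes {..<Suc (2 * n)}. of_int (sign \<tau>) *
    (a 0 (Suc (\<tau> 0)) * (\<Prod>i<n. a (Suc (\<tau> (Suc (2 * i)))) (Suc (\<tau> (Suc (Suc (2 * i))))))))"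
    by (intro sum.cong refl)
      (simp add: shift_permutes prod.lessThan_Suc_shift del: prod.lessThan_Suc)
  finally show ?thesis using pf_expand[OF skew, of "Suc n"] by simp
qed

text \<open>If index \<open>0\<close> is paired only with index \<open>1\<close>, every nonzero monomial
  contains this pair. This is the induction step for nonvanishing.\<close>

lemma pf_split_pair:
  fixes a :: "nat \<Rightarrow> nat \<Rightarrow> real"
  assumes skew: "\<And>i j. a i j = - a j i" and zero: "\<And>j. 2 \<le> j \<Longrightarrow> j < 2 * Suc n \<Longrightarrow> a 0 j = 0"
  shows "pf (Suc n) a = 2 * Suc n * a 0 1 * pf n (\<lambda>i j. a (2 + i) (2 + j))"
proof -
  have fin: "finite {\<sigma>. \<sigma> permutes {..<2 * Suc n} \<and> \<sigma> 0 = 0}"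
    by (rule finite_subset[OF _ finite_permutations[of "{..<2 * Suc n}"]]) auto
  have 0: "a 0 0 = 0" using skew[of 0 0] by simp
  have fix2: "(\<forall>i<2. \<sigma> i = i) \<longleftrightarrow> \<sigma> 0 = 0 \<and> \<sigma> 1 = 1" for \<sigma> :: "nat \<Rightarrow> nat"
    by (auto simp: less_2_cases_iff)
  have sh: "shift 2 \<tau> 0 = 0" "shift 2 \<tau> (Suc 0) = 1" "shift 2 \<tau> (Suc (Suc j)) = Suc (Suc (\<tau> j))" for \<tau> j
    by (auto simp: shift_def)
  have "(\<Sum>\<sigma> | \<sigma> permutes {..<2 * Suc n} \<and> \<sigma> 0 = 0. pf_term (Suc n) a \<sigma>) =
    (\<Sum>\<sigma> | \<sigma> permutes {..<2 + 2 * n} \<and> (\<forall>i<2. \<sigma> i = i). pf_term (Suc n) a \<sigma>)"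
  proof (rule sum.mono_neutral_cong_right[OF fin])
    show "\<forall>\<sigma>\<in>{\<sigma>. \<sigma> permutes {..<2 * Suc n} \<and> \<sigma> 0 = 0} - {\<sigma>. \<sigma> permutes {..<2 + 2 * n} \<and> (\<forall>i<2. \<sigma> i = i)}.
        pf_term (Suc n) a \<sigma> = 0"
    proof
      fix \<sigma> assume "\<sigma> \<in> {\<sigma>. \<sigma> permutes {..<2 * Suc n} \<and> \<sigma> 0 = 0} - {\<sigma>. \<sigma> permutes {..<2 + 2 * n} \<and> (\<forall>i<2. \<sigma> i = i)}"
      then have \<sigma>: "\<sigma> permutes {..<2 * Suc n}" "\<sigma> 0 = 0" "\<sigma> 1 \<noteq> 1" unfolding fix2 by auto
      have "\<sigma> 1 < 2 * Suc n" using permutes_in_image[OF \<sigma>(1), of 1] by simp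
      moreover have "\<sigma> 1 \<noteq> 0" using injD[OF permutes_inj[OF \<sigma>(1)], of 1 0] \<sigma>(2) by auto
      ultimately have "a 0 (\<sigma> 1) = 0" using zero[of "\<sigma> 1"] \<sigma>(3) by simp
      then show "pf_term (Suc n) a \<sigma> = 0"
        using \<sigma>(2) by (simp add: prod.lessThan_Suc_shift del: prod.lessThan_Suc)
    qed
  qed (auto simp: fix2)
  also have "\<dots> = (\<Sum>\<tau> | \<tau> permutes {..<2 * n}. pf_term (Suc n) a (shift 2 \<tau>))"
    by (rule sum_permutes_shift)
  also have "\<dots> = a 0 1 * pf n (\<lambda>i j. a (2 + i) (2 + j))"
    unfolding pf_def sum_distrib_left
    by (intro sum.cong refl)
      (simp add: shift_permutes sh prod.lessThan_Suc_shift del: prod.lessThan_Suc)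
  finally show ?thesis using pf_expand[OF skew, of "Suc n"] by simp
qed

section \<open>Pfaffians and nondegeneracy\<close>

text \<open>With vectors in place of a matrix, row and column operations become changes of the family
  \<open>u\<close>, and \<open>Pf\<close> is an alternating multilinear function of it.\<close>

locale skew_form =
  fixes B :: "'v::real_vector \<Rightarrow> 'v \<Rightarrow> real"
  assumes lin: "linear (\<lambda>x. B x y)" and skew: "B x y = - B y x"
begin

definition Pf :: "nat \<Rightarrow> (nat \<Rightarrow> 'v) \<Rightarrow> real" where
  "Pf m u = pf m (\<lambda>i j. B (u i) (u j))"

lemma lin2: "linear (B x)"
proof -
  have "B x = (\<lambda>y. - B y x)" by (rule ext) (rule skew)
  then show ?thesis using linear_compose_neg[OF lin[of x]] by simp
qed

lemma Pf_permute:
  assumes \<pi>: "\<pi> permutes {..<2 * m}"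
  shows "Pf m (u \<circ> \<pi>) = of_int (sign \<pi>) * Pf m u"
proof -
  let ?a = "\<lambda>i j. B (u i) (u j)"
  have "Pf m (u \<circ> \<pi>) = (\<Sum>\<sigma> | \<sigma> permutes {..<2 * m}. of_int (sign \<pi>) * pf_term m ?a (\<pi> \<circ> \<sigma>))"
    unfolding Pf_def pf_def
    by (intro sum.cong refl) (simp add: sign_comp[OF \<pi>] mult.assoc[symmetric] flip: of_int_mult)
  also have "\<dots> = of_int (sign \<pi>) * (\<Sum>\<sigma> | \<sigma> permutes {..<2 * m}. pf_term m ?a (\<pi> \<circ> \<sigma>))"
    by (simp add: sum_distrib_left)
  also have "\<dots> = of_int (sign \<pi>) * Pf m u"
    unfolding Pf_def pf_def by (subst sum_permutes_left[OF \<pi>]) simp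
  finally show ?thesis .
qed

lemma Pf_repeat:
  assumes "i < 2 * m" "j < 2 * m" "i \<noteq> j" "u i = u j"
  shows "Pf m u = 0"
proof -
  have "u \<circ> swap i j = u"
    using assms(4) by (auto simp: fun_eq_iff Transposition.transpose_def)
  then show ?thesis
    using Pf_permute[of "swap i j" m u] assms
    by (simp add: sign_swap_id permutes_swap_id)
qed

abbreviation monomial :: "nat \<Rightarrow> (nat \<Rightarrow> 'v) \<Rightarrow> nat \<Rightarrow> (nat \<Rightarrow> nat) \<Rightarrow> 'v \<Rightarrow> real" where
  "monomial m u j \<sigma> x \<equiv> \<Prod>i<m. B ((u(j := x)) (\<sigma> (2 * i))) ((u(j := x)) (\<sigma> (Suc (2 * i))))"

text \<open>A permutation takes the value \<open>j\<close> once, so exactly one factor of its monomial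
  involves the vector number \<open>j\<close>.\<close>

lemma pf_monomial_factor:
  assumes "j < 2 * m" and \<sigma>: "\<sigma> permutes {..<2 * m}"
  obtains c k where "k < 2 * m" "k \<noteq> j"
    "\<And>x. monomial m u j \<sigma> x = c * B x (u k)"
proof -
  let ?f = "\<lambda>x i. B ((u(j := x)) (\<sigma> (2 * i))) ((u(j := x)) (\<sigma> (Suc (2 * i))))"
  define l where "l = inv \<sigma> j"
  have \<sigma>l: "\<sigma> l = j" using permutes_inverses[OF \<sigma>] by (simp add: l_def)
  have eq: "\<sigma> i = j \<longleftrightarrow> i = l" for i using injD[OF permutes_inj[OF \<sigma>], of i l] \<sigma>l by auto
  have l: "l < 2 * m" using permutes_in_image[OF permutes_inv[OF \<sigma>], of j] assms(1) by (simp add: l_def)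
  define i0 where "i0 = l div 2"
  have i0: "i0 < m" using l by (simp add: i0_def)
  define c where "c = (\<Prod>i\<in>{..<m} - {i0}. B (u (\<sigma> (2 * i))) (u (\<sigma> (Suc (2 * i)))))"
  have rest: "(\<Prod>i\<in>{..<m} - {i0}. ?f x i) = c" for x
    unfolding c_def
  proof (rule prod.cong[OF refl])
    fix i assume "i \<in> {..<m} - {i0}"
    then have "2 * i \<noteq> l" "Suc (2 * i) \<noteq> l" by (auto simp: i0_def)
    then show "?f x i = B (u (\<sigma> (2 * i))) (u (\<sigma> (Suc (2 * i))))" using eq by simp
  qed
  have prod: "(\<Prod>i<m. ?f x i) = ?f x i0 * c" for x
    using prod.remove[of "{..<m}" i0 "?f x"] i0 rest by simp
  show thesis
  proof (cases "even l")
    case True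
    then have l2: "l = 2 * i0" by (simp add: i0_def)
    have ne: "\<sigma> (Suc (2 * i0)) \<noteq> j" using eq[of "Suc (2 * i0)"] l2 by simp
    have "\<sigma> (Suc (2 * i0)) < 2 * m" using permutes_in_image[OF \<sigma>, of "Suc (2 * i0)"] i0 by simp
    moreover have "?f x i0 * c = c * B x (u (\<sigma> (Suc (2 * i0))))" for x
      using ne \<sigma>l l2 by simp
    ultimately show thesis using that[of "\<sigma> (Suc (2 * i0))" c] ne unfolding prod by blast
  next
    case False
    then have l2: "l = Suc (2 * i0)" unfolding i0_def by presburger
    have ne: "\<sigma> (2 * i0) \<noteq> j" using eq[of "2 * i0"] l2 by simp
    have "\<sigma> (2 * i0) < 2 * m" using permutes_in_image[OF \<sigma>, of "2 * i0"] i0 by simp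
    moreover have "?f x i0 * c = - c * B x (u (\<sigma> (2 * i0)))" for x
      using ne \<sigma>l l2 skew[of "u (\<sigma> (2 * i0))" x] by simp
    ultimately show thesis using that[of "\<sigma> (2 * i0)" "- c"] ne unfolding prod by blast
  qed
qed

lemma linear_Pf:
  assumes "j < 2 * m"
  shows "linear (\<lambda>x. Pf m (u(j := x)))"
  unfolding Pf_def pf_def
proof (rule linear_compose_sum, rule ballI)
  fix \<sigma> assume "\<sigma> \<in> {\<sigma>. \<sigma> permutes {..<2 * m}}"
  then have \<sigma>: "\<sigma> permutes {..<2 * m}" by simp
  show "linear (\<lambda>x. of_int (sign \<sigma>) * monomial m u j \<sigma> x)"
  proof (rule pf_monomial_factor[OF assms \<sigma>, of u])
    fix c k
    assume c: "\<And>x. monomial m u j \<sigma> x = c * B x (u k)"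
    show ?thesis
      unfolding c using linear_compose_scale_right[OF linear_compose_scale_right[OF lin[of "u k"], of c], of "of_int (sign \<sigma>)"]
      by simp
  qed
qed

lemma Pf_kernel:
  assumes "j < 2 * m" "\<And>k. k < 2 * m \<Longrightarrow> B x (u k) = 0"
  shows "Pf m (u(j := x)) = 0"
  unfolding Pf_def pf_def
proof (rule sum.neutral, rule ballI)
  fix \<sigma> assume "\<sigma> \<in> {\<sigma>. \<sigma> permutes {..<2 * m}}"
  then have \<sigma>: "\<sigma> permutes {..<2 * m}" by simp
  show "of_int (sign \<sigma>) * monomial m u j \<sigma> x = 0"
  proof (rule pf_monomial_factor[OF assms(1) \<sigma>, of u])
    fix c k
    assume k: "k < 2 * m"
      and c: "\<And>x. monomial m u j \<sigma> x = c * B x (u k)"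
    show ?thesis unfolding c assms(2)[OF k] by simp
  qed
qed

text \<open>Stated with coefficients, so that it includes the linear independence of the family.\<close>

definition nondegenerate :: "nat \<Rightarrow> (nat \<Rightarrow> 'v) \<Rightarrow> bool" where
  "nondegenerate N u \<longleftrightarrow> (\<forall>c. (\<forall>j<N. B (\<Sum>i<N. c i *\<^sub>R u i) (u j) = 0) \<longrightarrow> (\<forall>i<N. c i = 0))"

text \<open>Replace \<open>u\<^sub>j\<close> by a kernel vector \<open>\<Sum>c\<^sub>i u\<^sub>i\<close>: the
  Pfaffian becomes \<open>0\<close>, but by multilinearity it becomes \<open>c\<^sub>j\<close> times
  the old one, as repeated vectors contribute nothing.\<close>

lemma Pf_nonzero_imp_nondegenerate:
  assumes "Pf m u \<noteq> 0"
  shows "nondegenerate (2 * m) u"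
  unfolding nondegenerate_def
proof (intro allI impI)
  fix c :: "nat \<Rightarrow> real" and j
  assume ker: "\<forall>j<2 * m. B (\<Sum>i<2 * m. c i *\<^sub>R u i) (u j) = 0" and j: "j < 2 * m"
  interpret L: linear "\<lambda>x. Pf m (u(j := x))" by (rule linear_Pf[OF j])
  have "0 = Pf m (u(j := \<Sum>i<2 * m. c i *\<^sub>R u i))"
    using Pf_kernel[OF j] ker by simp
  also have "\<dots> = (\<Sum>i<2 * m. c i * Pf m (u(j := u i)))"
    by (simp add: L.sum L.scale)
  also have "\<dots> = (\<Sum>i<2 * m. if i = j then c j * Pf m u else 0)"
  proof (intro sum.cong refl)
    fix i assume "i \<in> {..<2 * m}"
    then show "c i * Pf m (u(j := u i)) = (if i = j then c j * Pf m u else 0)"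
      using Pf_repeat[of i m j "u(j := u i)"] j by auto
  qed
  also have "\<dots> = c j * Pf m u" using j by simp
  finally show "c j = 0" using assms by simp
qed

lemma Pf_add_pair:
  assumes "2 \<le> j" "j < 2 * m"
  shows "Pf m (u(j := u j + (x *\<^sub>R u 0 + y *\<^sub>R u 1))) = Pf m u"
proof -
  interpret L: linear "\<lambda>x. Pf m (u(j := x))" by (rule linear_Pf[OF assms(2)])
  have "Pf m (u(j := u 0)) = 0" "Pf m (u(j := u 1)) = 0"
    using assms Pf_repeat[of j m 0 "u(j := u 0)"] Pf_repeat[of j m 1 "u(j := u 1)"] by auto
  then show ?thesis by (simp add: L.add L.scale)
qed

text \<open>The vectors are changed one at a time, in increasing order of the index; the vectors
  \<open>u\<^sub>0\<close> and \<open>u\<^sub>1\<close> stay in place throughout.\<close>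

lemma Pf_add_pairs:
  assumes "w 0 = u 0" "w 1 = u 1" "\<And>i. 2 \<le> i \<Longrightarrow> w i = u i + (x i *\<^sub>R u 0 + y i *\<^sub>R u 1)"
  shows "Pf m w = Pf m u"
proof -
  have "k \<le> 2 * m \<Longrightarrow> Pf m (\<lambda>i. if i < k then w i else u i) = Pf m u" for k
  proof (induction k)
    case (Suc k)
    let ?u = "\<lambda>i. if i < k then w i else u i"
    have eq: "(\<lambda>i. if i < Suc k then w i else u i) = ?u(k := w k)" by auto
    show ?case
    proof (cases "2 \<le> k")
      case True
      then have "w k = ?u k + (x k *\<^sub>R ?u 0 + y k *\<^sub>R ?u 1)" using assms by simp
      then show ?thesis unfolding eq using Pf_add_pair[OF True, of m ?u "x k" "y k"] Suc by simp
    next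
      case False
      then have "k = 0 \<or> k = 1" by auto
      then have "?u(k := w k) = ?u" using assms by auto
      then show ?thesis unfolding eq using Suc by simp
    qed
  qed simp
  from this[of "2 * m"] have "Pf m (\<lambda>i. if i < 2 * m then w i else u i) = Pf m u" by simp
  moreover have "Pf m (\<lambda>i. if i < 2 * m then w i else u i) = Pf m w"
    unfolding Pf_def pf_def
  proof (intro sum.cong refl arg_cong2[of _ _ _ _ "(*)"] prod.cong)
    fix \<sigma> i assume "\<sigma> \<in> {\<sigma>. \<sigma> permutes {..<2 * m}}" "i \<in> {..<m}"
    then have "\<sigma> (2 * i) < 2 * m" "\<sigma> (Suc (2 * i)) < 2 * m"
      using permutes_in_image[of \<sigma> "{..<2 * m}" "2 * i"] permutes_in_image[of \<sigma> "{..<2 * m}" "Suc (2 * i)"]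
      by auto
    then show "B (if \<sigma> (2 * i) < 2 * m then w (\<sigma> (2 * i)) else u (\<sigma> (2 * i)))
       (if \<sigma> (Suc (2 * i)) < 2 * m then w (\<sigma> (Suc (2 * i))) else u (\<sigma> (Suc (2 * i)))) =
        B (w (\<sigma> (2 * i))) (w (\<sigma> (Suc (2 * i))))" by simp
  qed
  ultimately show ?thesis by simp
qed

text \<open>Symplectic Gram-Schmidt: choose a pair \<open>v\<^sub>0, v\<^sub>1\<close> with nonzero product,
  make the remaining vectors orthogonal to it without changing the Pfaffian, and split the pair off.
  The orthogonal vectors are again nondegenerate.\<close>

lemma nondegenerate_imp_Pf_nonzero:
  "nondegenerate (2 * m) u \<Longrightarrow> Pf m u \<noteq> 0"
proof (induction m arbitrary: u)
  case 0
  show ?case by (simp add: Pf_def pf_def)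
next
  case (Suc m)
  interpret L1: linear "\<lambda>x. B x y" for y by (rule lin)
  interpret L2: linear "B x" for x by (rule lin2)
  have alt: "B x x = 0" for x using skew[of x x] by simp
  note nd = Suc.prems[unfolded nondegenerate_def, rule_format]
  have "\<exists>j<2 * Suc m. B (u 0) (u j) \<noteq> 0"
  proof (rule ccontr)
    assume "\<not> ?thesis"
    then have z: "B (u 0) (u j) = 0" if "j < 2 * Suc m" for j using that by blast
    have "(\<Sum>i<2 * Suc m. (if i = 0 then 1 else 0) *\<^sub>R u i) = (\<Sum>i<2 * Suc m. if i = 0 then u i else 0)"
      by (intro sum.cong) auto
    also have "\<dots> = u 0" by (simp only: sum.delta finite_lessThan) simp
    finally have "(if (0::nat) = 0 then 1 else 0) = (0::real)"
      using z by (intro nd[of "\<lambda>i. if i = 0 then 1 else 0" 0]) auto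
    then show False by simp
  qed
  then obtain j where j: "j < 2 * Suc m" "B (u 0) (u j) \<noteq> 0" by auto
  then have "j \<noteq> 0" using alt by metis
  define \<pi> where "\<pi> = swap 1 j"
  have \<pi>: "\<pi> permutes {..<2 * Suc m}" unfolding \<pi>_def using j by (intro permutes_swap_id) auto
  define v where "v = u \<circ> \<pi>"
  have v0: "v 0 = u 0" and v1: "v 1 = u j" using \<open>j \<noteq> 0\<close> by (auto simp: v_def \<pi>_def Transposition.transpose_def)
  define b where "b = B (v 0) (v 1)"
  have b: "b \<noteq> 0" using j v0 v1 by (simp add: b_def)
  have b0: "B (v 0) (v (Suc 0)) = b" by (simp add: b_def)
  have b': "B (v 1) (v 0) = - b" using skew[of "v 1"] by (simp add: b_def)
  have \<pi>\<pi>: "\<pi> (\<pi> i) = i" for i by (simp add: \<pi>_def)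
  have nd_perm: "c i = 0" if ker: "\<And>j. j < 2 * Suc m \<Longrightarrow> B (\<Sum>i<2 * Suc m. c i *\<^sub>R v i) (v j) = 0"
    and i: "i < 2 * Suc m" for c i
  proof -
    have "(\<Sum>i<2 * Suc m. c (\<pi> i) *\<^sub>R u i) = (\<Sum>i<2 * Suc m. c (\<pi> (\<pi> i)) *\<^sub>R u (\<pi> i))"
      by (rule sum.reindex_bij_betw[OF permutes_imp_bij[OF \<pi>], symmetric])
    then have eq: "(\<Sum>i<2 * Suc m. c (\<pi> i) *\<^sub>R u i) = (\<Sum>i<2 * Suc m. c i *\<^sub>R v i)"
      by (simp add: \<pi>\<pi> v_def)
    have "c (\<pi> (\<pi> i)) = 0"
    proof (rule nd[of "\<lambda>i. c (\<pi> i)"])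
      show "B (\<Sum>i<2 * Suc m. c (\<pi> i) *\<^sub>R u i) (u j) = 0" if "j < 2 * Suc m" for j
        using ker[of "\<pi> j"] permutes_in_image[OF \<pi>, of j] that unfolding eq by (simp add: v_def \<pi>\<pi>)
      show "\<pi> i < 2 * Suc m" using permutes_in_image[OF \<pi>, of i] i by simp
    qed
    then show ?thesis by (simp add: \<pi>\<pi>)
  qed
  \<comment> \<open>The coefficients for which \<open>w\<^sub>i = v\<^sub>i + x\<^sub>i v\<^sub>0 + y\<^sub>i
    v\<^sub>1\<close> is orthogonal to \<open>v\<^sub>0\<close> and \<open>v\<^sub>1\<close>.\<close>
  define x where "x i = B (v 1) (v i) / b" for i
  define y where "y i = - B (v 0) (v i) / b" for i
  define w where "w i = (if i < 2 then v i else v i + (x i *\<^sub>R v 0 + y i *\<^sub>R v 1))" for i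
  have w0: "B (v 0) (w i) = 0" if "2 \<le> i" for i
    using that b by (simp add: w_def L2.add L2.diff L2.scale alt y_def b0)
  have w1: "B (v 1) (w i) = 0" if "2 \<le> i" for i
    using that b b' by (simp add: w_def L2.add L2.diff L2.scale alt x_def b'[simplified])
  have "nondegenerate (2 * m) (\<lambda>i. w (2 + i))"
    unfolding nondegenerate_def
  proof (intro allI impI)
    fix c :: "nat \<Rightarrow> real" and i0
    assume ker: "\<forall>j<2 * m. B (\<Sum>i<2 * m. c i *\<^sub>R w (2 + i)) (w (2 + j)) = 0" and i0: "i0 < 2 * m"
    define X where "X = (\<Sum>i<2 * m. c i *\<^sub>R w (2 + i))"
    \<comment> \<open>The coefficients of \<open>X\<close> with respect to the family \<open>v\<close>.\<close>
    define d where "d k = (if k = 0 then \<Sum>i<2 * m. c i * x (2 + i) else if k = 1 then \<Sum>i<2 * m. c i * y (2 + i) else c (k - 2))" for k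
    have X: "X = (\<Sum>i<2 * Suc m. d i *\<^sub>R v i)"
    proof -
      have "(\<Sum>i<2 * Suc m. d i *\<^sub>R v i) = d 0 *\<^sub>R v 0 + (d 1 *\<^sub>R v 1 + (\<Sum>i<2 * m. d (2 + i) *\<^sub>R v (2 + i)))"
        by (simp add: sum.lessThan_Suc_shift del: sum.lessThan_Suc)
      also have "\<dots> = X"
        by (simp add: X_def d_def w_def scaleR_add_right sum.distrib scaleR_sum_left)
      finally show ?thesis by simp
    qed
    have X0: "B X (v 0) = 0" "B X (v 1) = 0"
      unfolding X_def L1.sum L1.scale using w0 w1 skew[of "w _"] by (auto intro!: sum.neutral)
    have Xk: "B X (v k) = 0" if "k < 2 * Suc m" for k
    proof (cases "k < 2")
      case True
      then show ?thesis using X0 by (auto simp: less_2_cases_iff)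
    next
      case False
      then have "v k = w k - (x k *\<^sub>R v 0 + y k *\<^sub>R v 1)" by (simp add: w_def)
      moreover have "2 + (k - 2) = k" "k - 2 < 2 * m" using False that by auto
      then have "B X (w k) = 0" using ker[rule_format, of "k - 2"] by (simp only: X_def)
      ultimately show ?thesis using X0 by (simp add: L2.diff L2.add L2.scale)
    qed
    have "d (2 + i0) = 0"
    proof (rule nd_perm[of d])
      show "B (\<Sum>i<2 * Suc m. d i *\<^sub>R v i) (v j) = 0" if "j < 2 * Suc m" for j
        using Xk[OF that] unfolding X .
      show "2 + i0 < 2 * Suc m" using i0 by simp
    qed
    then show "c i0 = 0" by (simp add: d_def)
  qed
  then have ne: "Pf m (\<lambda>i. w (2 + i)) \<noteq> 0" by (rule Suc.IH)
  have "Pf (Suc m) u = of_int (sign \<pi>) * Pf (Suc m) v"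
  proof -
    have "v \<circ> \<pi> = u" by (auto simp: v_def \<pi>\<pi>)
    then show ?thesis using Pf_permute[OF \<pi>, of v] by simp
  qed
  also have "Pf (Suc m) v = Pf (Suc m) w"
    by (rule Pf_add_pairs[symmetric]) (auto simp: w_def)
  also have "\<dots> = 2 * Suc m * b * Pf m (\<lambda>i. w (2 + i))"
    unfolding Pf_def using w0
    by (subst pf_split_pair[OF skew]) (simp_all add: w_def b0)
  finally show ?case using ne b by (simp add: sign_def)
qed

end

text \<open>The matrix \<open>a\<close> is the Gram matrix of the unit vectors for the bilinear form that it
  defines on sequences.\<close>

lemma pf_nonzero_iff:
  assumes skew: "\<And>i j. a i j = - a j i"
  shows "pf m a \<noteq> 0 \<longleftrightarrow> (\<forall>c. (\<forall>j<2 * m. (\<Sum>i<2 * m. c i * a i j) = 0) \<longrightarrow> (\<forall>i<2 * m. c i = 0))"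
proof -
  define B where "B x y = (\<Sum>i<2 * m. \<Sum>j<2 * m. x i * y j * a i j)" for x y :: "nat \<Rightarrow> real"
  define e where "e k = (\<lambda>i. if i = k then 1 else 0 :: real)" for k :: nat
  interpret skew_form B
  proof
    show "B x y = - B y x" for x y
    proof -
      have "B x y = (\<Sum>j<2 * m. \<Sum>i<2 * m. x i * y j * a i j)" unfolding B_def by (rule sum.swap)
      also have "\<dots> = (\<Sum>j<2 * m. \<Sum>i<2 * m. - (y j * x i * a j i))"
      proof (intro sum.cong refl)
        show "x i * y j * a i j = - (y j * x i * a j i)" for i j using skew[of i j] by simp
      qed
      finally show ?thesis by (simp add: B_def sum_negf)
    qed
  qed (auto simp: B_def scaleR_fun_def algebra_simps sum.distrib sum_distrib_left)
  have Bl: "B x (e j) = (\<Sum>i<2 * m. x i * a i j)" if "j < 2 * m" for x j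
  proof -
    have "x i * e j k * a i k = (if k = j then x i * a i j else 0)" for i k by (simp add: e_def)
    then show ?thesis using that by (simp add: B_def)
  qed
  have Be: "B (e i) (e j) = a i j" if "i < 2 * m" "j < 2 * m" for i j
  proof -
    have "e i k * a k j = (if k = i then a i j else 0)" for k by (simp add: e_def)
    then show ?thesis using that by (simp add: Bl)
  qed
  have "Pf m e = pf m a"
    unfolding Pf_def pf_def
  proof (intro sum.cong refl arg_cong2[of _ _ _ _ "(*)"] prod.cong)
    fix \<sigma> i assume "\<sigma> \<in> {\<sigma>. \<sigma> permutes {..<2 * m}}" "i \<in> {..<m}"
    then have "\<sigma> (2 * i) < 2 * m" "\<sigma> (Suc (2 * i)) < 2 * m"
      using permutes_in_image[of \<sigma> "{..<2 * m}" "2 * i"] permutes_in_image[of \<sigma> "{..<2 * m}" "Suc (2 * i)"]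
      by auto
    then show "B (e (\<sigma> (2 * i))) (e (\<sigma> (Suc (2 * i)))) = a (\<sigma> (2 * i)) (\<sigma> (Suc (2 * i)))" by (rule Be)
  qed
  moreover have "B (\<Sum>i<2 * m. c i *\<^sub>R e i) (e j) = (\<Sum>i<2 * m. c i * a i j)" if "j < 2 * m" for c j
  proof -
    have "(\<Sum>i<2 * m. c i *\<^sub>R e i) k = c k" if "k < 2 * m" for k
    proof -
      have "(c i *\<^sub>R e i) k = (if i = k then c k else 0)" for i by (simp add: e_def scaleR_fun_def)
      then have "(\<Sum>i<2 * m. (c i *\<^sub>R e i) k) = c k" using that by simp
      moreover have "(\<Sum>i\<in>I. f i) k = (\<Sum>i\<in>I. f i k)" for I and f :: "nat \<Rightarrow> nat \<Rightarrow> real"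
        by (induction I rule: infinite_finite_induct) auto
      ultimately show ?thesis by simp
    qed
    then show ?thesis using that by (simp add: Bl)
  qed
  ultimately show ?thesis
    using Pf_nonzero_imp_nondegenerate[of m e] nondegenerate_imp_Pf_nonzero[of m e]
    unfolding nondegenerate_def by auto
qed

section \<open>Finite families of vectors\<close>

lemma span_family:
  fixes f :: "'i \<Rightarrow> 'v::real_vector"
  assumes I: "finite I"
  shows "span (f ` I) = {\<Sum>i\<in>I. c i *\<^sub>R f i | c. True}" (is "_ = ?S")
proof
  show "?S \<subseteq> span (f ` I)"
    by (auto intro!: span_sum span_scale intro: span_base)
  show "span (f ` I) \<subseteq> ?S"
  proof (rule span_minimal)
    show "f ` I \<subseteq> ?S"
    proof (rule image_subsetI)
      fix i assume i: "i \<in> I"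
      have "(\<Sum>k\<in>I. (if k = i then 1 else 0) *\<^sub>R f k) = (\<Sum>k\<in>I. if k = i then f i else 0)"
        by (intro sum.cong) auto
      also have "\<dots> = f i" using i I by simp
      finally have "f i = (\<Sum>k\<in>I. (if k = i then 1 else 0) *\<^sub>R f k)" by (rule sym)
      then show "f i \<in> ?S" by (intro CollectI exI[of _ "\<lambda>k. if k = i then 1 else 0"] conjI TrueI)
    qed
    show "subspace ?S"
      unfolding subspace_def
    proof (intro conjI ballI allI)
      show "0 \<in> ?S" by (auto intro!: exI[of _ "\<lambda>i. 0"])
      fix x y assume "x \<in> ?S" "y \<in> ?S"
      then obtain c d where "x = (\<Sum>i\<in>I. c i *\<^sub>R f i)" "y = (\<Sum>i\<in>I. d i *\<^sub>R f i)" by auto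
      then have "x + y = (\<Sum>i\<in>I. (c i + d i) *\<^sub>R f i)" by (simp add: sum.distrib scaleR_add_left)
      then show "x + y \<in> ?S" by (auto intro!: exI[of _ "\<lambda>i. c i + d i"])
    next
      fix k x assume "x \<in> ?S"
      then obtain c where "x = (\<Sum>i\<in>I. c i *\<^sub>R f i)" by auto
      then have "k *\<^sub>R x = (\<Sum>i\<in>I. (k * c i) *\<^sub>R f i)" by (simp add: scaleR_sum_right)
      then show "k *\<^sub>R x \<in> ?S" by (auto intro!: exI[of _ "\<lambda>i. k * c i"])
    qed
  qed
qed

lemma independent_family:
  fixes f :: "'i \<Rightarrow> 'v::real_vector"
  assumes I: "finite I"
  shows "inj_on f I \<and> independent (f ` I) \<longleftrightarrow>
    (\<forall>c. (\<Sum>i\<in>I. c i *\<^sub>R f i) = 0 \<longrightarrow> (\<forall>i\<in>I. c i = 0))" (is "?L \<longleftrightarrow> ?R")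
proof
  assume L: ?L
  then have inj: "inj_on f I" and ind: "independent (f ` I)" by auto
  show ?R
  proof (intro allI impI ballI)
    fix c i assume 0: "(\<Sum>i\<in>I. c i *\<^sub>R f i) = 0" and i: "i \<in> I"
    let ?d = "\<lambda>v. c (inv_into I f v)"
    have "(\<Sum>v\<in>f ` I. ?d v *\<^sub>R v) = (\<Sum>i\<in>I. c i *\<^sub>R f i)"
      using inj by (simp add: sum.reindex)
    then have "?d (f i) = 0"
      using independentD[OF ind, of "f ` I" ?d "f i"] I i 0 by simp
    then show "c i = 0" using inj i by simp
  qed
next
  assume R: ?R
  have inj: "inj_on f I"
  proof (rule inj_onI, rule ccontr)
    fix i j assume ij: "i \<in> I" "j \<in> I" "f i = f j" "i \<noteq> j"
    let ?c = "\<lambda>k. (if k = i then 1 else 0) - (if k = j then 1 else 0) :: real"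
    have "(\<Sum>k\<in>I. ?c k *\<^sub>R f k) = (\<Sum>k\<in>I. (if k = i then f i else 0) - (if k = j then f j else 0))"
      using ij(4) by (intro sum.cong) auto
    also have "\<dots> = 0" using I ij by (simp add: sum_subtractf)
    finally have "?c i = 0" using R[rule_format, of ?c i] ij(1) by blast
    then show False using ij(4) by simp
  qed
  moreover have "independent (f ` I)"
  proof (rule independent_if_scalars_zero)
    show "finite (f ` I)" using I by simp
    fix d x assume 0: "(\<Sum>x\<in>f ` I. d x *\<^sub>R x) = 0" and "x \<in> f ` I"
    then obtain i where i: "i \<in> I" "x = f i" by auto
    have "(\<Sum>i\<in>I. d (f i) *\<^sub>R f i) = 0" using 0 inj by (simp add: sum.reindex)
    then show "d x = 0" using R i by auto
  qed
  ultimately show ?L by simp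
qed

section \<open>Smooth functions on a manifold\<close>

locale manifold =
  fixes A :: "('m::{t2_space,second_countable_topology}, 'e::euclidean_space) atlas"
  assumes manifold: "smooth_manifold A"
begin

abbreviation "T \<equiv> tangent_space A"
abbreviation "coT \<equiv> cotangent_space A"

lemma chartD:
  assumes "(U, \<phi>) \<in> A"
  shows "open U" "open (\<phi> ` U)" "homeomorphism U (\<phi> ` U) \<phi> (inv_into U \<phi>)"
  using manifold assms by (auto simp: smooth_manifold_def)

lemma chart_inv [simp]: "(U, \<phi>) \<in> A \<Longrightarrow> q \<in> U \<Longrightarrow> inv_into U \<phi> (\<phi> q) = q"
  using chartD(3) by (simp add: homeomorphism_def)

lemma chart_cover: obtains U \<phi> where "(U, \<phi>) \<in> A" "p \<in> U"
proof -
  have "(\<Union>(U, \<phi>)\<in>A. U) = UNIV" using manifold by (simp add: smooth_manifold_def)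
  then have "p \<in> (\<Union>(U, \<phi>)\<in>A. U)" by simp
  then show thesis using that by auto
qed

lemma transition:
  "(U, \<phi>) \<in> A \<Longrightarrow> (V, \<psi>) \<in> A \<Longrightarrow> smooth_on (\<phi> ` (U \<inter> V)) (\<psi> \<circ> inv_into U \<phi>)"
  using manifold by (auto simp: smooth_manifold_def)

lemma open_chart_image:
  assumes "(U, \<phi>) \<in> A" "open W"
  shows "open (\<phi> ` (U \<inter> W))"
proof -
  have "open (\<phi> ` U \<inter> inv_into U \<phi> -` W)"
    using chartD[OF assms(1)] assms(2) continuous_on_open_vimage[of "\<phi> ` U" "inv_into U \<phi>"]
    by (metis Int_commute homeomorphism_def)
  moreover have "\<phi> ` (U \<inter> W) = \<phi> ` U \<inter> inv_into U \<phi> -` W"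
    using assms(1) by auto
  ultimately show ?thesis by simp
qed

lemma open_chart_preimage:
  assumes "(U, \<phi>) \<in> A" "open B"
  shows "open (U \<inter> \<phi> -` B)"
  using chartD[OF assms(1)] assms(2) continuous_on_open_vimage[of U \<phi>]
  by (metis Int_commute homeomorphism_def)

lemma smooth_fun_onD:
  "smooth_fun_on A W f \<Longrightarrow> (U, \<phi>) \<in> A \<Longrightarrow> smooth_on (\<phi> ` (U \<inter> W)) (f \<circ> inv_into U \<phi>)"
  by (auto simp: smooth_fun_on_def)

lemma smooth_fun_onI:
  "(\<And>U \<phi>. (U, \<phi>) \<in> A \<Longrightarrow> smooth_on (\<phi> ` (U \<inter> W)) (\<lambda>y. f (inv_into U \<phi> y))) \<Longrightarrow> smooth_fun_on A W f"
  by (auto simp: smooth_fun_on_def o_def)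

lemma smooth_fun_on_subset: "smooth_fun_on A W f \<Longrightarrow> V \<subseteq> W \<Longrightarrow> smooth_fun_on A V f"
  unfolding smooth_fun_on_def by (force intro: smooth_on_subset)

lemma smooth_fun_on_local:
  assumes "\<And>p. p \<in> W \<Longrightarrow> \<exists>V. open V \<and> p \<in> V \<and> smooth_fun_on A V f"
  shows "smooth_fun_on A W f"
proof (rule smooth_fun_onI, rule smooth_on_openI)
  fix U \<phi> x assume U: "(U, \<phi>) \<in> A" and "x \<in> \<phi> ` (U \<inter> W)"
  then obtain q where q: "q \<in> U" "q \<in> W" "x = \<phi> q" by auto
  obtain V where V: "open V" "q \<in> V" "smooth_fun_on A V f" using assms[OF q(2)] by auto
  have "smooth_on (\<phi> ` (U \<inter> V)) (f \<circ> inv_into U \<phi>)" by (rule smooth_fun_onD[OF V(3) U])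
  then show "\<exists>T. open T \<and> x \<in> T \<and> smooth_on T (\<lambda>y. f (inv_into U \<phi> y))"
    using open_chart_image[OF U V(1)] q V(2) by (auto simp: o_def)
qed

lemma smooth_fun_on_cong:
  assumes "open W" "\<And>q. q \<in> W \<Longrightarrow> f q = g q" "smooth_fun_on A W f"
  shows "smooth_fun_on A W g"
proof (rule smooth_fun_onI)
  fix U \<phi> assume U: "(U, \<phi>) \<in> A"
  show "smooth_on (\<phi> ` (U \<inter> W)) (\<lambda>y. g (inv_into U \<phi> y))"
    by (rule smooth_on_cong[OF open_chart_image[OF U assms(1)] _ smooth_fun_onD[OF assms(3) U]])
      (use U assms(2) in auto)
qed

lemma smooth_fun_on_const: "open W \<Longrightarrow> smooth_fun_on A W (\<lambda>q. c)"
  by (intro smooth_fun_onI smooth_on_const open_chart_image)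

lemma smooth_fun_on_add:
  "open W \<Longrightarrow> smooth_fun_on A W f \<Longrightarrow> smooth_fun_on A W g \<Longrightarrow> smooth_fun_on A W (\<lambda>q. f q + g q)"
  by (intro smooth_fun_onI smooth_on_add open_chart_image)
    (auto dest: smooth_fun_onD simp: o_def)

lemma smooth_fun_on_mult:
  "open W \<Longrightarrow> smooth_fun_on A W f \<Longrightarrow> smooth_fun_on A W g \<Longrightarrow> smooth_fun_on A W (\<lambda>q. f q * g q)"
  by (intro smooth_fun_onI smooth_on_mult open_chart_image)
    (auto dest: smooth_fun_onD simp: o_def)

lemma smooth_fun_on_inverse:
  assumes "open W" "\<And>q. q \<in> W \<Longrightarrow> f q \<noteq> 0" "smooth_fun_on A W f"
  shows "smooth_fun_on A W (\<lambda>q. inverse (f q))"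
  by (intro smooth_fun_onI smooth_on_inverse open_chart_image)
    (use assms in \<open>auto dest: smooth_fun_onD simp: o_def\<close>)

lemma smooth_fun_on_minus:
  "open W \<Longrightarrow> smooth_fun_on A W f \<Longrightarrow> smooth_fun_on A W (\<lambda>q. - f q)"
  using smooth_fun_on_mult[OF _ smooth_fun_on_const, of W f "-1"] by simp

lemma smooth_fun_on_diff:
  "open W \<Longrightarrow> smooth_fun_on A W f \<Longrightarrow> smooth_fun_on A W g \<Longrightarrow> smooth_fun_on A W (\<lambda>q. f q - g q)"
  using smooth_fun_on_add[OF _ _ smooth_fun_on_minus, of W f g] by simp

lemma smooth_fun_on_sum:
  "open W \<Longrightarrow> (\<And>i. i \<in> I \<Longrightarrow> smooth_fun_on A W (f i)) \<Longrightarrow> smooth_fun_on A W (\<lambda>q. \<Sum>i\<in>I. f i q)"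
  by (induction I rule: infinite_finite_induct) (auto intro: smooth_fun_on_const smooth_fun_on_add)

lemmas smooth_intros = smooth_fun_on_const smooth_fun_on_add smooth_fun_on_mult smooth_fun_on_minus
  smooth_fun_on_diff smooth_fun_on_sum

text \<open>Smoothness must be tested in every chart of the atlas; a transition map carries it from one chart
  to the others.\<close>

lemma smooth_fun_on_chart:
  fixes g :: "'e \<Rightarrow> real"
  assumes "(U, \<phi>) \<in> A" "open W" "W \<subseteq> U" "smooth_on (\<phi> ` W) g"
  shows "smooth_fun_on A W (\<lambda>q. g (\<phi> q))"
proof (rule smooth_fun_onI)
  fix V \<psi> assume V: "(V, \<psi>) \<in> A"
  have W: "open (\<phi> ` W)" using open_chart_image[OF assms(1,2)] assms(3) by (simp add: inf.absorb2)
  have "smooth_on (\<psi> ` (V \<inter> W)) (\<phi> \<circ> inv_into V \<psi>)"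
    by (rule smooth_on_subset[OF transition[OF V assms(1)]]) (use assms(3) in auto)
  then show "smooth_on (\<psi> ` (V \<inter> W)) (\<lambda>y. g (\<phi> (inv_into V \<psi> y)))"
    by (intro smooth_on_compose[OF open_chart_image[OF V assms(2)] W _ assms(4)])
      (use V in \<open>auto simp: o_def\<close>)
qed

text \<open>The set where \<open>\<rho>\<close> may be nonzero is enclosed in a closed set \<open>K\<close>,
  not only in \<open>W\<close>, so that products with \<open>\<rho>\<close> extend smoothly by
  \<open>0\<close>. It is closed because it is compact in a Hausdorff space.\<close>

lemma smooth_bump:
  assumes "open W" "p \<in> W"
  obtains \<rho> V K where "smooth_fun A \<rho>" "open V" "closed K" "p \<in> V" "V \<subseteq> K" "K \<subseteq> W"
    "\<And>q. q \<in> V \<Longrightarrow> \<rho> q = 1" "\<And>q. q \<notin> K \<Longrightarrow> \<rho> q = 0"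
proof -
  obtain U \<phi> where U: "(U, \<phi>) \<in> A" "p \<in> U" by (rule chart_cover)
  have "open (\<phi> ` (U \<inter> W))" "\<phi> p \<in> \<phi> ` (U \<inter> W)"
    using open_chart_image U assms by auto
  then obtain R where R: "R > 0" "cball (\<phi> p) R \<subseteq> \<phi> ` (U \<inter> W)"
    by (meson open_contains_cball)
  obtain \<rho>0 :: "'e \<Rightarrow> real" where \<rho>0: "smooth_on UNIV \<rho>0" "\<And>x. dist x (\<phi> p) \<le> R/2 \<Longrightarrow> \<rho>0 x = 1"
    "\<And>x. dist x (\<phi> p) \<ge> R \<Longrightarrow> \<rho>0 x = 0"
    using smooth_cutoff[of "R/2" R "\<phi> p"] R by auto
  define K where "K = inv_into U \<phi> ` cball (\<phi> p) R"
  define V where "V = U \<inter> \<phi> -` ball (\<phi> p) (R/2)"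
  define \<rho> where "\<rho> q = (if q \<in> U then \<rho>0 (\<phi> q) else 0)" for q
  have cont: "continuous_on (\<phi> ` U) (inv_into U \<phi>)" using chartD(3)[OF U(1)] by (simp add: homeomorphism_def)
  have "compact K" unfolding K_def
    by (rule compact_continuous_image[OF continuous_on_subset[OF cont]]) (use R in auto)
  then have clK: "closed K" by (rule compact_imp_closed)
  have KUW: "K \<subseteq> U \<inter> W" using R(2) U(1) by (force simp: K_def)
  have inK: "q \<in> K" if "q \<in> U" "\<phi> q \<in> cball (\<phi> p) R" for q
    using that U(1) chart_inv unfolding K_def by (metis imageI)
  have zero: "\<rho> q = 0" if "q \<notin> K" for q
  proof (cases "q \<in> U")
    case True
    then have "dist (\<phi> q) (\<phi> p) \<ge> R" using inK that by (force simp: dist_commute)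
    then show ?thesis by (simp add: \<rho>_def \<rho>0)
  qed (simp add: \<rho>_def)
  have "smooth_fun A \<rho>"
  proof (rule smooth_fun_on_local)
    fix q
    show "\<exists>V. open V \<and> q \<in> V \<and> smooth_fun_on A V \<rho>"
    proof (cases "q \<in> K")
      case True
      have "smooth_fun_on A U (\<lambda>q. \<rho>0 (\<phi> q))"
        by (rule smooth_fun_on_chart[OF U(1)]) (use chartD[OF U(1)] \<rho>0 in \<open>auto intro: smooth_on_subset\<close>)
      then have "smooth_fun_on A U \<rho>"
        by (rule smooth_fun_on_cong[rotated 2]) (use chartD[OF U(1)] in \<open>auto simp: \<rho>_def\<close>)
      then show ?thesis using True KUW chartD[OF U(1)] by auto
    next
      case False
      have "smooth_fun_on A (- K) \<rho>"
        by (rule smooth_fun_on_cong[OF _ _ smooth_fun_on_const[of _ 0]]) (use clK zero in auto)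
      then show ?thesis using False clK by (auto intro!: exI[of _ "- K"])
    qed
  qed
  moreover have "open V" unfolding V_def by (rule open_chart_preimage[OF U(1)]) simp
  moreover have "p \<in> V" using U R by (simp add: V_def)
  moreover have "V \<subseteq> K" using inK R by (auto simp: V_def)
  moreover have "\<rho> q = 1" if "q \<in> V" for q
    using that by (simp add: V_def \<rho>_def \<rho>0 dist_commute)
  ultimately show ?thesis using that clK KUW zero by (metis le_inf_iff)
qed

text \<open>The way in which functions and vector fields given on a chart become global objects.\<close>

lemma smooth_extend:
  assumes "smooth_fun A \<rho>" "closed K" "K \<subseteq> W" "open W" "\<And>q. q \<notin> K \<Longrightarrow> \<rho> q = 0" "smooth_fun_on A W f"
  shows "smooth_fun A (\<lambda>q. if q \<in> W then \<rho> q * f q else 0)"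
proof (rule smooth_fun_on_local)
  fix q
  show "\<exists>V. open V \<and> q \<in> V \<and> smooth_fun_on A V (\<lambda>q. if q \<in> W then \<rho> q * f q else 0)"
  proof (cases "q \<in> W")
    case True
    have "smooth_fun_on A W (\<lambda>q. \<rho> q * f q)"
      by (intro smooth_intros assms smooth_fun_on_subset[OF assms(1)]) auto
    then have "smooth_fun_on A W (\<lambda>q. if q \<in> W then \<rho> q * f q else 0)"
      by (rule smooth_fun_on_cong[rotated 2]) (use assms in auto)
    then show ?thesis using True assms by auto
  next
    case False
    have "smooth_fun_on A (- K) (\<lambda>q. if q \<in> W then \<rho> q * f q else 0)"
      by (rule smooth_fun_on_cong[OF _ _ smooth_fun_on_const[of _ 0]]) (use assms in auto)
    then show ?thesis using False assms by (auto intro!: exI[of _ "- K"])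
  qed
qed

section \<open>Tangent vectors and coordinate frames\<close>

lemma tangentD:
  assumes "v \<in> T p"
  shows "smooth_fun A f \<Longrightarrow> smooth_fun A g \<Longrightarrow> v (\<lambda>x. f x + g x) = v f + v g"
    "smooth_fun A f \<Longrightarrow> v (\<lambda>x. c * f x) = c * v f"
    "smooth_fun A f \<Longrightarrow> smooth_fun A g \<Longrightarrow> v (\<lambda>x. f x * g x) = v f * g p + f p * v g"
    "\<not> smooth_fun A f \<Longrightarrow> v f = 0"
  using assms by (auto simp: tangent_space_def)

lemma tangent_const: "v \<in> T p \<Longrightarrow> v (\<lambda>x. c) = 0"
  using tangentD(3)[of v p "\<lambda>x. 1" "\<lambda>x. 1"] tangentD(2)[of v p "\<lambda>x. 1" c]
  by (simp add: smooth_fun_on_const)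

lemma tangent_minus: "v \<in> T p \<Longrightarrow> smooth_fun A f \<Longrightarrow> v (\<lambda>x. - f x) = - v f"
  using tangentD(2)[of v p f "-1"] by simp

lemma tangent_diff:
  "v \<in> T p \<Longrightarrow> smooth_fun A f \<Longrightarrow> smooth_fun A g \<Longrightarrow> v (\<lambda>x. f x - g x) = v f - v g"
  using tangentD(1)[of v p f "\<lambda>x. - g x"] tangent_minus[of v p g] by (simp add: smooth_intros)

lemma tangent_sum:
  assumes v: "v \<in> T p"
  shows "(\<And>i. i \<in> I \<Longrightarrow> smooth_fun A (f i)) \<Longrightarrow>
    v (\<lambda>x. \<Sum>i\<in>I. f i x) = (\<Sum>i\<in>I. v (f i))"
proof (induction I rule: infinite_finite_induct)
  case (insert i I)
  have "v (\<lambda>x. f i x + (\<Sum>i\<in>I. f i x)) = v (f i) + v (\<lambda>x. \<Sum>i\<in>I. f i x)"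
    by (rule tangentD(1)[OF v]) (use insert in \<open>auto intro!: smooth_intros\<close>)
  then show ?case using insert by simp
qed (auto simp: tangent_const[OF v])

text \<open>Multiply \<open>f - g\<close> by a bump function supported where it vanishes, and apply the
  product rule to the zero function.\<close>

lemma tangent_local:
  assumes v: "v \<in> T p" and "open V" "p \<in> V" "\<And>q. q \<in> V \<Longrightarrow> f q = g q"
    and f: "smooth_fun A f" and g: "smooth_fun A g"
  shows "v f = v g"
proof -
  obtain \<rho> V' K where \<rho>: "smooth_fun A \<rho>" "open V'" "closed K" "p \<in> V'" "V' \<subseteq> K" "K \<subseteq> V"
    "\<And>q. q \<in> V' \<Longrightarrow> \<rho> q = 1" "\<And>q. q \<notin> K \<Longrightarrow> \<rho> q = 0"
    using smooth_bump[OF assms(2,3)] by metis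
  have "(\<lambda>q. \<rho> q * (f q - g q)) = (\<lambda>q. 0)"
    using \<rho> assms(4) by (auto simp: fun_eq_iff) (metis subsetD)
  then have "v (\<lambda>q. \<rho> q * (f q - g q)) = 0" using tangent_const[OF v] by simp
  moreover have "v (\<lambda>q. \<rho> q * (f q - g q)) = v \<rho> * (f p - g p) + \<rho> p * v (\<lambda>q. f q - g q)"
    by (rule tangentD(3)[OF v \<rho>(1)]) (intro smooth_intros f g open_UNIV)
  ultimately show ?thesis using \<rho> assms(3,4) by (simp add: tangent_diff[OF v f g])
qed

lemma tangent_eqI:
  "v \<in> T p \<Longrightarrow> w \<in> T p \<Longrightarrow> (\<And>f. smooth_fun A f \<Longrightarrow> v f = w f) \<Longrightarrow> v = w"
  using tangentD(4) by (metis ext)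

lemma subspace_tangent: "subspace (T p)"
  unfolding subspace_def
  by (auto simp: tangent_space_def scaleR_fun_def algebra_simps)

lemmas tangent_0 = subspace_0[OF subspace_tangent]
  and tangent_add = subspace_add[OF subspace_tangent]
  and tangent_scale = subspace_scale[OF subspace_tangent]
  and tangent_sum_mem = subspace_sum[OF subspace_tangent]

lemma scaleR_fun_apply [simp]: "(c *\<^sub>R f) x = c *\<^sub>R f x"
  by (simp add: scaleR_fun_def)

lemma sum_fun_apply: "(\<Sum>i\<in>I. f i) x = (\<Sum>i\<in>I. f i x)"
  by (induction I rule: infinite_finite_induct) auto

text \<open>Coordinate functions with their coordinate vector fields. All of them are defined on the whole
  manifold, because tangent vectors and forms are tested on global functions and fields only; they
  behave like coordinates on \<open>W\<close>.\<close>

definition coordinate_frame :: "'m set \<Rightarrow> ('e \<Rightarrow> 'm \<Rightarrow> real) \<Rightarrow> ('e \<Rightarrow> 'm \<Rightarrow> 'm tvec) \<Rightarrow> bool" where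
  "coordinate_frame W x E \<longleftrightarrow> open W \<and> (\<forall>b. smooth_fun A (x b)) \<and> (\<forall>b. vector_field A (E b)) \<and>
    (\<forall>q\<in>W. (\<forall>b\<in>Basis. \<forall>c\<in>Basis. E b q (x c) = (if b = c then 1 else 0)) \<and>
      (\<forall>v\<in>T q. v = (\<Sum>b\<in>Basis. v (x b) *\<^sub>R E b q)))"

lemma coordinate_frameD:
  assumes "coordinate_frame W x E"
  shows "open W" "smooth_fun A (x b)" "vector_field A (E b)"
    "q \<in> W \<Longrightarrow> b \<in> Basis \<Longrightarrow> c \<in> Basis \<Longrightarrow> E b q (x c) = (if b = c then 1 else 0)"
    "q \<in> W \<Longrightarrow> v \<in> T q \<Longrightarrow> v = (\<Sum>b\<in>Basis. v (x b) *\<^sub>R E b q)"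
  using assms unfolding coordinate_frame_def by (elim conjE, simp only:)+

text \<open>Cut off the coordinates of a chart and the partial derivatives. Hadamard's lemma writes a function
  near \<open>q\<close> as its value at \<open>q\<close> plus products of functions vanishing at
  \<open>q\<close> with smooth ones, so a derivation at \<open>q\<close> is determined by its values
  on the coordinates.\<close>

lemma local_frame:
  obtains W x E where "coordinate_frame W x E" "p \<in> W"
proof -
  obtain U \<phi> where U: "(U, \<phi>) \<in> A" "p \<in> U" by (rule chart_cover)
  note oU = chartD(1)[OF U(1)] and opU = chartD(2)[OF U(1)]
  let ?i = "inv_into U \<phi>"
  obtain \<rho> V K where \<rho>: "smooth_fun A \<rho>" "open V" "closed K" "p \<in> V" "V \<subseteq> K" "K \<subseteq> U"
    "\<And>q. q \<in> V \<Longrightarrow> \<rho> q = 1" "\<And>q. q \<notin> K \<Longrightarrow> \<rho> q = 0"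
    using smooth_bump[OF oU U(2)] by metis
  have VU: "V \<subseteq> U" using \<rho> by auto
  define x :: "'e \<Rightarrow> 'm \<Rightarrow> real" where "x b q = (if q \<in> U then \<rho> q * (\<phi> q \<bullet> b) else 0)" for b q
  define D where "D f q b = frechet_derivative (f \<circ> ?i) (at (\<phi> q)) b" for f :: "'m \<Rightarrow> real" and q b
  \<comment> \<open>Off \<open>U\<close> the cutoff \<open>\<rho>\<close> vanishes; on functions that are not
    smooth a tangent vector is \<open>0\<close> by convention.\<close>
  define E where "E b q f = (if smooth_fun A f then (if q \<in> U then \<rho> q * D f q b else 0) else 0)" for b q f
  have sm: "smooth_on (\<phi> ` U) (f \<circ> ?i)" if "smooth_fun A f" for f
    using smooth_fun_onD[OF that U(1)] by simp
  have hd: "((f \<circ> ?i) has_derivative D f q) (at (\<phi> q))" if "smooth_fun A f" "q \<in> U" for f q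
    unfolding D_def using smooth_on_differentiable[OF sm[OF that(1)]] that(2)
    by (simp add: frechet_derivative_works[symmetric])
  have D_eq: "D f q = d" if "((f \<circ> ?i) has_derivative d) (at (\<phi> q))" for f q d
    unfolding D_def using frechet_derivative_at[OF that] by simp
  have "smooth_fun A (x b)" for b
    unfolding x_def
    by (rule smooth_extend[OF \<rho>(1,3,6) oU \<rho>(8)], assumption,
        rule smooth_fun_on_chart[OF U(1) oU order_refl],
        rule smooth_on_linear[OF opU], rule bounded_linear_inner_left)
  moreover have "vector_field A (E b)" for b
    unfolding vector_field_on_def
  proof (intro conjI ballI allI impI)
    fix q
    have 1: "D (\<lambda>x. f x + g x) q b = D f q b + D g q b"
      if "q \<in> U" "smooth_fun A f" "smooth_fun A g" for f g
      using D_eq[where f = "\<lambda>x. f x + g x" and q = q and d = "\<lambda>b. D f q b + D g q b"]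
        has_derivative_add[OF hd[OF that(2,1)] hd[OF that(3,1)]] by (simp add: o_def)
    have 2: "D (\<lambda>x. c * f x) q b = c * D f q b" if "q \<in> U" "smooth_fun A f" for f c
      using D_eq[where f = "\<lambda>x. c * f x" and q = q and d = "\<lambda>b. c * D f q b"]
        has_derivative_mult_right[OF hd[OF that(2,1)]] by (simp add: o_def)
    have 3: "D (\<lambda>x. f x * g x) q b = D f q b * g q + f q * D g q b"
      if "q \<in> U" "smooth_fun A f" "smooth_fun A g" for f g
      using D_eq[where f = "\<lambda>x. f x * g x" and q = q and d = "\<lambda>b. f q * D g q b + D f q b * g q"] that U(1)
        has_derivative_mult[OF hd[OF that(2,1)] hd[OF that(3,1)]] by (simp add: o_def)
    show "E b q \<in> T q"
      unfolding tangent_space_def E_def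
      by (auto simp: smooth_intros 1 2 3 algebra_simps)
  next
    fix f assume f: "smooth_fun A f"
    have "smooth_fun_on A U (\<lambda>q. D f q b)" unfolding D_def
      by (rule smooth_fun_on_chart[OF U(1) oU order_refl
            smooth_on_directional_derivative[OF sm[OF f]]])
    from smooth_extend[OF \<rho>(1,3,6) oU \<rho>(8) this]
    show "smooth_fun A (\<lambda>q. E b q f)" using f by (simp add: E_def)
  qed
  moreover have "E b q (x c) = (if b = c then 1 else 0)" if "q \<in> V" "b \<in> Basis" "c \<in> Basis" for q b c
  proof -
    have "\<phi> ` V = \<phi> ` (U \<inter> V)" using VU by (simp add: inf.absorb2)
    then have oV: "open (\<phi> ` V)" using open_chart_image[OF U(1) \<rho>(2)] by simp
    have "((\<lambda>y. y \<bullet> c) has_derivative (\<lambda>h. h \<bullet> c)) (at (\<phi> q))"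
      by (intro bounded_linear_imp_has_derivative bounded_linear_inner_left)
    then have "((x c \<circ> ?i) has_derivative (\<lambda>h. h \<bullet> c)) (at (\<phi> q))"
      by (rule has_derivative_transform_within_open[OF _ oV])
        (use that VU U(1) \<rho> in \<open>auto simp: x_def subset_iff\<close>)
    from D_eq[OF this] show ?thesis
      using that VU \<rho> \<open>\<And>b. smooth_fun A (x b)\<close> by (auto simp: E_def inner_Basis)
  qed
  moreover have "v = (\<Sum>b\<in>Basis. v (x b) *\<^sub>R E b q)" if q: "q \<in> V" and v: "v \<in> T q" for q v
  proof (rule tangent_eqI[OF v])
    show "(\<Sum>b\<in>Basis. v (x b) *\<^sub>R E b q) \<in> T q"
      using \<open>\<And>b. vector_field A (E b)\<close>
      by (intro tangent_sum_mem tangent_scale) (simp add: vector_field_on_def)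
    fix f assume f: "smooth_fun A f"
    have qU: "q \<in> U" using q VU by auto
    have "\<phi> ` V = \<phi> ` (U \<inter> V)" using VU by (simp add: inf.absorb2)
    then have "open (\<phi> ` V)" using open_chart_image[OF U(1) \<rho>(2)] by simp
    then obtain r where r: "r > 0" "ball (\<phi> q) r \<subseteq> \<phi> ` V" using q by (metis imageI open_contains_ball)
    define B where "B = U \<inter> \<phi> -` ball (\<phi> q) r"
    have oB: "open B" unfolding B_def by (rule open_chart_preimage[OF U(1)]) simp
    have qB: "q \<in> B" using qU r by (simp add: B_def)
    have BV: "B \<subseteq> V"
    proof
      fix y assume "y \<in> B"
      then have y: "y \<in> U" "\<phi> y \<in> \<phi> ` V" using r by (auto simp: B_def)
      then obtain z where "z \<in> V" "\<phi> y = \<phi> z" by auto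
      then show "y \<in> V" using y VU U(1) chart_inv by (metis subsetD)
    qed
    have gs: "smooth_on (ball (\<phi> q) r) (f \<circ> ?i)"
      by (rule smooth_on_subset[OF sm[OF f]]) (use r VU in auto)
    obtain h where h: "\<And>b. smooth_on (ball (\<phi> q) r) (h b)"
      "\<And>y. y \<in> ball (\<phi> q) r \<Longrightarrow> (f \<circ> ?i) y = (f \<circ> ?i) (\<phi> q) + (\<Sum>b\<in>Basis. ((y - \<phi> q) \<bullet> b) * h b y)"
      "\<And>b. h b (\<phi> q) = frechet_derivative (f \<circ> ?i) (at (\<phi> q)) b"
      using Hadamard_lemma[OF gs] by blast
    obtain \<sigma> V' K' where \<sigma>: "smooth_fun A \<sigma>" "open V'" "closed K'" "q \<in> V'" "V' \<subseteq> K'" "K' \<subseteq> B"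
      "\<And>q. q \<in> V' \<Longrightarrow> \<sigma> q = 1" "\<And>q. q \<notin> K' \<Longrightarrow> \<sigma> q = 0"
      using smooth_bump[OF oB qB] by metis
    define H where "H b y = (if y \<in> B then \<sigma> y * h b (\<phi> y) else 0)" for b y
    have sH: "smooth_fun A (H b)" for b
      unfolding H_def
    proof (rule smooth_extend[OF \<sigma>(1,3,6) oB \<sigma>(8)])
      show "smooth_fun_on A B (\<lambda>y. h b (\<phi> y))"
        by (rule smooth_fun_on_chart[OF U(1) oB _ smooth_on_subset[OF h(1)]]) (auto simp: B_def)
    qed
    note sx = \<open>\<And>b. smooth_fun A (x b)\<close>
    have "v f = v (\<lambda>y. f q + (\<Sum>b\<in>Basis. (x b y - x b q) * H b y))"
    proof (rule tangent_local[OF v \<sigma>(2,4) _ f])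
      fix y assume y: "y \<in> V'"
      then have yB: "y \<in> B" using \<sigma> by auto
      then have "f y = f q + (\<Sum>b\<in>Basis. ((\<phi> y - \<phi> q) \<bullet> b) * h b (\<phi> y))"
        using h(2)[of "\<phi> y"] U(1) qU by (simp add: B_def)
      also have "(\<Sum>b\<in>Basis. ((\<phi> y - \<phi> q) \<bullet> b) * h b (\<phi> y)) = (\<Sum>b\<in>Basis. (x b y - x b q) * H b y)"
        using yB y \<sigma>(7) BV VU q \<rho>(7)
        by (intro sum.cong) (auto simp: x_def H_def inner_diff_left subset_iff)
      finally show "f y = f q + (\<Sum>b\<in>Basis. (x b y - x b q) * H b y)" .
    qed (intro smooth_intros sx sH open_UNIV)
    also have "\<dots> = (\<Sum>b\<in>Basis. v (x b) * H b q)"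
      by (subst tangentD(1)[OF v] tangent_sum[OF v] tangentD(3)[OF v] tangent_diff[OF v];
          (intro smooth_intros sx sH open_UNIV)?)+
        (simp add: tangent_const[OF v] tangent_sum[OF v] tangentD(3)[OF v] tangent_diff[OF v] smooth_intros sx sH)
    also have "\<dots> = (\<Sum>b\<in>Basis. v (x b) * E b q f)"
      using qB \<sigma>(4,7) \<rho>(7) q qU f by (simp add: H_def E_def h(3) D_def)
    finally show "v f = (\<Sum>b\<in>Basis. v (x b) *\<^sub>R E b q) f" by (simp add: sum_fun_apply)
  qed
  ultimately have "coordinate_frame V x E"
    unfolding coordinate_frame_def by (intro conjI allI ballI \<rho>(2))
  then show ?thesis using \<rho>(4) by (rule that)
qed

section \<open>Vector fields and differential forms\<close>

lemma vf_tangent: "vector_field A X \<Longrightarrow> X p \<in> T p"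
  unfolding vector_field_on_def by blast

lemma vf_smooth: "vector_field A X \<Longrightarrow> smooth_fun A (\<lambda>p. X p f)"
proof (cases "smooth_fun A f")
  case False
  assume X: "vector_field A X"
  then have "X p f = 0" for p using False tangentD(4)[OF vf_tangent[OF X]] by blast
  then show ?thesis by (simp add: smooth_intros)
qed (simp add: vector_field_on_def)

lemma vfI:
  "(\<And>p. X p \<in> T p) \<Longrightarrow> (\<And>f. smooth_fun A f \<Longrightarrow> smooth_fun A (\<lambda>p. X p f)) \<Longrightarrow>
    vector_field A X"
  unfolding vector_field_on_def by blast

lemma vf_add: "vector_field A X \<Longrightarrow> vector_field A Y \<Longrightarrow> vector_field A (\<lambda>p. X p + Y p)"
  by (rule vfI) (auto intro!: tangent_add smooth_fun_on_add dest: vf_smooth vf_tangent)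

lemma vf_fscale: "smooth_fun A f \<Longrightarrow> vector_field A X \<Longrightarrow> vector_field A (\<lambda>p. f p *\<^sub>R X p)"
  by (rule vfI) (auto intro!: tangent_scale smooth_fun_on_mult dest: vf_smooth vf_tangent)

lemma vf_sum:
  assumes "\<And>i. i \<in> I \<Longrightarrow> vector_field A (X i)"
  shows "vector_field A (\<lambda>p. \<Sum>i\<in>I. X i p)"
proof (rule vfI)
  show "(\<Sum>i\<in>I. X i p) \<in> T p" for p
    by (intro tangent_sum_mem) (use assms vf_tangent in blast)
  show "smooth_fun A (\<lambda>p. (\<Sum>i\<in>I. X i p) f)" for f
    unfolding sum_fun_apply by (intro smooth_fun_on_sum open_UNIV) (use assms vf_smooth in blast)
qed

lemma vf_zero: "vector_field A (\<lambda>p. 0)"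
  by (rule vfI) (auto simp: tangent_0 smooth_fun_on_const)

text \<open>Take constant coefficients in a coordinate frame.\<close>

lemma vf_extend:
  assumes v: "v \<in> T p"
  obtains X where "vector_field A X" "X p = v"
proof -
  obtain W x E where "coordinate_frame W x E" and p: "p \<in> W" by (rule local_frame[of p])
  note F = coordinate_frameD(1)[OF this(1)] p coordinate_frameD(2-)[OF this(1)]
  show thesis
  proof
    show "vector_field A (\<lambda>q. \<Sum>b\<in>Basis. v (x b) *\<^sub>R E b q)"
      by (intro vf_sum vf_fscale smooth_intros F open_UNIV)
    show "(\<Sum>b\<in>Basis. v (x b) *\<^sub>R E b p) = v" using F(6)[OF F(2) v] by simp
  qed
qed

lemma bracket_apply: "lie_bracket X Y p f = X p (\<lambda>q. Y q f) - Y p (\<lambda>q. X q f)"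
  by (simp add: lie_bracket_def)

lemma tangentI:
  assumes "\<And>f g. smooth_fun A f \<Longrightarrow> smooth_fun A g \<Longrightarrow> v (\<lambda>x. f x + g x) = v f + v g"
    "\<And>c f. smooth_fun A f \<Longrightarrow> v (\<lambda>x. c * f x) = c * v f"
    "\<And>f g. smooth_fun A f \<Longrightarrow> smooth_fun A g \<Longrightarrow> v (\<lambda>x. f x * g x) = v f * g p + f p * v g"
    "\<And>f. \<not> smooth_fun A f \<Longrightarrow> v f = 0"
  shows "v \<in> T p"
  unfolding tangent_space_def using assms by blast

lemmas vf_apply = tangentD(1)[OF vf_tangent] tangent_diff[OF vf_tangent] tangent_minus[OF vf_tangent]
  tangentD(2)[OF vf_tangent] tangentD(3)[OF vf_tangent] tangent_const[OF vf_tangent] tangentD(4)[OF vf_tangent]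

lemma bracket_tangent [simp]:
  assumes X: "vector_field A X" and Y: "vector_field A Y"
  shows "lie_bracket X Y p \<in> T p"
proof (rule tangentI)
  fix f assume f: "\<not> smooth_fun A f"
  show "lie_bracket X Y p f = 0"
    unfolding bracket_apply vf_apply(7)[OF X f] vf_apply(7)[OF Y f]
    by (simp add: vf_apply(6)[OF X] vf_apply(6)[OF Y])
next
  fix f g assume f: "smooth_fun A f" and g: "smooth_fun A g"
  show "lie_bracket X Y p (\<lambda>x. f x + g x) = lie_bracket X Y p f + lie_bracket X Y p g"
    by (simp add: bracket_apply vf_apply(1)[OF X] vf_apply(1)[OF Y] f g vf_smooth[OF X] vf_smooth[OF Y])
  show "lie_bracket X Y p (\<lambda>x. f x * g x) = lie_bracket X Y p f * g p + f p * lie_bracket X Y p g"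
    by (simp add: bracket_apply vf_apply(1,5)[OF X] vf_apply(1,5)[OF Y] f g vf_smooth[OF X] vf_smooth[OF Y] smooth_intros algebra_simps)
next
  fix c f assume f: "smooth_fun A f"
  show "lie_bracket X Y p (\<lambda>x. c * f x) = c * lie_bracket X Y p f"
    by (simp add: bracket_apply vf_apply(4)[OF X] vf_apply(4)[OF Y] f vf_smooth[OF X] vf_smooth[OF Y] algebra_simps)
qed

lemma vf_bracket [simp]:
  assumes X: "vector_field A X" and Y: "vector_field A Y"
  shows "vector_field A (lie_bracket X Y)"
  by (rule vfI) (simp_all add: X Y bracket_apply smooth_fun_on_diff vf_smooth[OF X] vf_smooth[OF Y])

lemma bracket_skew: "lie_bracket X Y p = - lie_bracket Y X p"
  by (auto simp: fun_eq_iff bracket_apply)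

lemma bracket_add_left:
  assumes "vector_field A X" "vector_field A Y" "vector_field A Z"
  shows "lie_bracket (\<lambda>q. X q + Y q) Z p = lie_bracket X Z p + lie_bracket Y Z p"
  by (auto simp: fun_eq_iff bracket_apply vf_apply(1)[OF assms(3)] vf_smooth[OF assms(1)] vf_smooth[OF assms(2)])

text \<open>The second term is the reason why the bracket is not tensorial; in \<open>ext_d\<close> it is
  cancelled by the derivative of \<open>f\<close>.\<close>

lemma bracket_fscale_left:
  assumes "smooth_fun A f" "vector_field A X" "vector_field A Z"
  shows "lie_bracket (\<lambda>q. f q *\<^sub>R X q) Z p = f p *\<^sub>R lie_bracket X Z p - Z p f *\<^sub>R X p"
  by (auto simp: fun_eq_iff bracket_apply vf_apply(5)[OF assms(3)] vf_smooth[OF assms(2)] assms(1) algebra_simps)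

lemma covectorD:
  assumes "\<xi> \<in> coT p"
  shows "v \<in> T p \<Longrightarrow> w \<in> T p \<Longrightarrow> \<xi> (v + w) = \<xi> v + \<xi> w"
    "v \<in> T p \<Longrightarrow> \<xi> (c *\<^sub>R v) = c * \<xi> v"
    "v \<notin> T p \<Longrightarrow> \<xi> v = 0"
  using assms by (auto simp: cotangent_space_def)

lemma covectorI:
  assumes "\<And>v w. v \<in> T p \<Longrightarrow> w \<in> T p \<Longrightarrow> \<xi> (v + w) = \<xi> v + \<xi> w"
    "\<And>c v. v \<in> T p \<Longrightarrow> \<xi> (c *\<^sub>R v) = c * \<xi> v"
    "\<And>v. v \<notin> T p \<Longrightarrow> \<xi> v = 0"
  shows "\<xi> \<in> coT p"
  unfolding cotangent_space_def using assms by blast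

lemma covector_diff:
  assumes "\<xi> \<in> coT p" "v \<in> T p" "w \<in> T p"
  shows "\<xi> (v - w) = \<xi> v - \<xi> w"
  using covectorD(1)[OF assms(1,2) tangent_scale[OF assms(3), of "-1"]] covectorD(2)[OF assms(1,3), of "-1"]
  by simp

lemma covector_minus:
  assumes "\<xi> \<in> coT p" "v \<in> T p"
  shows "\<xi> (- v) = - \<xi> v"
  using covectorD(2)[OF assms, of "-1"] by simp

lemma covector_0: "\<xi> \<in> coT p \<Longrightarrow> \<xi> 0 = 0"
  using covectorD(2)[OF _ tangent_0, of \<xi> p 0] by simp

lemma covector_sum:
  assumes "\<xi> \<in> coT p"
  shows "(\<And>i. i \<in> I \<Longrightarrow> v i \<in> T p) \<Longrightarrow> \<xi> (\<Sum>i\<in>I. v i) = (\<Sum>i\<in>I. \<xi> (v i))"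
proof (induction I rule: infinite_finite_induct)
  case (insert i I)
  then have "(\<Sum>i\<in>I. v i) \<in> T p" "v i \<in> T p" by (auto intro: tangent_sum_mem)
  from covectorD(1)[OF assms this(2,1)] insert show ?case
    by (simp only: sum.insert not_False_eq_True insertI2)
qed (auto simp: covector_0[OF assms])

lemma subspace_cotangent: "subspace (coT p)"
  unfolding subspace_def
  by (auto simp: cotangent_space_def algebra_simps)

lemma covector_eqI:
  "\<xi> \<in> coT p \<Longrightarrow> \<zeta> \<in> coT p \<Longrightarrow>
    (\<And>v. v \<in> T p \<Longrightarrow> \<xi> v = \<zeta> v) \<Longrightarrow> \<xi> = \<zeta>"
  using covectorD(3) by (metis ext)

lemma form_covector: "one_form A \<eta> \<Longrightarrow> \<eta> p \<in> coT p"
  by (simp add: one_form_on_def)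

lemma form_smooth: "one_form A \<eta> \<Longrightarrow> vector_field A X \<Longrightarrow> smooth_fun A (\<lambda>p. \<eta> p (X p))"
  by (simp add: one_form_on_def)

lemma one_formI:
  "(\<And>p. \<eta> p \<in> coT p) \<Longrightarrow> (\<And>X. vector_field A X \<Longrightarrow> smooth_fun A (\<lambda>p. \<eta> p (X p))) \<Longrightarrow>
    one_form A \<eta>"
  unfolding one_form_on_def by blast

lemma two_formD:
  assumes "two_form A \<omega>"
  shows "v \<in> T p \<Longrightarrow> \<omega> p v \<in> coT p"
    "v \<in> T p \<Longrightarrow> (\<lambda>w. \<omega> p w v) \<in> coT p"
    "v \<in> T p \<Longrightarrow> \<omega> p v v = 0"
    "vector_field A X \<Longrightarrow> vector_field A Y \<Longrightarrow> smooth_fun A (\<lambda>p. \<omega> p (X p) (Y p))"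
    "v \<notin> T p \<Longrightarrow> \<omega> p v = 0"
proof -
  note c = assms[unfolded two_form_def]
  note * = conjunct1[OF c] conjunct1[OF conjunct2[OF c]] conjunct2[OF conjunct2[OF c]]
  show "v \<in> T p \<Longrightarrow> \<omega> p v \<in> coT p"
    "v \<in> T p \<Longrightarrow> (\<lambda>w. \<omega> p w v) \<in> coT p"
    "v \<in> T p \<Longrightarrow> \<omega> p v v = 0" using *(1) by blast+
  show "v \<notin> T p \<Longrightarrow> \<omega> p v = 0" using *(2) by simp
  show "vector_field A X \<Longrightarrow> vector_field A Y \<Longrightarrow> smooth_fun A (\<lambda>p. \<omega> p (X p) (Y p))" using *(3) by simp
qed

lemma two_form_unique:
  assumes \<omega>: "two_form A \<omega>" "two_form A \<omega>'"
    and eq: "\<And>X Y p. vector_field A X \<Longrightarrow> vector_field A Y \<Longrightarrow> \<omega> p (X p) (Y p) = \<omega>' p (X p) (Y p)"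
  shows "\<omega> = \<omega>'"
proof (rule ext)+
  fix p v w
  have off: "\<omega> p v w = 0" if "two_form A \<omega>" "\<not> (v \<in> T p \<and> w \<in> T p)" for \<omega>
    using that(2) two_formD(5)[OF that(1), of v p] covectorD(3)[OF two_formD(1)[OF that(1)], of v p w]
    by (cases "v \<in> T p") simp_all
  show "\<omega> p v w = \<omega>' p v w"
  proof (cases "v \<in> T p \<and> w \<in> T p")
    case True
    obtain X where X: "vector_field A X" "X p = v" using True by (rule vf_extend[OF conjunct1])
    obtain Y where Y: "vector_field A Y" "Y p = w" using True by (rule vf_extend[OF conjunct2])
    show ?thesis using eq[OF X(1) Y(1), of p] by (simp only: X Y)
  qed (simp add: off \<omega>)
qed

section \<open>The exterior derivative of a 1-form\<close>

text \<open>The invariant formula for \<open>d\<eta>\<close> on vector fields; \<open>d_form\<close> is the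
  unique \<open>2\<close>-form that agrees with it.\<close>

definition ext_d :: "('m \<Rightarrow> 'm covec) \<Rightarrow> ('m \<Rightarrow> 'm tvec) \<Rightarrow> ('m \<Rightarrow> 'm tvec) \<Rightarrow> 'm \<Rightarrow> real" where
  "ext_d \<eta> X Y p = X p (\<lambda>q. \<eta> q (Y q)) - Y p (\<lambda>q. \<eta> q (X q)) - \<eta> p (lie_bracket X Y p)"

context
  fixes \<eta> assumes \<eta>: "one_form A \<eta>"
begin

lemma ext_d_skew: "vector_field A X \<Longrightarrow> vector_field A Y \<Longrightarrow> ext_d \<eta> X Y p = - ext_d \<eta> Y X p"
  using covector_minus[OF form_covector[OF \<eta>] bracket_tangent[of Y X p]]
  by (simp add: ext_d_def bracket_skew[of X Y])

lemma ext_d_smooth: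
  assumes X: "vector_field A X" and Y: "vector_field A Y"
  shows "smooth_fun A (ext_d \<eta> X Y)"
  unfolding ext_d_def
  by (intro smooth_fun_on_diff open_UNIV vf_smooth[OF X] vf_smooth[OF Y] form_smooth[OF \<eta> vf_bracket[OF X Y]])

lemma ext_d_add:
  assumes "vector_field A X" "vector_field A X'" "vector_field A Y"
  shows "ext_d \<eta> (\<lambda>q. X q + X' q) Y p = ext_d \<eta> X Y p + ext_d \<eta> X' Y p"
  using assms
  by (simp add: ext_d_def bracket_add_left vf_tangent[OF assms(1)] vf_tangent[OF assms(2)] covectorD[OF form_covector[OF \<eta>]] vf_apply(1)[OF assms(3)] form_smooth[OF \<eta> assms(1)] form_smooth[OF \<eta> assms(2)])

lemma ext_d_fscale:
  assumes "smooth_fun A f" "vector_field A X" "vector_field A Y"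
  shows "ext_d \<eta> (\<lambda>q. f q *\<^sub>R X q) Y p = f p * ext_d \<eta> X Y p"
  using assms
  by (simp add: ext_d_def bracket_fscale_left vf_tangent[OF assms(2)] covectorD[OF form_covector[OF \<eta>]] vf_apply(5)[OF assms(3)] form_smooth[OF \<eta> assms(2)]
     covector_diff[OF form_covector[OF \<eta>]] tangent_scale algebra_simps)

lemma ext_d_sum:
  assumes "\<And>i. i \<in> I \<Longrightarrow> vector_field A (X i)" "vector_field A Y"
  shows "ext_d \<eta> (\<lambda>q. \<Sum>i\<in>I. X i q) Y p = (\<Sum>i\<in>I. ext_d \<eta> (X i) Y p)"
  using assms(1)
proof (induction I rule: infinite_finite_induct)
  have z: "ext_d \<eta> (\<lambda>q. 0) Y p = 0"
    using ext_d_fscale[OF smooth_fun_on_const[OF open_UNIV, of 0] vf_zero assms(2)] by simp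
  {
    case (infinite I)
    then show ?case by (simp only: sum.infinite not_False_eq_True z)
  next
    case empty
    show ?case by (simp only: sum.empty z)
  next
    case (insert i I)
    then have "vector_field A (\<lambda>q. \<Sum>i\<in>I. X i q)" "vector_field A (X i)" by (blast intro: vf_sum)+
    from ext_d_add[OF this(2,1) assms(2)] insert show ?case
      by (simp only: sum.insert not_False_eq_True insertI2)
  }
qed

lemma ext_d_local:
  assumes X: "vector_field A X" "vector_field A X'" and Y: "vector_field A Y"
    and V: "open V" "p \<in> V" "\<And>q. q \<in> V \<Longrightarrow> X q = X' q"
  shows "ext_d \<eta> X Y p = ext_d \<eta> X' Y p"
proof -
  have 1: "Y p (\<lambda>q. X q f) = Y p (\<lambda>q. X' q f)" for f
    by (rule tangent_local[OF vf_tangent[OF Y] V(1,2)]) (use X V in \<open>auto simp: vf_smooth[OF X(1)] vf_smooth[OF X(2)]\<close>)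
  have 2: "Y p (\<lambda>q. \<eta> q (X q)) = Y p (\<lambda>q. \<eta> q (X' q))"
    by (rule tangent_local[OF vf_tangent[OF Y] V(1,2)]) (use X V in \<open>auto simp: form_smooth[OF \<eta> X(1)] form_smooth[OF \<eta> X(2)]\<close>)
  have "lie_bracket X Y p = lie_bracket X' Y p"
    by (auto simp: fun_eq_iff bracket_apply 1 V)
  then show ?thesis by (simp add: ext_d_def 2 V)
qed

text \<open>Near \<open>p\<close> the field \<open>X\<close> is a combination of the frame fields with smooth
  coefficients, which come out of \<open>ext_d\<close> with their values at \<open>p\<close>.\<close>

lemma ext_d_pointwise_left:
  assumes X: "vector_field A X" "vector_field A X'" and Y: "vector_field A Y" and "X p = X' p"
  shows "ext_d \<eta> X Y p = ext_d \<eta> X' Y p"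
proof -
  obtain W x E where "coordinate_frame W x E" and p: "p \<in> W" by (rule local_frame[of p])
  note F = coordinate_frameD(1)[OF this(1)] p coordinate_frameD(2-)[OF this(1)]
  have "ext_d \<eta> X Y p = (\<Sum>b\<in>Basis. X p (x b) * ext_d \<eta> (E b) Y p)" if X: "vector_field A X" for X
  proof -
    have "ext_d \<eta> X Y p = ext_d \<eta> (\<lambda>q. \<Sum>b\<in>Basis. X q (x b) *\<^sub>R E b q) Y p"
      by (rule ext_d_local[OF X _ Y F(1,2)])
        (use X F vf_tangent[OF X] in \<open>auto intro!: vf_sum vf_fscale vf_smooth[OF X]\<close>)
    also have "\<dots> = (\<Sum>b\<in>Basis. X p (x b) * ext_d \<eta> (E b) Y p)"
      using X F Y by (subst ext_d_sum) (auto intro!: vf_fscale sum.cong ext_d_fscale vf_smooth[OF X])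
    finally show ?thesis .
  qed
  then show ?thesis using assms by simp
qed

lemma ext_d_pointwise:
  assumes "vector_field A X" "vector_field A X'" "vector_field A Y" "vector_field A Y'"
    "X p = X' p" "Y p = Y' p"
  shows "ext_d \<eta> X Y p = ext_d \<eta> X' Y' p"
  using ext_d_pointwise_left[of X X' Y p] ext_d_pointwise_left[of Y Y' X' p] ext_d_skew assms by metis

text \<open>Evaluate the invariant formula on arbitrary vector fields through the given vectors; the choice
  does not matter.\<close>

lemma two_form_d_exists:
  "\<exists>\<omega>. two_form A \<omega> \<and> (\<forall>X Y. vector_field A X \<longrightarrow> vector_field A Y \<longrightarrow> (\<forall>p. \<omega> p (X p) (Y p) = ext_d \<eta> X Y p))"
proof -
  define e where "e p v = (SOME X. vector_field A X \<and> X p = v)" for p v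
  have e: "vector_field A (e p v)" "e p v p = v" if "v \<in> T p" for p v
    using vf_extend[OF that] someI_ex[of "\<lambda>X. vector_field A X \<and> X p = v"]
    unfolding e_def by blast+
  define \<omega> where "\<omega> p v w = (if v \<in> T p \<and> w \<in> T p
     then ext_d \<eta> (e p v) (e p w) p else 0)" for p v w
  have \<omega>: "\<omega> p (X p) (Y p) = ext_d \<eta> X Y p" if "vector_field A X" "vector_field A Y" for X Y p
  proof -
    note t = vf_tangent[OF that(1), of p] vf_tangent[OF that(2), of p]
    have "\<omega> p (X p) (Y p) = ext_d \<eta> (e p (X p)) (e p (Y p)) p"
      unfolding \<omega>_def by (rule if_P) (rule conjI[OF t])
    also have "\<dots> = ext_d \<eta> X Y p"
      by (rule ext_d_pointwise[OF e(1)[OF t(1)] that(1) e(1)[OF t(2)] that(2) e(2)[OF t(1)] e(2)[OF t(2)]])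
    finally show ?thesis .
  qed
  have skew: "\<omega> p v w = - \<omega> p w v" for p v w
  proof (cases "v \<in> T p \<and> w \<in> T p")
    case True
    then show ?thesis
      using ext_d_skew[OF e(1) e(1), of v p w p p] by (simp add: \<omega>_def)
  qed (auto simp: \<omega>_def)
  have add: "\<omega> p (v + v') w = \<omega> p v w + \<omega> p v' w"
    if v: "v \<in> T p" "v' \<in> T p" "w \<in> T p" for p v v' w
    using \<omega>[OF vf_add[OF e(1)[OF v(1)] e(1)[OF v(2)]] e(1)[OF v(3)], of p]
      ext_d_add[OF e(1)[OF v(1)] e(1)[OF v(2)] e(1)[OF v(3)], of p] v e
    by (simp add: \<omega>_def)
  have scale: "\<omega> p (c *\<^sub>R v) w = c * \<omega> p v w"
    if v: "v \<in> T p" "w \<in> T p" for p v w c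
    using \<omega>[OF vf_fscale[OF smooth_fun_on_const[OF open_UNIV, of c] e(1)[OF v(1)]] e(1)[OF v(2)], of p]
      ext_d_fscale[OF smooth_fun_on_const[OF open_UNIV, of c] e(1)[OF v(1)] e(1)[OF v(2)], of p] v e
    by (simp add: \<omega>_def)
  have right: "(\<lambda>w. \<omega> p w v) \<in> coT p" if v: "v \<in> T p" for p v
    by (rule covectorI) (simp_all only: add scale v, simp add: \<omega>_def)
  have neg: "\<omega> p v = (-1) *\<^sub>R (\<lambda>w. \<omega> p w v)" for p v
    using skew[of p v] by (simp add: fun_eq_iff)
  have left: "\<omega> p v \<in> coT p" if "v \<in> T p" for p v
    by (subst neg) (rule subspace_scale[OF subspace_cotangent right[OF that]])
  have alt: "\<omega> p v v = 0" for p v using skew[of p v v] by simp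
  have smooth: "smooth_fun A (\<lambda>p. \<omega> p (X p) (Y p))" if "vector_field A X" "vector_field A Y" for X Y
    unfolding \<omega>[OF that] by (rule ext_d_smooth[OF that])
  have off: "\<omega> p v = 0" if "v \<notin> T p" for p v
    using that by (simp add: \<omega>_def fun_eq_iff)
  have "two_form A \<omega>"
    unfolding two_form_def
    by (intro conjI allI ballI impI) (erule left, erule right, rule alt, erule off, erule (1) smooth)
  then show ?thesis using \<omega> by blast
qed

lemma d_form_eqI:
  assumes "two_form A \<omega>"
    "\<And>X Y p. vector_field A X \<Longrightarrow> vector_field A Y \<Longrightarrow> \<omega> p (X p) (Y p) = ext_d \<eta> X Y p"
  shows "d_form A \<eta> = \<omega>"
  unfolding d_form_def
proof (rule the_equality)
  show "two_form A \<omega> \<and> (\<forall>X Y. vector_field A X \<longrightarrow> vector_field A Y \<longrightarrow>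
        (\<forall>p. \<omega> p (X p) (Y p) = X p (\<lambda>q. \<eta> q (Y q)) - Y p (\<lambda>q. \<eta> q (X q)) - \<eta> p (lie_bracket X Y p)))"
    using assms unfolding ext_d_def by blast
next
  fix \<omega>'
  assume "two_form A \<omega>' \<and> (\<forall>X Y. vector_field A X \<longrightarrow> vector_field A Y \<longrightarrow>
        (\<forall>p. \<omega>' p (X p) (Y p) = X p (\<lambda>q. \<eta> q (Y q)) - Y p (\<lambda>q. \<eta> q (X q)) - \<eta> p (lie_bracket X Y p)))"
  then show "\<omega>' = \<omega>"
    by (intro two_form_unique[OF _ assms(1)]) (auto simp: assms(2) ext_d_def)
qed

lemma two_form_d: "two_form A (d_form A \<eta>)"
  and d_form_apply: "vector_field A X \<Longrightarrow> vector_field A Y \<Longrightarrow> d_form A \<eta> p (X p) (Y p) = ext_d \<eta> X Y p"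
proof -
  obtain \<omega> where \<omega>: "two_form A \<omega>"
    "\<And>X Y p. vector_field A X \<Longrightarrow> vector_field A Y \<Longrightarrow> \<omega> p (X p) (Y p) = ext_d \<eta> X Y p"
    using two_form_d_exists by blast
  have eq: "d_form A \<eta> = \<omega>" by (rule d_form_eqI[OF \<omega>])
  show "two_form A (d_form A \<eta>)" unfolding eq by (rule \<omega>)
  show "vector_field A X \<Longrightarrow> vector_field A Y \<Longrightarrow> d_form A \<eta> p (X p) (Y p) = ext_d \<eta> X Y p"
    unfolding eq by (rule \<omega>)
qed

end

lemma two_form_skew:
  assumes \<omega>: "two_form A \<omega>" and v: "v \<in> T p" "w \<in> T p"
  shows "\<omega> p v w = - \<omega> p w v"
proof -
  have vw: "v + w \<in> T p" using v by (rule tangent_add)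
  have "\<omega> p (v + w) (v + w) = \<omega> p (v + w) v + \<omega> p (v + w) w"
    by (rule covectorD(1)[OF two_formD(1)[OF \<omega> vw] v])
  also have "\<dots> = \<omega> p v w + \<omega> p w v"
    using covectorD(1)[OF two_formD(2)[OF \<omega> v(1)] v] covectorD(1)[OF two_formD(2)[OF \<omega> v(2)] v]
      two_formD(3)[OF \<omega>] v by simp
  finally show ?thesis using two_formD(3)[OF \<omega> vw] by simp
qed

section \<open>The contact condition as nondegeneracy\<close>

text \<open>Triviality of the kernel of \<open>\<Omega>\<close> at \<open>p\<close>.\<close>

definition nondeg :: "('m \<Rightarrow> 'm covec) \<Rightarrow> 'm \<Rightarrow> bool" where
  "nondeg \<eta> p \<longleftrightarrow> (\<forall>v\<in>T p. \<forall>a.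
     d_form A \<eta> p v + a *\<^sub>R \<eta> p = 0 \<and> \<eta> p v = 0 \<longrightarrow> v = 0 \<and> a = 0)"

lemma tangent_basis:
  obtains e where "\<And>i. e i \<in> T p"
    "T p = span (e ` {..<DIM('e)})"
    "inj_on e {..<DIM('e)}" "independent (e ` {..<DIM('e)})"
proof -
  obtain W x E where "coordinate_frame W x E" and p: "p \<in> W" by (rule local_frame[of p])
  note F = coordinate_frameD(1)[OF this(1)] p coordinate_frameD(2-)[OF this(1)]
  obtain \<beta> :: "nat \<Rightarrow> 'e" where "bij_betw \<beta> {0..<DIM('e)} Basis"
    using ex_bij_betw_nat_finite[OF finite_Basis] by blast
  then have \<beta>: "bij_betw \<beta> {..<DIM('e)} Basis" by (simp add: atLeast0LessThan)
  have im: "(\<lambda>i. E (\<beta> i) p) ` {..<DIM('e)} = (\<lambda>b. E b p) ` Basis"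
  proof -
    have "(\<lambda>i. E (\<beta> i) p) ` {..<DIM('e)} = (\<lambda>b. E b p) ` (\<beta> ` {..<DIM('e)})"
      by (simp only: image_image)
    also have "\<beta> ` {..<DIM('e)} = Basis" by (rule bij_betw_imp_surj_on[OF \<beta>])
    finally show ?thesis .
  qed
  have "inj_on (\<lambda>b. E b p) Basis \<and> independent ((\<lambda>b. E b p) ` Basis)"
    unfolding independent_family[OF finite_Basis]
  proof (intro allI impI ballI)
    fix c and b0 :: 'e assume 0: "(\<Sum>b\<in>Basis. c b *\<^sub>R E b p) = 0" and b0: "b0 \<in> Basis"
    have "c b * E b p (x b0) = (if b = b0 then c b0 else 0)" if "b \<in> Basis" for b
      using F(5)[OF F(2) that b0] by simp
    then have "(\<Sum>b\<in>Basis. c b *\<^sub>R E b p) (x b0) = (\<Sum>b\<in>Basis. if b = b0 then c b0 else 0)"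
      by (simp add: sum_fun_apply)
    also have "\<dots> = c b0" using b0 by simp
    finally show "c b0 = 0" using 0 by simp
  qed
  then have inj: "inj_on (\<lambda>b. E b p) Basis" and ind2: "independent ((\<lambda>i. E (\<beta> i) p) ` {..<DIM('e)})"
    unfolding im by blast+
  have ind1: "inj_on (\<lambda>i. E (\<beta> i) p) {..<DIM('e)}"
  proof (rule inj_onI)
    fix i j assume ij: "i \<in> {..<DIM('e)}" "j \<in> {..<DIM('e)}" "E (\<beta> i) p = E (\<beta> j) p"
    have "\<beta> i = \<beta> j"
      by (rule inj_onD[OF inj ij(3)]) (use bij_betwE[OF \<beta>] ij in blast)+
    then show "i = j" using bij_betw_imp_inj_on[OF \<beta>] ij by (meson inj_onD)
  qed
  note ind = ind1 ind2
  have "T p = span ((\<lambda>b. E b p) ` Basis)"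
  proof
    show "T p \<subseteq> span ((\<lambda>b. E b p) ` Basis)"
      unfolding span_family[OF finite_Basis]
    proof
      fix v assume "v \<in> T p"
      from F(6)[OF F(2) this]
      show "v \<in> {\<Sum>b\<in>Basis. c b *\<^sub>R E b p | c. True}"
        by (intro CollectI exI[of _ "\<lambda>b. v (x b)"] conjI TrueI)
    qed
    show "span ((\<lambda>b. E b p) ` Basis) \<subseteq> T p"
      by (rule span_minimal[OF _ subspace_tangent]) (use vf_tangent[OF F(4)] in blast)
  qed
  then show thesis
    using that[of "\<lambda>i. E (\<beta> i) p"] vf_tangent[OF F(4)] ind unfolding im by blast
qed

lemma independent_spans_tangent:
  assumes "\<And>i. i < DIM('e) \<Longrightarrow> v i \<in> T p"
    "inj_on v {..<DIM('e)}" "independent (v ` {..<DIM('e)})"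
  shows "T p \<subseteq> span (v ` {..<DIM('e)})"
proof -
  obtain e where e: "\<And>i. e i \<in> T p"
    "T p = span (e ` {..<DIM('e)})"
    "inj_on e {..<DIM('e)}" "independent (e ` {..<DIM('e)})"
    by (rule tangent_basis[of p]) blast
  have sub: "v ` {..<DIM('e)} \<subseteq> span (e ` {..<DIM('e)})" using assms(1) e(2) by auto
  show ?thesis
  proof (rule subsetI, rule ccontr)
    fix w assume w: "w \<in> T p" "w \<notin> span (v ` {..<DIM('e)})"
    have "w \<notin> v ` {..<DIM('e)}" using w(2) span_base[of w "v ` {..<DIM('e)}"] by (rule contrapos_nn)
    moreover have "independent (insert w (v ` {..<DIM('e)}))"
      using w(2) assms(3) by (rule independent_insertI)
    moreover have "insert w (v ` {..<DIM('e)}) \<subseteq> span (e ` {..<DIM('e)})"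
      using w(1) e(2) sub by auto
    ultimately have "Suc (card (v ` {..<DIM('e)})) \<le> card (e ` {..<DIM('e)})"
      using independent_span_bound[of "e ` {..<DIM('e)}" "insert w (v ` {..<DIM('e)})"] by simp
    then show False using e(3) assms(2) by (simp add: card_image)
  qed
qed

text \<open>The matrix \<open>a\<close> in the proof is that of \<open>\<Omega>\<close> on \<open>(0, 1),
  (v\<^sub>0, 0), \<dots>, (v\<^sub>2\<^sub>n, 0)\<close>, padded with zeros to be skew for all
  indices. Expanding its Pfaffian along row \<open>0\<close> gives the top form.\<close>

lemma top_form_nonzero_iff:
  assumes \<eta>: "one_form A \<eta>" and v: "\<And>i. i < 2 * n + 1 \<Longrightarrow> v i \<in> T p"
  shows "wedge 1 (2 * n) (\<lambda>u. \<eta> p (u 0)) (wedge_power 2 (\<lambda>u. d_form A \<eta> p (u 0) (u 1)) n) v \<noteq> 0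
    \<longleftrightarrow> (\<forall>b c. \<eta> p (\<Sum>i<2 * n + 1. c i *\<^sub>R v i) = 0 \<and>
      (\<forall>k<2 * n + 1. d_form A \<eta> p (\<Sum>i<2 * n + 1. c i *\<^sub>R v i) (v k) + b * \<eta> p (v k) = 0)
      \<longrightarrow> b = 0 \<and> (\<forall>i<2 * n + 1. c i = 0))" (is "?w v \<noteq> 0 \<longleftrightarrow> ?R")
proof -
  let ?d = "d_form A \<eta> p"
  note d = two_form_d[OF \<eta>]
  define a where "a i j = (if i < 2 * Suc n \<and> j < 2 * Suc n then
      (if i = 0 then (if j = 0 then 0 else \<eta> p (v (j - 1))) else
        if j = 0 then - \<eta> p (v (i - 1)) else ?d (v (i - 1)) (v (j - 1))) else 0)" for i j
  have skew: "a i j = - a j i" for i j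
    using two_form_skew[OF d v v, of "i - 1" "j - 1"] by (auto simp: a_def)
  obtain c where c: "c > 0" "\<And>v. wedge_power 2 (\<lambda>u. ?d (u 0) (u 1)) n v =
     c * alt (2 * n) (\<lambda>v. \<Prod>i<n. ?d (v (2 * i)) (v (Suc (2 * i)))) v"
    using wedge_power_eq_alt[of ?d n] by blast
  have "?w v = c * alt (1 + 2 * n) (\<lambda>v. \<eta> p (v 0) * (\<Prod>i<n. ?d (v (1 + 2 * i)) (v (1 + Suc (2 * i))))) v"
    using wedge_eq_alt[of 1 "\<lambda>u. \<eta> p (u 0)", OF _ c(2), of v] by simp
  also have "alt (1 + 2 * n) (\<lambda>v. \<eta> p (v 0) * (\<Prod>i<n. ?d (v (1 + 2 * i)) (v (1 + Suc (2 * i))))) v =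
    (\<Sum>\<tau> | \<tau> permutes {..<Suc (2 * n)}. of_int (sign \<tau>) *
    (a 0 (Suc (\<tau> 0)) * (\<Prod>i<n. a (Suc (\<tau> (Suc (2 * i)))) (Suc (\<tau> (Suc (Suc (2 * i))))))))"
    unfolding alt_def add_Suc plus_1_eq_Suc
  proof (intro sum.cong refl arg_cong2[of _ _ _ _ "(*)"] prod.cong)
    fix \<tau> assume "\<tau> \<in> {\<tau>. \<tau> permutes {..<Suc (2 * n)}}"
    then have lt: "\<tau> i < Suc (2 * n)" if "i < Suc (2 * n)" for i
      using permutes_in_image[of \<tau> "{..<Suc (2 * n)}" i] that by simp
    show "\<eta> p ((v \<circ> \<tau>) 0) = a 0 (Suc (\<tau> 0))" using lt[of 0] by (simp add: a_def)
    fix i assume "i \<in> {..<n}"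
    then show "?d ((v \<circ> \<tau>) (Suc (2 * i))) ((v \<circ> \<tau>) (Suc (Suc (2 * i)))) =
      a (Suc (\<tau> (Suc (2 * i)))) (Suc (\<tau> (Suc (Suc (2 * i)))))"
      using lt[of "Suc (2 * i)"] lt[of "Suc (Suc (2 * i))"] by (simp add: a_def)
  qed
  finally have "?w v \<noteq> 0 \<longleftrightarrow> pf (Suc n) a \<noteq> 0"
    unfolding pf_expand_shift[OF skew] using c(1) by simp
  also have "\<dots> \<longleftrightarrow> (\<forall>c. (\<forall>j<2 * Suc n. (\<Sum>i<2 * Suc n. c i * a i j) = 0) \<longrightarrow> (\<forall>i<2 * Suc n. c i = 0))"
    by (rule pf_nonzero_iff[OF skew])
  also have "\<dots> \<longleftrightarrow> ?R"
  proof -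
    let ?N = "2 * n + 1"
    have less: "(\<forall>j<2 * Suc n. P j) \<longleftrightarrow> P 0 \<and> (\<forall>j<?N. P (Suc j))" for P
      by (auto simp: less_Suc_eq_0_disj)
    have sum: "(\<Sum>i<2 * Suc n. f i) = f 0 + (\<Sum>i<?N. f (Suc i))" for f :: "nat \<Rightarrow> real"
      by (simp add: sum.lessThan_Suc_shift del: sum.lessThan_Suc)
    have sp: "c i *\<^sub>R v i \<in> T p" if "i \<in> {..<?N}" for c i
      using that v by (intro tangent_scale) auto
    have \<eta>s: "\<eta> p (\<Sum>i<?N. c i *\<^sub>R v i) = (\<Sum>i<?N. c i * \<eta> p (v i))" for c
    proof -
      have "\<eta> p (\<Sum>i<?N. c i *\<^sub>R v i) = (\<Sum>i<?N. \<eta> p (c i *\<^sub>R v i))"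
        by (rule covector_sum[OF form_covector[OF \<eta>] sp])
      also have "\<dots> = (\<Sum>i<?N. c i * \<eta> p (v i))"
        by (rule sum.cong[OF refl], rule covectorD(2)[OF form_covector[OF \<eta>] v]) simp
      finally show ?thesis .
    qed
    have ds: "?d (\<Sum>i<?N. c i *\<^sub>R v i) w = (\<Sum>i<?N. c i * ?d (v i) w)" if w: "w \<in> T p" for c w
    proof -
      have "?d (\<Sum>i<?N. c i *\<^sub>R v i) w = (\<Sum>i<?N. ?d (c i *\<^sub>R v i) w)"
        by (rule covector_sum[OF two_formD(2)[OF d w] sp])
      also have "\<dots> = (\<Sum>i<?N. c i * ?d (v i) w)"
        by (rule sum.cong[OF refl], rule covectorD(2)[OF two_formD(2)[OF d w] v]) simp
      finally show ?thesis .
    qed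
    have row0: "(\<Sum>i<2 * Suc n. c i * a i 0) = - \<eta> p (\<Sum>i<?N. c (Suc i) *\<^sub>R v i)" for c
      unfolding sum \<eta>s by (simp add: a_def sum_negf)
    have row: "(\<Sum>i<2 * Suc n. c i * a i (Suc k)) = ?d (\<Sum>i<?N. c (Suc i) *\<^sub>R v i) (v k) + c 0 * \<eta> p (v k)"
      if "k < ?N" for c k
      unfolding sum ds[OF v[OF that]] using that by (simp add: a_def)
    show ?thesis
    proof
      assume L: "\<forall>c. (\<forall>j<2 * Suc n. (\<Sum>i<2 * Suc n. c i * a i j) = 0) \<longrightarrow> (\<forall>i<2 * Suc n. c i = 0)"
      show ?R
      proof (intro allI impI)
        fix b c assume *: "\<eta> p (\<Sum>i<?N. c i *\<^sub>R v i) = 0 \<and> (\<forall>k<?N. ?d (\<Sum>i<?N. c i *\<^sub>R v i) (v k) + b * \<eta> p (v k) = 0)"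
        let ?c = "\<lambda>i. if i = 0 then b else c (i - 1)"
        have "\<forall>j<2 * Suc n. (\<Sum>i<2 * Suc n. ?c i * a i j) = 0"
          unfolding less row0 using row[of _ ?c] * by simp
        then have "\<forall>i<2 * Suc n. ?c i = 0" by (rule mp[OF spec[OF L, of ?c]])
        then show "b = 0 \<and> (\<forall>i<?N. c i = 0)" unfolding less by simp
      qed
    next
      assume R: ?R
      show "\<forall>c. (\<forall>j<2 * Suc n. (\<Sum>i<2 * Suc n. c i * a i j) = 0) \<longrightarrow> (\<forall>i<2 * Suc n. c i = 0)"
      proof (intro allI impI)
        fix c i assume "\<forall>j<2 * Suc n. (\<Sum>i<2 * Suc n. c i * a i j) = 0" and i: "i < 2 * Suc n"
        then have "\<eta> p (\<Sum>i<?N. c (Suc i) *\<^sub>R v i) = 0 \<and>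
          (\<forall>k<?N. ?d (\<Sum>i<?N. c (Suc i) *\<^sub>R v i) (v k) + c 0 * \<eta> p (v k) = 0)"
          unfolding less row0 using row[of _ c] by simp
        then have "c 0 = 0 \<and> (\<forall>i<?N. c (Suc i) = 0)"
          by (rule mp[OF spec[OF spec[OF R, of "c 0"], of "\<lambda>i. c (Suc i)"]])
        then have "\<forall>i<2 * Suc n. c i = 0" unfolding less .
        then show "c i = 0" using i by simp
      qed
    qed
  qed
  finally show ?thesis .
qed

text \<open>If the top form is nonzero on \<open>v\<close>, then \<open>v\<close> is independent, hence spans
  the tangent space, and the kernel of \<open>\<Omega>\<close> is visible in the coefficients with
  respect to \<open>v\<close>. Conversely any basis will do for \<open>v\<close>.\<close>

lemma contact_iff_nondeg:
  assumes \<eta>: "one_form A \<eta>" and dim: "DIM('e) = 2 * n + 1"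
  shows "contact_form A n \<eta> \<longleftrightarrow> (\<forall>p. nondeg \<eta> p)"
proof -
  note d = two_form_d[OF \<eta>]
  note cov = form_covector[OF \<eta>]
  have "(\<exists>v. (\<forall>i<2 * n + 1. v i \<in> T p) \<and>
        wedge 1 (2 * n) (\<lambda>u. \<eta> p (u 0)) (wedge_power 2 (\<lambda>u. d_form A \<eta> p (u 0) (u 1)) n) v \<noteq> 0)
    \<longleftrightarrow> nondeg \<eta> p" for p
  proof
    assume "\<exists>v. (\<forall>i<2 * n + 1. v i \<in> T p) \<and>
        wedge 1 (2 * n) (\<lambda>u. \<eta> p (u 0)) (wedge_power 2 (\<lambda>u. d_form A \<eta> p (u 0) (u 1)) n) v \<noteq> 0"
    then obtain v where v: "\<And>i. i < 2 * n + 1 \<Longrightarrow> v i \<in> T p"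
      and w: "wedge 1 (2 * n) (\<lambda>u. \<eta> p (u 0)) (wedge_power 2 (\<lambda>u. d_form A \<eta> p (u 0) (u 1)) n) v \<noteq> 0"
      by blast
    have free: "b = 0 \<and> (\<forall>i<2 * n + 1. c i = 0)"
      if "\<eta> p (\<Sum>i<2 * n + 1. c i *\<^sub>R v i) = 0"
        "\<And>k. k < 2 * n + 1 \<Longrightarrow> d_form A \<eta> p (\<Sum>i<2 * n + 1. c i *\<^sub>R v i) (v k) + b * \<eta> p (v k) = 0" for b c
      by (rule mp[OF spec[OF spec[OF iffD1[OF top_form_nonzero_iff[OF \<eta> v] w], of b], of c]])
        (assumption | intro conjI allI impI that)+
    have d0: "d_form A \<eta> p 0 = 0"
    proof
      fix w
      show "d_form A \<eta> p 0 w = 0 w"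
      proof (cases "w \<in> T p")
        case True
        then show ?thesis using covector_0[OF two_formD(2)[OF d True]] by simp
      next
        case False
        then show ?thesis using covectorD(3)[OF two_formD(1)[OF d tangent_0] False] by simp
      qed
    qed
    have "inj_on v {..<2 * n + 1} \<and> independent (v ` {..<2 * n + 1})"
      unfolding independent_family[OF finite_lessThan]
    proof (intro allI impI)
      fix c assume 0: "(\<Sum>i<2 * n + 1. c i *\<^sub>R v i) = 0"
      show "\<forall>i\<in>{..<2 * n + 1}. c i = 0"
        using free[of c 0, unfolded 0] by (simp add: covector_0[OF cov] d0)
    qed
    then have sp: "T p \<subseteq> span (v ` {..<2 * n + 1})"
      using independent_spans_tangent[of v p] v dim by simp
    show "nondeg \<eta> p"
      unfolding nondeg_def
    proof (intro ballI allI impI)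
      fix X a assume X: "X \<in> T p" and *: "d_form A \<eta> p X + a *\<^sub>R \<eta> p = 0 \<and> \<eta> p X = 0"
      obtain c where c: "X = (\<Sum>i<2 * n + 1. c i *\<^sub>R v i)"
        using X sp unfolding span_family[OF finite_lessThan] by blast
      have "d_form A \<eta> p X (v k) + a * \<eta> p (v k) = 0" for k
        using fun_cong[OF conjunct1[OF *], of "v k"] by simp
      then have "a = 0 \<and> (\<forall>i<2 * n + 1. c i = 0)" using free[of c a] * unfolding c by blast
      then show "X = 0 \<and> a = 0" unfolding c by (auto intro!: sum.neutral)
    qed
  next
    assume nd: "nondeg \<eta> p"
    obtain e where e: "\<And>i. e i \<in> T p"
      "T p = span (e ` {..<2 * n + 1})"
      "inj_on e {..<2 * n + 1}" "independent (e ` {..<2 * n + 1})"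
      using tangent_basis[of p] unfolding dim by blast
    have ind: "\<forall>c. (\<Sum>i<2 * n + 1. c i *\<^sub>R e i) = 0 \<longrightarrow> (\<forall>i\<in>{..<2 * n + 1}. c i = 0)"
      using e(3,4) independent_family[of "{..<2 * n + 1}" e] by blast
    have "wedge 1 (2 * n) (\<lambda>u. \<eta> p (u 0)) (wedge_power 2 (\<lambda>u. d_form A \<eta> p (u 0) (u 1)) n) e \<noteq> 0"
      unfolding top_form_nonzero_iff[where v = e and p = p and n = n, OF \<eta> e(1)]
    proof (intro allI impI)
      fix b c
      let ?X = "\<Sum>i<2 * n + 1. c i *\<^sub>R e i"
      assume *: "\<eta> p ?X = 0 \<and> (\<forall>k<2 * n + 1. d_form A \<eta> p ?X (e k) + b * \<eta> p (e k) = 0)"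
      have X: "?X \<in> T p" by (intro tangent_sum_mem tangent_scale e)
      let ?\<xi> = "d_form A \<eta> p ?X + b *\<^sub>R \<eta> p"
      have \<xi>: "?\<xi> \<in> coT p"
        by (intro subspace_add[OF subspace_cotangent] subspace_scale[OF subspace_cotangent] two_formD(1)[OF d X] cov)
      have "?\<xi> = 0"
      proof (rule covector_eqI[OF \<xi> subspace_0[OF subspace_cotangent]])
        fix w assume "w \<in> T p"
        then obtain k where w: "w = (\<Sum>i<2 * n + 1. k i *\<^sub>R e i)"
          unfolding e(2) span_family[OF finite_lessThan] by blast
        have "?\<xi> w = (\<Sum>i<2 * n + 1. ?\<xi> (k i *\<^sub>R e i))"
          unfolding w by (rule covector_sum[OF \<xi>]) (intro tangent_scale e)
        also have "\<dots> = 0"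
        proof (rule sum.neutral, rule ballI)
          fix i assume "i \<in> {..<2 * n + 1}"
          then have "?\<xi> (e i) = 0" using * by simp
          then show "?\<xi> (k i *\<^sub>R e i) = 0" unfolding covectorD(2)[OF \<xi> e(1)] by simp
        qed
        finally show "?\<xi> w = 0 w" by simp
      qed
      then have "?X = 0 \<and> b = 0" using nd X * unfolding nondeg_def by blast
      then show "b = 0 \<and> (\<forall>i<2 * n + 1. c i = 0)" using ind by auto
    qed
    then show "\<exists>v. (\<forall>i<2 * n + 1. v i \<in> T p) \<and>
        wedge 1 (2 * n) (\<lambda>u. \<eta> p (u 0)) (wedge_power 2 (\<lambda>u. d_form A \<eta> p (u 0) (u 1)) n) v \<noteq> 0"
      using e(1) by blast
  qed
  then show ?thesis using \<eta> by (simp only: contact_form_def simp_thms)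
qed

section \<open>Involutivity of the graph of a 1-form\<close>

abbreviation graph_elem :: "('m \<Rightarrow> 'm covec) \<Rightarrow> 'm \<Rightarrow> 'm tvec \<Rightarrow> real \<Rightarrow> 'm E1_elem" where
  "graph_elem \<eta> p v a \<equiv> ((v, a), (d_form A \<eta> p v + a *\<^sub>R \<eta> p, - \<eta> p v))"

lemma L_of_eq:
  assumes \<eta>: "one_form A \<eta>"
  shows "L_of A \<eta> x = {graph_elem \<eta> x v a | v a. v \<in> T x}"
proof (intro set_eqI iffI)
  fix z assume "z \<in> L_of A \<eta> x"
  then obtain X f where X: "vector_field A X"
    and z: "z = ((X x, f x), (d_form A \<eta> x (X x) + f x *\<^sub>R \<eta> x, - \<eta> x (X x)))"
    unfolding L_of_def by blast
  show "z \<in> {graph_elem \<eta> x v a | v a. v \<in> T x}"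
    unfolding z using vf_tangent[OF X] by blast
next
  fix z assume "z \<in> {graph_elem \<eta> x v a | v a. v \<in> T x}"
  then obtain v a where v: "v \<in> T x"
    and z: "z = graph_elem \<eta> x v a" by blast
  obtain X where X: "vector_field A X" "X x = v" by (rule vf_extend[OF v])
  have sm: "smooth_fun A (\<lambda>_. a)" by (rule smooth_fun_on_const[OF open_UNIV])
  have "((X x, a), (d_form A \<eta> x (X x) + a *\<^sub>R \<eta> x, - \<eta> x (X x))) \<in> L_of A \<eta> x"
    unfolding L_of_def
    by (rule CollectI, rule exI[of _ X], rule exI[of _ "\<lambda>_. a"]) (simp only: X(1) sm simp_thms)
  then show "z \<in> L_of A \<eta> x" unfolding z X(2) .
qed

lemma jacobi:
  assumes X: "vector_field A X" and Y: "vector_field A Y" and Z: "vector_field A Z"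
  shows "lie_bracket (lie_bracket X Y) Z p =
    lie_bracket X (lie_bracket Y Z) p - lie_bracket Y (lie_bracket X Z) p"
proof
  fix f
  note s = vf_smooth[OF X] vf_smooth[OF Y] vf_smooth[OF Z]
  show "lie_bracket (lie_bracket X Y) Z p f =
    (lie_bracket X (lie_bracket Y Z) p - lie_bracket Y (lie_bracket X Z) p) f"
    by (simp add: bracket_apply vf_apply(2)[OF X s(2,3)] vf_apply(2)[OF X s(3,2)] vf_apply(2)[OF Y s(1,3)]
        vf_apply(2)[OF Y s(3,1)] vf_apply(2)[OF Z s(1,2)])
qed

text \<open>The identity \<open>d d\<eta> = 0\<close>, written with \<open>d\<eta>\<close> as
  \<open>ext_d\<close>. After expansion the second derivatives cancel by the definition of the
  bracket, and the rest is the Jacobi identity.\<close>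

lemma ext_d_closed:
  assumes \<eta>: "one_form A \<eta>" and X: "vector_field A X" and Y: "vector_field A Y" and Z: "vector_field A Z"
  shows "ext_d \<eta> (lie_bracket X Y) Z p =
    X p (\<lambda>q. ext_d \<eta> Y Z q) - Y p (\<lambda>q. ext_d \<eta> X Z q) + Z p (\<lambda>q. ext_d \<eta> X Y q)
    + ext_d \<eta> X (lie_bracket Y Z) p - ext_d \<eta> Y (lie_bracket X Z) p"
proof -
  note s = vf_smooth[OF X] vf_smooth[OF Y] vf_smooth[OF Z]
  have e: "smooth_fun A (\<lambda>q. \<eta> q (lie_bracket X Y q))" "smooth_fun A (\<lambda>q. \<eta> q (lie_bracket Y Z q))"
    "smooth_fun A (\<lambda>q. \<eta> q (lie_bracket X Z q))"
    by (rule form_smooth[OF \<eta> vf_bracket]; fact)+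
  have j: "\<eta> p (lie_bracket (lie_bracket X Y) Z p) =
    \<eta> p (lie_bracket X (lie_bracket Y Z) p) - \<eta> p (lie_bracket Y (lie_bracket X Z) p)"
    unfolding jacobi[OF X Y Z]
    by (rule covector_diff[OF form_covector[OF \<eta>] bracket_tangent bracket_tangent]) (rule X Y Z vf_bracket | assumption)+
  have D: "V p (\<lambda>q. ext_d \<eta> P Q q) = V p (\<lambda>q. P q (\<lambda>r. \<eta> r (Q r))) - V p (\<lambda>q. Q q (\<lambda>r. \<eta> r (P r)))
      - V p (\<lambda>q. \<eta> q (lie_bracket P Q q))"
    if V: "vector_field A V" and P: "vector_field A P" and Q: "vector_field A Q" for V P Q
    unfolding ext_d_def
    by (simp only: vf_apply(2)[OF V smooth_fun_on_diff[OF open_UNIV vf_smooth[OF P] vf_smooth[OF Q]]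
          form_smooth[OF \<eta> vf_bracket[OF P Q]]] vf_apply(2)[OF V vf_smooth[OF P] vf_smooth[OF Q]])
  show ?thesis
    unfolding D[OF X Y Z] D[OF Y X Z] D[OF Z X Y]
    unfolding ext_d_def j bracket_apply[of X Y] bracket_apply[of X Z] bracket_apply[of Y Z]
    by simp
qed

lemma one_form_add:
  assumes "one_form A \<alpha>" "one_form A \<beta>"
  shows "one_form A (\<lambda>p. \<alpha> p + \<beta> p)"
proof (rule one_formI)
  show "\<alpha> p + \<beta> p \<in> coT p" for p
    by (rule subspace_add[OF subspace_cotangent form_covector[OF assms(1)] form_covector[OF assms(2)]])
  show "smooth_fun A (\<lambda>p. (\<alpha> p + \<beta> p) (X p))" if "vector_field A X" for X
    unfolding plus_fun_apply
    by (rule smooth_fun_on_add[OF open_UNIV form_smooth[OF assms(1) that] form_smooth[OF assms(2) that]])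
qed

lemma one_form_fscale:
  assumes "smooth_fun A f" "one_form A \<alpha>"
  shows "one_form A (\<lambda>p. f p *\<^sub>R \<alpha> p)"
proof (rule one_formI)
  show "f p *\<^sub>R \<alpha> p \<in> coT p" for p
    by (rule subspace_scale[OF subspace_cotangent form_covector[OF assms(2)]])
  show "smooth_fun A (\<lambda>p. (f p *\<^sub>R \<alpha> p) (X p))" if "vector_field A X" for X
    unfolding scaleR_fun_apply real_scaleR_def
    by (rule smooth_fun_on_mult[OF open_UNIV assms(1) form_smooth[OF assms(2) that]])
qed

lemma one_form_diff:
  assumes "one_form A \<alpha>" "one_form A \<beta>"
  shows "one_form A (\<lambda>p. \<alpha> p - \<beta> p)"
  using one_form_add[OF assms(1) one_form_fscale[OF smooth_fun_on_const[OF open_UNIV, of "-1"] assms(2)]]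
  by simp

lemma one_form_contract:
  assumes \<omega>: "two_form A \<omega>" and X: "vector_field A X"
  shows "one_form A (\<lambda>p. \<omega> p (X p))"
proof (rule one_formI)
  show "\<omega> p (X p) \<in> coT p" for p
    by (rule two_formD(1)[OF \<omega> vf_tangent[OF X]])
  show "smooth_fun A (\<lambda>p. \<omega> p (X p) (Y p))" if "vector_field A Y" for Y
    by (rule two_formD(4)[OF \<omega> X that])
qed

lemma d_fun_apply: "v \<in> T p \<Longrightarrow> d_fun A f p v = v f"
  by (simp add: d_fun_def)

lemma one_form_d_fun:
  assumes "smooth_fun A f"
  shows "one_form A (d_fun A f)"
proof (rule one_formI)
  show "d_fun A f p \<in> coT p" for p
    by (rule covectorI) (auto simp: d_fun_def tangent_add tangent_scale)
  show "smooth_fun A (\<lambda>p. d_fun A f p (X p))" if X: "vector_field A X" for X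
    by (simp only: d_fun_apply[OF vf_tangent[OF X]] vf_smooth[OF X])
qed

text \<open>The \<open>1\<close>-form component of the extended Courant bracket.\<close>

definition bracket_form ::
  "('m \<Rightarrow> 'm tvec) \<Rightarrow> ('m \<Rightarrow> real) \<Rightarrow> ('m \<Rightarrow> 'm covec) \<Rightarrow> ('m \<Rightarrow> real) \<Rightarrow>
   ('m \<Rightarrow> 'm tvec) \<Rightarrow> ('m \<Rightarrow> real) \<Rightarrow> ('m \<Rightarrow> 'm covec) \<Rightarrow> ('m \<Rightarrow> real) \<Rightarrow> 'm \<Rightarrow> 'm covec" where
  "bracket_form X1 f1 \<alpha>1 g1 X2 f2 \<alpha>2 g2 = (\<lambda>p.
     d_form A \<alpha>2 p (X1 p) - f1 p *\<^sub>R (d_fun A g2 p - \<alpha>2 p) + d_fun A (\<lambda>q. \<alpha>2 q (X1 q) + f1 q * g2 q) p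
     - (d_form A \<alpha>1 p (X2 p) - f2 p *\<^sub>R (d_fun A g1 p - \<alpha>1 p)))"

text \<open>In the function component, \<open>-\<alpha>\<^sub>2(X\<^sub>1)\<close> from
  \<open>d~(\<alpha>\<^sub>2, g\<^sub>2)\<close> cancels against
  \<open>\<alpha>\<^sub>2(X\<^sub>1)\<close> from \<open>i(\<alpha>\<^sub>2, g\<^sub>2)\<close>.\<close>

lemma courant_bracket_eq:
  assumes X1: "vector_field A X1" and X2: "vector_field A X2"
  shows "courant_bracket A ((X1, f1), (\<alpha>1, g1)) ((X2, f2), (\<alpha>2, g2)) =
    ((lie_bracket X1 X2, \<lambda>p. X1 p f2 - X2 p f1),
     (bracket_form X1 f1 \<alpha>1 g1 X2 f2 \<alpha>2 g2,
      \<lambda>p. X1 p g2 - X2 p g1 + f1 p * g2 p + \<alpha>1 p (X2 p)))"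
  using vf_tangent[OF X1] vf_tangent[OF X2]
  by (simp add: tilde_Lie_def tilde_d_fun_def bracket_form_def fun_eq_iff d_fun_apply)

lemma one_form_bracket_form:
  assumes "vector_field A X1" "vector_field A X2" "smooth_fun A f1" "smooth_fun A f2"
    "smooth_fun A g1" "smooth_fun A g2" "one_form A \<alpha>1" "one_form A \<alpha>2"
  shows "one_form A (bracket_form X1 f1 \<alpha>1 g1 X2 f2 \<alpha>2 g2)"
  unfolding bracket_form_def
  by (intro one_form_add one_form_diff one_form_fscale one_form_d_fun smooth_fun_on_add smooth_fun_on_mult
      open_UNIV assms one_form_contract[OF two_form_d[OF assms(7)] assms(2)]
      one_form_contract[OF two_form_d[OF assms(8)] assms(1)] form_smooth[OF assms(8,1)])

text \<open>The two terms with \<open>Z(g\<^sub>2)\<close>, and the two terms with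
  \<open>Z(\<alpha>\<^sub>2(X\<^sub>1))\<close>, cancel.\<close>

lemma bracket_form_apply:
  assumes X1: "vector_field A X1" and X2: "vector_field A X2" and f1: "smooth_fun A f1"
    and g2: "smooth_fun A g2" and \<alpha>1: "one_form A \<alpha>1" and \<alpha>2: "one_form A \<alpha>2" and Z: "vector_field A Z"
  shows "bracket_form X1 f1 \<alpha>1 g1 X2 f2 \<alpha>2 g2 p (Z p) =
    X1 p (\<lambda>q. \<alpha>2 q (Z q)) - \<alpha>2 p (lie_bracket X1 Z p) + f1 p * \<alpha>2 p (Z p) + Z p f1 * g2 p
    - X2 p (\<lambda>q. \<alpha>1 q (Z q)) + Z p (\<lambda>q. \<alpha>1 q (X2 q)) + \<alpha>1 p (lie_bracket X2 Z p)
    - f2 p * \<alpha>1 p (Z p) + f2 p * Z p g1"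
proof -
  have "Z p (\<lambda>q. \<alpha>2 q (X1 q) + f1 q * g2 q) = Z p (\<lambda>q. \<alpha>2 q (X1 q)) + (Z p f1 * g2 p + f1 p * Z p g2)"
    by (simp only: vf_apply(1)[OF Z form_smooth[OF \<alpha>2 X1] smooth_fun_on_mult[OF open_UNIV f1 g2]]
        vf_apply(5)[OF Z f1 g2])
  then show ?thesis
    by (simp add: bracket_form_def d_fun_apply[OF vf_tangent[OF Z]] d_form_apply[OF \<alpha>1 X2 Z]
        d_form_apply[OF \<alpha>2 X1 Z] ext_d_def algebra_simps)
qed

lemma sections_L_of:
  assumes \<eta>: "one_form A \<eta>"
  shows "sections_of A (L_of A \<eta>) =
    {((X, f), (\<lambda>p. d_form A \<eta> p (X p) + f p *\<^sub>R \<eta> p, \<lambda>p. - \<eta> p (X p))) | X f.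
      vector_field A X \<and> smooth_fun A f}" (is "_ = ?S")
proof (intro set_eqI iffI)
  fix e assume e: "e \<in> sections_of A (L_of A \<eta>)"
  obtain X f \<alpha> g where eq: "e = ((X, f), (\<alpha>, g))" by (metis prod.exhaust)
  have v: "\<alpha> p = d_form A \<eta> p (X p) + f p *\<^sub>R \<eta> p" "g p = - \<eta> p (X p)" for p
    using e by (auto simp: eq sections_of_def L_of_eq[OF \<eta>])
  have "vector_field A X" "smooth_fun A f" using e unfolding eq sections_of_def E1_sections_on_def by blast+
  moreover have "\<alpha> = (\<lambda>p. d_form A \<eta> p (X p) + f p *\<^sub>R \<eta> p)" "g = (\<lambda>p. - \<eta> p (X p))"
    using v by blast+
  ultimately show "e \<in> ?S" unfolding eq by blast
next
  fix e assume "e \<in> ?S"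
  then obtain X f where X: "vector_field A X" and f: "smooth_fun A f"
    and e: "e = ((X, f), (\<lambda>p. d_form A \<eta> p (X p) + f p *\<^sub>R \<eta> p, \<lambda>p. - \<eta> p (X p)))" by blast
  have "one_form A (\<lambda>p. d_form A \<eta> p (X p) + f p *\<^sub>R \<eta> p)"
    by (intro one_form_add one_form_fscale f \<eta> one_form_contract[OF two_form_d[OF \<eta>] X])
  moreover have "smooth_fun A (\<lambda>p. - \<eta> p (X p))"
    by (rule smooth_fun_on_minus[OF open_UNIV form_smooth[OF \<eta> X]])
  ultimately have "e \<in> E1_sections_on A UNIV" unfolding e E1_sections_on_def using X f by blast
  moreover have "value_at e p \<in> L_of A \<eta> p" for p
    unfolding e L_of_eq[OF \<eta>] value_at.simps using vf_tangent[OF X] by blast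
  ultimately show "e \<in> sections_of A (L_of A \<eta>)" unfolding sections_of_def by blast
qed

text \<open>The function component and the terms containing \<open>f\<^sub>1\<close>, \<open>f\<^sub>2\<close>
  without derivatives agree by the formula for \<open>d\<eta>\<close>; what remains of the
  \<open>1\<close>-form component is \<open>d d\<eta> = 0\<close>.\<close>

lemma L_of_involutive:
  assumes \<eta>: "one_form A \<eta>" and e1: "e1 \<in> sections_of A (L_of A \<eta>)" and e2: "e2 \<in> sections_of A (L_of A \<eta>)"
  shows "courant_bracket A e1 e2 \<in> sections_of A (L_of A \<eta>)"
proof -
  obtain X1 f1 where X1: "vector_field A X1" and f1: "smooth_fun A f1"
    and e1: "e1 = ((X1, f1), (\<lambda>p. d_form A \<eta> p (X1 p) + f1 p *\<^sub>R \<eta> p, \<lambda>p. - \<eta> p (X1 p)))"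
    using e1 unfolding sections_L_of[OF \<eta>] by blast
  obtain X2 f2 where X2: "vector_field A X2" and f2: "smooth_fun A f2"
    and e2: "e2 = ((X2, f2), (\<lambda>p. d_form A \<eta> p (X2 p) + f2 p *\<^sub>R \<eta> p, \<lambda>p. - \<eta> p (X2 p)))"
    using e2 unfolding sections_L_of[OF \<eta>] by blast
  define \<alpha> where "\<alpha> X f = (\<lambda>p. d_form A \<eta> p (X p) + f p *\<^sub>R \<eta> p)" for X f
  define g where "g X = (\<lambda>p. - \<eta> p (X p))" for X
  note B = vf_bracket[OF X1 X2]
  have \<alpha>: "one_form A (\<alpha> X f)" if "vector_field A X" "smooth_fun A f" for X f
    unfolding \<alpha>_def by (intro one_form_add one_form_fscale that \<eta> one_form_contract[OF two_form_d[OF \<eta>]])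
  have g: "smooth_fun A (g X)" if "vector_field A X" for X
    unfolding g_def by (rule smooth_fun_on_minus[OF open_UNIV form_smooth[OF \<eta> that]])
  have \<alpha>_apply: "\<alpha> X f p (Y p) = ext_d \<eta> X Y p + f p * \<eta> p (Y p)"
    if "vector_field A X" "vector_field A Y" for X Y f p
    by (simp add: \<alpha>_def d_form_apply[OF \<eta> that])
  have V_g: "V p (g X) = - V p (\<lambda>q. \<eta> q (X q))" if "vector_field A V" "vector_field A X" for V X p
    unfolding g_def by (rule vf_apply(3)[OF that(1) form_smooth[OF \<eta> that(2)]])
  have V_\<alpha>: "V p (\<lambda>q. \<alpha> X f q (Y q)) = V p (\<lambda>q. ext_d \<eta> X Y q) + (V p f * \<eta> p (Y p) + f p * V p (\<lambda>q. \<eta> q (Y q)))"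
    if V: "vector_field A V" and X: "vector_field A X" and Y: "vector_field A Y" and f: "smooth_fun A f" for V X Y f p
  proof -
    have "V p (\<lambda>q. \<alpha> X f q (Y q)) = V p (\<lambda>q. ext_d \<eta> X Y q + f q * \<eta> q (Y q))"
      by (simp only: \<alpha>_apply[OF X Y])
    then show ?thesis
      by (simp only: vf_apply(1)[OF V ext_d_smooth[OF \<eta> X Y] smooth_fun_on_mult[OF open_UNIV f form_smooth[OF \<eta> Y]]]
          vf_apply(5)[OF V f form_smooth[OF \<eta> Y]])
  qed
  let ?h = "\<lambda>p. X1 p f2 - X2 p f1"
  have h: "smooth_fun A ?h" by (rule smooth_fun_on_diff[OF open_UNIV vf_smooth[OF X1] vf_smooth[OF X2]])
  have form: "bracket_form X1 f1 (\<alpha> X1 f1) (g X1) X2 f2 (\<alpha> X2 f2) (g X2) = \<alpha> (lie_bracket X1 X2) ?h"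
  proof
    fix p
    show "bracket_form X1 f1 (\<alpha> X1 f1) (g X1) X2 f2 (\<alpha> X2 f2) (g X2) p = \<alpha> (lie_bracket X1 X2) ?h p"
    proof (rule covector_eqI)
      show "bracket_form X1 f1 (\<alpha> X1 f1) (g X1) X2 f2 (\<alpha> X2 f2) (g X2) p \<in> coT p"
        by (rule form_covector[OF one_form_bracket_form[OF X1 X2 f1 f2 g[OF X1] g[OF X2] \<alpha>[OF X1 f1] \<alpha>[OF X2 f2]]])
      show "\<alpha> (lie_bracket X1 X2) ?h p \<in> coT p" by (rule form_covector[OF \<alpha>[OF B h]])
      fix v assume "v \<in> T p"
      then obtain Z where Z: "vector_field A Z" "Z p = v" by (rule vf_extend)
      note b1 = vf_bracket[OF X1 Z(1)] and b2 = vf_bracket[OF X2 Z(1)]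
      have 1: "bracket_form X1 f1 (\<alpha> X1 f1) (g X1) X2 f2 (\<alpha> X2 f2) (g X2) p (Z p) = \<alpha> (lie_bracket X1 X2) ?h p (Z p)"
        unfolding bracket_form_apply[OF X1 X2 f1 g[OF X2] \<alpha>[OF X1 f1] \<alpha>[OF X2 f2] Z(1)]
          V_\<alpha>[OF X1 X2 Z(1) f2] V_\<alpha>[OF X2 X1 Z(1) f1] V_\<alpha>[OF Z(1) X1 X2 f1] V_g[OF Z(1) X1]
        unfolding \<alpha>_apply[OF X1 b2] \<alpha>_apply[OF X2 b1] \<alpha>_apply[OF X1 Z(1)] \<alpha>_apply[OF X2 Z(1)] \<alpha>_apply[OF B Z(1)]
          ext_d_closed[OF \<eta> X1 X2 Z(1)]
        by (simp add: g_def ext_d_def[of \<eta> X1 Z p] ext_d_def[of \<eta> X2 Z p] algebra_simps)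
      show "bracket_form X1 f1 (\<alpha> X1 f1) (g X1) X2 f2 (\<alpha> X2 f2) (g X2) p v = \<alpha> (lie_bracket X1 X2) ?h p v"
        using 1 unfolding Z(2) .
    qed
  qed
  have fn: "(\<lambda>p. X1 p (g X2) - X2 p (g X1) + f1 p * g X2 p + \<alpha> X1 f1 p (X2 p)) = g (lie_bracket X1 X2)"
    unfolding V_g[OF X1 X2] V_g[OF X2 X1] \<alpha>_apply[OF X1 X2] by (simp add: g_def ext_d_def)
  have "courant_bracket A e1 e2 = ((lie_bracket X1 X2, ?h), (\<alpha> (lie_bracket X1 X2) ?h, g (lie_bracket X1 X2)))"
    unfolding e1 e2 \<alpha>_def[symmetric] g_def[symmetric] courant_bracket_eq[OF X1 X2] form fn ..
  then show ?thesis unfolding sections_L_of[OF \<eta>] using B h unfolding \<alpha>_def g_def by blast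
qed

section \<open>The Dirac structure of a 1-form\<close>

lemma pairing_sym: "E1_pairing u w = E1_pairing w u"
  by (cases u; cases w) (auto simp: algebra_simps)

lemma pairing_add_scale:
  assumes "u \<in> E1_fibre A p" "v \<in> E1_fibre A p" "w \<in> E1_fibre A p"
  shows "E1_pairing (u + c *\<^sub>R v) w = E1_pairing u w + c * E1_pairing v w"
proof -
  obtain u1 u2 \<mu> u4 v1 v2 \<nu> v4 w1 w2 \<zeta> w4 where e:
    "u = ((u1, u2), (\<mu>, u4))" "v = ((v1, v2), (\<nu>, v4))" "w = ((w1, w2), (\<zeta>, w4))"
    by (metis prod.exhaust)
  have t: "u1 \<in> T p" "v1 \<in> T p" "\<zeta> \<in> coT p"
    using assms by (auto simp: e E1_fibre_def)
  show ?thesis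
    by (simp add: e covectorD(1)[OF t(3) t(1) tangent_scale[OF t(2)]] covectorD(2)[OF t(3) t(2)] algebra_simps)
qed

lemma subspace_fibre: "subspace (E1_fibre A p)"
  unfolding E1_fibre_def
  by (intro subspace_Times subspace_tangent subspace_cotangent subspace_UNIV)

lemma L_ofI:
  assumes "one_form A \<eta>" "v \<in> T p"
  shows "graph_elem \<eta> p v a \<in> L_of A \<eta> p"
  unfolding L_of_eq[OF assms(1)] using assms(2)
  by (intro CollectI exI[of _ v] exI[of _ a] conjI refl)

lemma L_ofE:
  assumes "one_form A \<eta>" "z \<in> L_of A \<eta> p"
  obtains v a where "v \<in> T p" "z = graph_elem \<eta> p v a"
  using assms(2) unfolding L_of_eq[OF assms(1)] by (elim CollectE exE conjE) (rule that)

lemma L_of_subspace: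
  assumes \<eta>: "one_form A \<eta>"
  shows "subspace (L_of A \<eta> p)"
  unfolding subspace_def
proof (intro conjI ballI allI)
  note d = two_form_d[OF \<eta>]
  note cov = form_covector[OF \<eta>]
  have dadd: "d_form A \<eta> p (v + w) = d_form A \<eta> p v + d_form A \<eta> p w"
    if vw: "v \<in> T p" "w \<in> T p" for v w
  proof (rule covector_eqI[OF two_formD(1)[OF d tangent_add[OF vw]]
        subspace_add[OF subspace_cotangent two_formD(1)[OF d vw(1)] two_formD(1)[OF d vw(2)]]])
    fix u assume "u \<in> T p"
    from covectorD(1)[OF two_formD(2)[OF d this] vw]
    show "d_form A \<eta> p (v + w) u = (d_form A \<eta> p v + d_form A \<eta> p w) u" by simp
  qed
  have dscale: "d_form A \<eta> p (c *\<^sub>R v) = c *\<^sub>R d_form A \<eta> p v" if v: "v \<in> T p" for c v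
  proof (rule covector_eqI[OF two_formD(1)[OF d tangent_scale[OF v]]
        subspace_scale[OF subspace_cotangent two_formD(1)[OF d v]]])
    fix u assume "u \<in> T p"
    from covectorD(2)[OF two_formD(2)[OF d this] v]
    show "d_form A \<eta> p (c *\<^sub>R v) u = (c *\<^sub>R d_form A \<eta> p v) u" by simp
  qed
  show scale: "c *\<^sub>R z \<in> L_of A \<eta> p" if zL: "z \<in> L_of A \<eta> p" for c z
  proof -
    obtain v a where v: "v \<in> T p" and z: "z = graph_elem \<eta> p v a"
      using zL by (rule L_ofE[OF \<eta>])
    have "c *\<^sub>R z = ((c *\<^sub>R v, c * a), (d_form A \<eta> p (c *\<^sub>R v) + (c * a) *\<^sub>R \<eta> p, - \<eta> p (c *\<^sub>R v)))"
      by (simp add: z dscale[OF v] covectorD(2)[OF cov v] scaleR_add_right)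
    then show ?thesis by (simp only: L_ofI[OF \<eta> tangent_scale[OF v]])
  qed
  show "y + z \<in> L_of A \<eta> p" if yz: "y \<in> L_of A \<eta> p" "z \<in> L_of A \<eta> p" for y z
  proof -
    obtain v a where v: "v \<in> T p" and y: "y = graph_elem \<eta> p v a"
      using yz(1) by (rule L_ofE[OF \<eta>])
    obtain w b where w: "w \<in> T p" and z: "z = graph_elem \<eta> p w b"
      using yz(2) by (rule L_ofE[OF \<eta>])
    have "y + z = ((v + w, a + b), (d_form A \<eta> p (v + w) + (a + b) *\<^sub>R \<eta> p, - \<eta> p (v + w)))"
      by (simp add: y z dadd[OF v w] covectorD(1)[OF cov v w] scaleR_add_left algebra_simps)
    then show ?thesis by (simp only: L_ofI[OF \<eta> tangent_add[OF v w]])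
  qed
  have "((0, 0), (d_form A \<eta> p 0 + 0 *\<^sub>R \<eta> p, - \<eta> p 0)) \<in> L_of A \<eta> p"
    by (rule L_ofI[OF \<eta> tangent_0])
  from scale[OF this, of 0] show "0 \<in> L_of A \<eta> p" by (simp add: zero_prod_def)
qed

lemma L_of_isotropic:
  assumes \<eta>: "one_form A \<eta>"
  shows "isotropic A p (L_of A \<eta> p)"
  unfolding isotropic_def
proof (intro conjI ballI)
  note d = two_form_d[OF \<eta>]
  note cov = form_covector[OF \<eta>]
  show "subspace (L_of A \<eta> p)" by (rule L_of_subspace[OF \<eta>])
  show "L_of A \<eta> p \<subseteq> E1_fibre A p"
  proof
    fix z assume "z \<in> L_of A \<eta> p"
    then obtain v a where v: "v \<in> T p" and z: "z = graph_elem \<eta> p v a"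
      by (rule L_ofE[OF \<eta>])
    show "z \<in> E1_fibre A p"
      unfolding z E1_fibre_def
      using v subspace_add[OF subspace_cotangent two_formD(1)[OF d v] subspace_scale[OF subspace_cotangent cov]]
      by (intro SigmaI UNIV_I)
  qed
  fix y z assume yz: "y \<in> L_of A \<eta> p" "z \<in> L_of A \<eta> p"
  obtain v a where v: "v \<in> T p" and y: "y = graph_elem \<eta> p v a"
    using yz(1) by (rule L_ofE[OF \<eta>])
  obtain w b where w: "w \<in> T p" and z: "z = graph_elem \<eta> p w b"
    using yz(2) by (rule L_ofE[OF \<eta>])
  show "E1_pairing y z = 0"
    using two_form_skew[OF d v w] by (simp add: y z)
qed

text \<open>Subtracting from an element of \<open>V\<close> the element of the graph with the same vector part
  leaves a covector, which must pair to zero with the whole tangent part.\<close>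

lemma L_of_maximal:
  assumes \<eta>: "one_form A \<eta>" and V: "isotropic A p V" "L_of A \<eta> p \<subseteq> V"
  shows "V = L_of A \<eta> p"
proof
  have sub: "subspace V" and fib: "V \<subseteq> E1_fibre A p" and iso: "\<And>u v. u \<in> V \<Longrightarrow> v \<in> V \<Longrightarrow> E1_pairing u v = 0"
    using V(1) unfolding isotropic_def by blast+
  show "V \<subseteq> L_of A \<eta> p"
  proof
    fix z assume z: "z \<in> V"
    obtain v a \<xi> b where e: "z = ((v, a), (\<xi>, b))" by (metis prod.exhaust)
    have v: "v \<in> T p" using z fib by (auto simp: e E1_fibre_def)
    define y where "y = graph_elem \<eta> p v a"
    have y: "y \<in> L_of A \<eta> p" unfolding y_def by (rule L_ofI[OF \<eta> v])
    have "z - y \<in> V" using subspace_diff[OF sub z] y V(2) by blast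
    moreover define \<zeta> where "\<zeta> = \<xi> - (d_form A \<eta> p v + a *\<^sub>R \<eta> p)"
    moreover define c where "c = b - - \<eta> p v"
    ultimately have zy: "((0, 0), (\<zeta>, c)) \<in> V" by (simp add: e y_def zero_prod_def[symmetric])
    have \<zeta>: "\<zeta> \<in> coT p" using zy fib by (auto simp: E1_fibre_def)
    have *: "\<zeta> w + k * c = 0" if w: "w \<in> T p" for w k
    proof -
      have cov: "d_form A \<eta> p w + k *\<^sub>R \<eta> p \<in> coT p"
        by (intro subspace_add[OF subspace_cotangent] subspace_scale[OF subspace_cotangent]
            two_formD(1)[OF two_form_d[OF \<eta>] w] form_covector[OF \<eta>])
      have "graph_elem \<eta> p w k \<in> L_of A \<eta> p"
        by (rule L_ofI[OF \<eta> w])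
      then have "E1_pairing ((0, 0), (\<zeta>, c)) (graph_elem \<eta> p w k) = 0"
        using iso[OF zy] V(2) by blast
      then show ?thesis using covector_0[OF cov] unfolding E1_pairing.simps by simp
    qed
    have "c = 0" using *[OF tangent_0, of 1] covector_0[OF \<zeta>] by simp
    moreover have "\<zeta> = 0"
      by (rule covector_eqI[OF \<zeta> subspace_0[OF subspace_cotangent]]) (use *[of _ 0] in simp)
    ultimately have "z = y" by (simp add: e y_def \<zeta>_def c_def)
    then show "z \<in> L_of A \<eta> p" using y by simp
  qed
qed (rule V(2))

text \<open>The frame is the graph over a coordinate frame of \<open>TM\<close>, completed by the section
  \<open>(0, 1)\<close>, which gets the last index.\<close>

lemma L_of_subbundle:
  assumes \<eta>: "one_form A \<eta>"
  shows "subbundle A (L_of A \<eta>)"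
  unfolding subbundle_def
proof (intro exI[of _ "Suc (DIM('e))"] allI)
  fix p
  let ?N = "DIM('e)"
  note d = two_form_d[OF \<eta>]
  obtain W x E where "coordinate_frame W x E" and p: "p \<in> W" by (rule local_frame[of p])
  note F = coordinate_frameD(1)[OF this(1)] p coordinate_frameD(2-)[OF this(1)]
  obtain \<beta> :: "nat \<Rightarrow> 'e" where "bij_betw \<beta> {0..<?N} Basis"
    using ex_bij_betw_nat_finite[OF finite_Basis] by blast
  then have \<beta>: "bij_betw \<beta> {..<?N} Basis" by (simp add: atLeast0LessThan)
  have \<beta>i: "\<beta> i \<in> Basis" if "i < ?N" for i using bij_betwE[OF \<beta>] that by blast
  have \<beta>eq: "\<beta> i = \<beta> j \<longleftrightarrow> i = j" if "i < ?N" "j < ?N" for i j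
    using bij_betw_imp_inj_on[OF \<beta>] that by (auto dest: inj_onD)
  define X where "X i = (if i < ?N then E (\<beta> i) else (\<lambda>q. 0))" for i
  define f where "f i = (\<lambda>q::'m. if i < ?N then 0 else 1 :: real)" for i
  define s where "s i = ((X i, f i), (\<lambda>q. d_form A \<eta> q (X i q) + f i q *\<^sub>R \<eta> q, \<lambda>q. - \<eta> q (X i q)))" for i
  have X: "vector_field A (X i)" for i
    unfolding X_def using F(4) vf_zero by (cases "i < ?N") simp_all
  have f: "smooth_fun A (f i)" for i unfolding f_def by (rule smooth_fun_on_const[OF open_UNIV])
  have s: "s i \<in> sections_of A (L_of A \<eta>)" for i
    unfolding s_def sections_L_of[OF \<eta>]
    by (intro CollectI exI[of _ "X i"] exI[of _ "f i"] conjI refl X f)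
  then have sL: "value_at (s i) q \<in> L_of A \<eta> q" for i q unfolding sections_of_def by blast
  have "s i \<in> E1_sections_on A W" for i
  proof -
    have "vector_field_on A W (X i)"
      using X[of i] smooth_fun_on_subset[OF _ subset_UNIV, of _ W] by (auto simp: vector_field_on_def)
    moreover have "one_form_on A W (\<lambda>q. d_form A \<eta> q (X i q) + f i q *\<^sub>R \<eta> q)"
      using one_form_add[OF one_form_contract[OF d X] one_form_fscale[OF f \<eta>], of i i]
        smooth_fun_on_subset[OF _ subset_UNIV, of _ W] by (auto simp: one_form_on_def)
    moreover have "smooth_fun_on A W (f i)" by (rule smooth_fun_on_subset[OF f subset_UNIV])
    moreover have "smooth_fun_on A W (\<lambda>q. - \<eta> q (X i q))"
      by (rule smooth_fun_on_subset[OF smooth_fun_on_minus[OF open_UNIV form_smooth[OF \<eta> X]] subset_UNIV])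
    ultimately show ?thesis
      unfolding s_def E1_sections_on_def by (intro CollectI exI conjI) (rule refl)
  qed
  moreover have fstsum: "fst (\<Sum>i<Suc ?N. c i *\<^sub>R value_at (s i) q) = (\<Sum>i<?N. c i *\<^sub>R E (\<beta> i) q, c ?N)" for c q
  proof -
    have "fst (\<Sum>i<Suc ?N. c i *\<^sub>R value_at (s i) q) = (\<Sum>i<Suc ?N. c i *\<^sub>R (X i q, f i q))"
      by (simp only: fst_sum fst_scaleR s_def value_at.simps fst_conv)
    also have "\<dots> = (\<Sum>i<?N. c i *\<^sub>R (E (\<beta> i) q, 0)) + c ?N *\<^sub>R (0, 1)"
      by (simp add: X_def f_def)
    also have "\<dots> = (\<Sum>i<?N. c i *\<^sub>R E (\<beta> i) q, c ?N)"
      by (rule prod_eqI) (simp_all add: fst_sum snd_sum)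
    finally show ?thesis .
  qed
  have comp: "(\<Sum>i<?N. c i *\<^sub>R E (\<beta> i) q) (x (\<beta> k)) = c k" if q: "q \<in> W" and k: "k < ?N" for c q k
  proof -
    have "c i * E (\<beta> i) q (x (\<beta> k)) = (if i = k then c k else 0)" if "i < ?N" for i
      using F(5)[OF q \<beta>i[OF that] \<beta>i[OF k]] \<beta>eq[OF that k] by simp
    then have "(\<Sum>i<?N. c i *\<^sub>R E (\<beta> i) q) (x (\<beta> k)) = (\<Sum>i<?N. if i = k then c k else 0)"
      by (simp add: sum_fun_apply)
    then show ?thesis using k by simp
  qed
  have "inj_on (\<lambda>i. value_at (s i) q) {..<Suc ?N} \<and> independent ((\<lambda>i. value_at (s i) q) ` {..<Suc ?N})"
    if q: "q \<in> W" for q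
    unfolding independent_family[OF finite_lessThan]
  proof (intro allI impI ballI)
    fix c k assume "(\<Sum>i<Suc ?N. c i *\<^sub>R value_at (s i) q) = 0" and k: "k \<in> {..<Suc ?N}"
    then have "(\<Sum>i<?N. c i *\<^sub>R E (\<beta> i) q) = 0" "c ?N = 0"
      using fstsum[of c q] by (simp_all add: zero_prod_def del: sum.lessThan_Suc)
    then show "c k = 0" using comp[OF q, of k c] k by (cases "k = ?N") auto
  qed
  moreover have "L_of A \<eta> q = span ((\<lambda>i. value_at (s i) q) ` {..<Suc ?N})" if q: "q \<in> W" for q
  proof
    show "span ((\<lambda>i. value_at (s i) q) ` {..<Suc ?N}) \<subseteq> L_of A \<eta> q"
      by (rule span_minimal[OF _ L_of_subspace[OF \<eta>]]) (use sL in blast)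
    show "L_of A \<eta> q \<subseteq> span ((\<lambda>i. value_at (s i) q) ` {..<Suc ?N})"
    proof
      fix z assume "z \<in> L_of A \<eta> q"
      then obtain v a where v: "v \<in> T q" and z: "z = graph_elem \<eta> q v a"
        by (rule L_ofE[OF \<eta>])
      define c where "c i = (if i < ?N then v (x (\<beta> i)) else a)" for i
      let ?y = "\<Sum>i<Suc ?N. c i *\<^sub>R value_at (s i) q"
      have "v = (\<Sum>b\<in>Basis. v (x b) *\<^sub>R E b q)" by (rule F(6)[OF q v])
      also have "\<dots> = (\<Sum>i<?N. c i *\<^sub>R E (\<beta> i) q)"
        by (subst sum.reindex_bij_betw[OF \<beta>, symmetric]) (simp add: c_def)
      finally have fy: "fst ?y = (v, a)" unfolding fstsum by (simp add: c_def)
      have "?y \<in> L_of A \<eta> q"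
        by (intro subspace_sum[OF L_of_subspace[OF \<eta>]] subspace_scale[OF L_of_subspace[OF \<eta>]] sL)
      then obtain w b where "?y = graph_elem \<eta> q w b"
        by (rule L_ofE[OF \<eta>])
      then have "z = ?y" using fy z by simp
      then show "z \<in> span ((\<lambda>i. value_at (s i) q) ` {..<Suc ?N})"
        unfolding span_family[OF finite_lessThan] by blast
    qed
  qed
  ultimately show "\<exists>W s. open W \<and> p \<in> W \<and> (\<forall>i<Suc ?N. s i \<in> E1_sections_on A W) \<and>
     (\<forall>y\<in>W. inj_on (\<lambda>i. value_at (s i) y) {..<Suc ?N} \<and>
             independent ((\<lambda>i. value_at (s i) y) ` {..<Suc ?N}) \<and>
             L_of A \<eta> y = span ((\<lambda>i. value_at (s i) y) ` {..<Suc ?N}))"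
    using F(1,2) by (intro exI[of _ W] exI[of _ s]) blast
qed

lemma L_of_dirac:
  assumes \<eta>: "one_form A \<eta>"
  shows "dirac_structure A (L_of A \<eta>)"
  unfolding dirac_structure_def maximally_isotropic_def
  using L_of_subbundle[OF \<eta>] L_of_isotropic[OF \<eta>] L_of_maximal[OF \<eta>] L_of_involutive[OF \<eta>] by blast

lemma L_of_transverse:
  assumes \<eta>: "one_form A \<eta>"
  shows "L_of A \<eta> p \<inter> ({0} \<times> (coT p \<times> UNIV)) = {0}"
    and "L_of A \<eta> p \<inter> ((T p \<times> UNIV) \<times> {0}) = {0} \<longleftrightarrow> nondeg \<eta> p"
proof -
  have 0: "0 \<in> L_of A \<eta> p" by (rule subspace_0[OF L_of_subspace[OF \<eta>]])
  have z: "z = 0" if zL: "z \<in> L_of A \<eta> p" and z0: "fst z = 0" for z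
  proof -
    obtain v a where zz: "z = graph_elem \<eta> p v a"
      using zL by (rule L_ofE[OF \<eta>])
    have "0 *\<^sub>R z = z"
    proof -
      have "0 *\<^sub>R z \<in> L_of A \<eta> p" by (rule subspace_scale[OF L_of_subspace[OF \<eta>] zL])
      then obtain w b where "0 *\<^sub>R z = graph_elem \<eta> p w b"
        by (rule L_ofE[OF \<eta>])
      moreover have "fst (0 *\<^sub>R z) = fst z" using z0 by simp
      ultimately show ?thesis by (auto simp: zz)
    qed
    then show ?thesis by simp
  qed
  have c0: "0 \<in> coT p" by (rule subspace_0[OF subspace_cotangent])
  show "L_of A \<eta> p \<inter> ({0} \<times> (coT p \<times> UNIV)) = {0}"
  proof
    show "L_of A \<eta> p \<inter> ({0} \<times> (coT p \<times> UNIV)) \<subseteq> {0}" using z by auto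
    show "{0} \<subseteq> L_of A \<eta> p \<inter> ({0} \<times> (coT p \<times> UNIV))" using 0 c0 by (simp add: zero_prod_def)
  qed
  show "L_of A \<eta> p \<inter> ((T p \<times> UNIV) \<times> {0}) = {0} \<longleftrightarrow> nondeg \<eta> p"
  proof
    assume L: "L_of A \<eta> p \<inter> ((T p \<times> UNIV) \<times> {0}) = {0}"
    show "nondeg \<eta> p"
      unfolding nondeg_def
    proof (intro ballI allI impI)
      fix v a assume v: "v \<in> T p" and *: "d_form A \<eta> p v + a *\<^sub>R \<eta> p = 0 \<and> \<eta> p v = 0"
      have "graph_elem \<eta> p v a \<in> L_of A \<eta> p"
        by (rule L_ofI[OF \<eta> v])
      then have "((v, a), (0, 0)) \<in> L_of A \<eta> p" using * by (simp only: minus_zero)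
      then have "((v, a), (0, 0)) \<in> L_of A \<eta> p \<inter> ((T p \<times> UNIV) \<times> {0})"
        using v by (simp add: zero_prod_def)
      then show "v = 0 \<and> a = 0" unfolding L by (simp add: zero_prod_def)
    qed
  next
    assume nd: "nondeg \<eta> p"
    show "L_of A \<eta> p \<inter> ((T p \<times> UNIV) \<times> {0}) = {0}"
    proof
      show "{0} \<subseteq> L_of A \<eta> p \<inter> ((T p \<times> UNIV) \<times> {0})"
        using 0 tangent_0[of p] by (simp add: zero_prod_def)
      show "L_of A \<eta> p \<inter> ((T p \<times> UNIV) \<times> {0}) \<subseteq> {0}"
      proof
        fix y assume y: "y \<in> L_of A \<eta> p \<inter> ((T p \<times> UNIV) \<times> {0})"
        obtain v a where v: "v \<in> T p" and yy: "y = graph_elem \<eta> p v a"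
          using IntD1[OF y] by (rule L_ofE[OF \<eta>])
        have "d_form A \<eta> p v + a *\<^sub>R \<eta> p = 0" "\<eta> p v = 0" using y by (auto simp: yy zero_prod_def)
        then have "v = 0 \<and> a = 0" using nd v unfolding nondeg_def by blast
        then have "fst y = 0" by (simp add: yy zero_prod_def)
        then show "y \<in> {0}" using z y by blast
      qed
    qed
  qed
qed

lemma L_of_inj:
  assumes \<eta>: "one_form A \<eta>" "one_form A \<eta>'" and eq: "L_of A \<eta> = L_of A \<eta>'"
  shows "\<eta> = \<eta>'"
proof
  fix p
  show "\<eta> p = \<eta>' p"
  proof (rule covector_eqI[OF form_covector[OF \<eta>(1)] form_covector[OF \<eta>(2)]])
    fix v assume v: "v \<in> T p"
    have "((v, 0), (d_form A \<eta> p v + 0 *\<^sub>R \<eta> p, - \<eta> p v)) \<in> L_of A \<eta> p"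
      by (rule L_ofI[OF \<eta>(1) v])
    then show "\<eta> p v = \<eta>' p v" unfolding eq L_of_eq[OF \<eta>(2)] by auto
  qed
qed

section \<open>Smooth dependence of the solution of a linear system\<close>

lemma smooth_nonzero_nbhd:
  assumes "open W" "p \<in> W" "smooth_fun_on A W f" "f p \<noteq> 0"
  obtains V where "open V" "p \<in> V" "V \<subseteq> W" "\<And>q. q \<in> V \<Longrightarrow> f q \<noteq> 0"
proof -
  obtain U \<phi> where U: "(U, \<phi>) \<in> A" "p \<in> U" by (rule chart_cover)
  let ?g = "f \<circ> inv_into U \<phi>"
  have "continuous_on (\<phi> ` (U \<inter> W)) ?g"
    by (rule smooth_on_continuous[OF smooth_fun_onD[OF assms(3) U(1)]])
  then have "open (\<phi> ` (U \<inter> W) \<inter> ?g -` (- {0}))"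
    by (rule continuous_open_preimage[OF _ open_chart_image[OF U(1) assms(1)]])
      (intro open_Compl closed_singleton)
  from open_chart_preimage[OF U(1) this]
  have "open (U \<inter> \<phi> -` (\<phi> ` (U \<inter> W) \<inter> ?g -` (- {0})))" .
  moreover have "q \<in> W" if qU: "q \<in> U" and qW: "\<phi> q \<in> \<phi> ` (U \<inter> W)" for q
  proof -
    obtain q' where q': "q' \<in> U" "q' \<in> W" "\<phi> q = \<phi> q'" using qW by auto
    have "q = inv_into U \<phi> (\<phi> q)" by (rule chart_inv[OF U(1) qU, symmetric])
    also have "\<dots> = q'" unfolding q'(3) by (rule chart_inv[OF U(1) q'(1)])
    finally show ?thesis using q'(2) by (simp only:)
  qed
  moreover have "f q \<noteq> 0" if "q \<in> U" "?g (\<phi> q) \<noteq> 0" for q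
    using that chart_inv[OF U(1)] by simp
  ultimately show thesis
    by (intro that[of "U \<inter> \<phi> -` (\<phi> ` (U \<inter> W) \<inter> ?g -` (- {0}))"])
      (use U(2) chart_inv[OF U] assms(2,4) in auto)
qed

text \<open>Gaussian elimination in the ring of functions that are smooth near \<open>p\<close>: a row that is
  nonzero at \<open>p\<close> has an entry that is invertible near \<open>p\<close>, and it serves
  as pivot.\<close>

lemma smooth_solution:
  fixes m :: "nat \<Rightarrow> 'j \<Rightarrow> 'm \<Rightarrow> real"
  assumes "open W" "p \<in> W" "\<And>i j. i < r \<Longrightarrow> smooth_fun_on A W (m i j)" "\<And>j. smooth_fun_on A W (u j)"
    and "\<And>q j. q \<in> W \<Longrightarrow> u j q = (\<Sum>i<r. c i q * m i j q)"
    and "\<And>d. (\<And>j. (\<Sum>i<r. d i * m i j p) = 0) \<Longrightarrow> \<forall>i<r. d i = 0"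
  shows "\<exists>V. open V \<and> p \<in> V \<and> V \<subseteq> W \<and> (\<forall>i<r. smooth_fun_on A V (c i))"
  using assms
proof (induction r arbitrary: W m u)
  case 0
  then show ?case by blast
next
  case (Suc r)
  have "\<exists>j. m r j p \<noteq> 0"
  proof (rule ccontr)
    assume "\<not> ?thesis"
    then have z: "m r j p = 0" for j by blast
    have "(\<Sum>i<Suc r. (if i = r then 1 else 0) * m i j p) = 0" for j
    proof (rule sum.neutral, rule ballI)
      show "(if i = r then 1 else 0) * m i j p = 0" for i using z by simp
    qed
    then have "\<forall>i<Suc r. (if i = r then 1 else 0) = (0::real)"
      by (rule Suc.prems(6))
    then show False by auto
  qed
  then obtain k where k: "m r k p \<noteq> 0" by blast
  obtain V0 where V0: "open V0" "p \<in> V0" "V0 \<subseteq> W" "\<And>q. q \<in> V0 \<Longrightarrow> m r k q \<noteq> 0"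
    using smooth_nonzero_nbhd[OF Suc.prems(1,2) Suc.prems(3)[of r k] k] by blast
  define t where "t q = inverse (m r k q)" for q
  have m: "smooth_fun_on A V0 (m i j)" if "i < Suc r" for i j
    by (rule smooth_fun_on_subset[OF Suc.prems(3)[OF that] V0(3)])
  have u: "smooth_fun_on A V0 (u j)" for j by (rule smooth_fun_on_subset[OF Suc.prems(4) V0(3)])
  have t: "smooth_fun_on A V0 t" unfolding t_def
    by (rule smooth_fun_on_inverse[OF V0(1,4) m]) simp_all
  have mt: "m r k q * t q = 1" if "q \<in> V0" for q using V0(4)[OF that] by (simp add: t_def)
  \<comment> \<open>Row \<open>r\<close> is the pivot row, \<open>k\<close> the pivot column; the pivot row
    itself reduces to \<open>0\<close>.\<close>
  define m' where "m' i j = (\<lambda>q. m i j q - m i k q * t q * m r j q)" for i j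
  define u' where "u' j = (\<lambda>q. u j q - u k q * t q * m r j q)" for j
  have "\<exists>V. open V \<and> p \<in> V \<and> V \<subseteq> V0 \<and> (\<forall>i<r. smooth_fun_on A V (c i))"
  proof (rule Suc.IH[OF V0(1,2), of m' u'])
    show "smooth_fun_on A V0 (m' i j)" if "i < r" for i j
      unfolding m'_def by (intro smooth_fun_on_diff smooth_fun_on_mult V0(1) m t) (use that in auto)
    show "smooth_fun_on A V0 (u' j)" for j
      unfolding u'_def by (intro smooth_fun_on_diff smooth_fun_on_mult V0(1) m t u) auto
    show "u' j q = (\<Sum>i<r. c i q * m' i j q)" if q: "q \<in> V0" for q j
    proof -
      have qW: "q \<in> W" using q V0(3) by blast
      have r0: "c r q * m r k q * t q * m r j q = c r q * m r j q"
        using mt[OF q] by (simp add: mult.assoc)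
      have "u' j q = (\<Sum>i<Suc r. c i q * m i j q) - (\<Sum>i<Suc r. c i q * m i k q) * t q * m r j q"
        by (simp only: u'_def Suc.prems(5)[OF qW])
      also have "\<dots> = (\<Sum>i<r. c i q * m i j q) - (\<Sum>i<r. c i q * m i k q) * t q * m r j q"
        using r0 by (simp add: algebra_simps)
      also have "\<dots> = (\<Sum>i<r. c i q * m' i j q)"
        by (simp add: m'_def right_diff_distrib sum_subtractf sum_distrib_right mult.assoc)
      finally show ?thesis .
    qed
    show "\<forall>i<r. d i = 0" if d: "\<And>j. (\<Sum>i<r. d i * m' i j p) = 0" for d
    proof -
      \<comment> \<open>A relation between the reduced rows extends to one between the original rows.\<close>
      define d' where "d' i = (if i < r then d i else - (\<Sum>i<r. d i * m i k p) * t p)" for i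
      have "(\<Sum>i<Suc r. d' i * m i j p) = (\<Sum>i<r. d i * m' i j p)" for j
        by (simp add: d'_def m'_def right_diff_distrib sum_subtractf sum_distrib_right mult.assoc)
      then have "\<forall>i<Suc r. d' i = 0" using d by (intro Suc.prems(6)) simp
      then show ?thesis by (metis d'_def less_SucI)
    qed
  qed
  then obtain V where V: "open V" "p \<in> V" "V \<subseteq> V0" "\<And>i. i < r \<Longrightarrow> smooth_fun_on A V (c i)" by blast
  have "smooth_fun_on A V (\<lambda>q. t q * (u k q - (\<Sum>i<r. c i q * m i k q)))"
    by (intro smooth_fun_on_mult smooth_fun_on_diff smooth_fun_on_sum V(1)
        smooth_fun_on_subset[OF t V(3)] smooth_fun_on_subset[OF u V(3)] smooth_fun_on_subset[OF m V(3)] V(4)) auto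
  then have "smooth_fun_on A V (c r)"
  proof (rule smooth_fun_on_cong[OF V(1), rotated])
    fix q assume "q \<in> V"
    then have q: "q \<in> V0" "q \<in> W" using V(3) V0(3) by auto
    have "u k q - (\<Sum>i<r. c i q * m i k q) = c r q * m r k q"
      using Suc.prems(5)[OF q(2), of k] by simp
    then show "t q * (u k q - (\<Sum>i<r. c i q * m i k q)) = c r q"
      using mt[OF q(1)] by (simp add: mult.commute mult.left_commute)
  qed
  then have "\<forall>i<Suc r. smooth_fun_on A V (c i)" using V(4) by (auto simp: less_Suc_eq)
  then show ?case using V V0(3) by blast
qed

end

section \<open>Dirac structures that are graphs over the tangent part\<close>

text \<open>One of the two transversality conditions makes \<open>L\<close> equal to some
  \<open>L\<^sub>\<eta>\<close>; the other one then turns into the contact condition on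
  \<open>\<eta>\<close>.\<close>

locale transverse_dirac = manifold A
  for A :: "('m::{t2_space,second_countable_topology}, 'e::euclidean_space) atlas" +
  fixes L :: "'m \<Rightarrow> 'm E1_elem set"
  assumes dirac: "dirac_structure A L"
    and transverse: "\<And>x. L x \<inter> ({0} \<times> (coT x \<times> UNIV)) = {0}"
begin

lemma L_subspace: "subspace (L x)" and L_fibre: "L x \<subseteq> E1_fibre A x"
  and L_pairing: "u \<in> L x \<Longrightarrow> v \<in> L x \<Longrightarrow> E1_pairing u v = 0"
  and L_maximal: "isotropic A x V \<Longrightarrow> L x \<subseteq> V \<Longrightarrow> V = L x"
  using dirac unfolding dirac_structure_def maximally_isotropic_def isotropic_def by blast+

lemma L_vertical:
  assumes "((0, 0), (\<xi>, b)) \<in> L x"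
  shows "\<xi> = 0 \<and> b = 0"
proof -
  have "\<xi> \<in> coT x" using assms L_fibre by (auto simp: E1_fibre_def)
  then have "((0, 0), (\<xi>, b)) \<in> L x \<inter> ({0} \<times> (coT x \<times> UNIV))"
    using assms by (simp add: zero_prod_def)
  then show ?thesis unfolding transverse by (simp add: zero_prod_def)
qed

lemma L_unique:
  assumes "((v, a), (\<xi>, b)) \<in> L x" "((v, a), (\<xi>', b')) \<in> L x"
  shows "\<xi> = \<xi>'" "b = b'"
proof -
  have "((v, a), (\<xi>, b)) - ((v, a), (\<xi>', b')) \<in> L x" by (rule subspace_diff[OF L_subspace assms])
  then have "((0, 0), (\<xi> - \<xi>', b - b')) \<in> L x" by (simp add: zero_prod_def)
  from L_vertical[OF this] show "\<xi> = \<xi>'" "b = b'" by auto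
qed

text \<open>Otherwise there is a linear functional \<open>g\<close> on \<open>T\<^sub>xM \<times>
  \<real>\<close> that vanishes on the projection of \<open>L\<close> but not at \<open>(v,
  a)\<close>. As a covector \<open>\<zeta>\<close> it is orthogonal to \<open>L\<close> and to
  itself, so by maximality it lies in \<open>L\<close>, and transversality makes it
  \<open>0\<close>.\<close>

lemma L_total:
  assumes v: "v \<in> T x"
  shows "\<exists>\<xi> b. ((v, a), (\<xi>, b)) \<in> L x"
proof (rule ccontr)
  assume no: "\<nexists>\<xi> b. ((v, a), (\<xi>, b)) \<in> L x"
  define P where "P = fst ` L x"
  have P: "subspace P" unfolding P_def
    by (rule linear_subspace_image[OF _ L_subspace]) (simp add: linear_iff)
  have nP: "(v, a) \<notin> P"
  proof
    assume "(v, a) \<in> P"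
    then obtain z where "z \<in> L x" "fst z = (v, a)" unfolding P_def by (metis imageE)
    then have "((v, a), (fst (snd z), snd (snd z))) \<in> L x" by (metis prod.collapse)
    then show False using no by blast
  qed
  obtain Bs where Bs: "Bs \<subseteq> P" "independent Bs" "P \<subseteq> span Bs" by (rule basis_exists[of P]) blast
  have spB: "span Bs = P" using Bs P by (metis span_subspace)
  have "independent (insert (v, a) Bs)" using nP spB Bs(2) by (intro independent_insertI) auto
  from linear_independent_extend[OF this, of "\<lambda>w. if w = (v, a) then 1 else 0 :: real"]
  obtain g where g: "linear g" "\<And>w. w \<in> insert (v, a) Bs \<Longrightarrow> g w = (if w = (v, a) then 1 else 0 :: real)"
    by blast
  interpret g: linear g by (rule g(1))
  have gP: "g w = 0" if "w \<in> P" for w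
  proof -
    have "(v, a) \<notin> Bs" using nP Bs(1) by blast
    then have "g b = 0" if "b \<in> Bs" for b using g(2)[of b] that by auto
    then show ?thesis using linear_eq_0_on_span[OF g(1), of Bs w] that spB by simp
  qed
  define \<xi> where "\<xi> w = (if w \<in> T x then g (w, 0) else 0)" for w
  define c where "c = g (0, 1)"
  have split: "g (w, k) = g (w, 0) + k * c" for w k
  proof -
    show ?thesis
      using g.add[of "(w, 0)" "k *\<^sub>R (0, 1)"] g.scale[of k "(0, 1)"] by (simp add: c_def)
  qed
  have \<xi>: "\<xi> \<in> coT x"
  proof (rule covectorI)
    fix w w' assume w: "w \<in> T x" "w' \<in> T x"
    have "g (w + w', 0) = g (w, 0) + g (w', 0)" using g.add[of "(w, 0)" "(w', 0)"] by simp
    then show "\<xi> (w + w') = \<xi> w + \<xi> w'" using w tangent_add[OF w] by (simp only: \<xi>_def if_True)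
  next
    fix k w assume w: "w \<in> T x"
    have "g (k *\<^sub>R w, 0) = k * g (w, 0)" using g.scale[of k "(w, 0)"] by simp
    then show "\<xi> (k *\<^sub>R w) = k * \<xi> w" using w tangent_scale[OF w] by (simp only: \<xi>_def if_True)
  qed (simp add: \<xi>_def)
  define \<zeta> where "\<zeta> = (((0, 0), (\<xi>, c)) :: 'm E1_elem)"
  have \<zeta>F: "\<zeta> \<in> E1_fibre A x" using \<xi> tangent_0 by (simp add: \<zeta>_def E1_fibre_def)
  have \<zeta>L: "E1_pairing \<zeta> z = 0" if z: "z \<in> L x" for z
  proof -
    obtain w k \<mu> h where zz: "z = ((w, k), (\<mu>, h))" by (metis prod.exhaust)
    have w: "w \<in> T x" "\<mu> \<in> coT x" using z L_fibre by (auto simp: zz E1_fibre_def)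
    have "(w, k) \<in> P" using z unfolding P_def zz by force
    then have "g (w, 0) + k * c = 0" using gP[of "(w, k)"] split[of w k] by simp
    then show ?thesis using w by (simp add: zz \<zeta>_def \<xi>_def covector_0[OF w(2)])
  qed
  have \<zeta>\<zeta>: "E1_pairing \<zeta> \<zeta> = 0" by (simp add: \<zeta>_def covector_0[OF \<xi>])
  define V where "V = {z + k *\<^sub>R \<zeta> | z k. z \<in> L x}"
  have "isotropic A x V"
    unfolding isotropic_def
  proof (intro conjI ballI)
    show "subspace V"
    proof -
      have "V = {z + y | z y. z \<in> L x \<and> y \<in> span {\<zeta>}}" unfolding V_def span_singleton by blast
      then show ?thesis using subspace_sums[OF L_subspace subspace_span[of "{\<zeta>}"]] by simp
    qed
    show "V \<subseteq> E1_fibre A x"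
      unfolding V_def using L_fibre \<zeta>F subspace_add[OF subspace_fibre] subspace_scale[OF subspace_fibre] by blast
    fix y z assume "y \<in> V" "z \<in> V"
    then obtain y0 k z0 l where y: "y0 \<in> L x" "y = y0 + k *\<^sub>R \<zeta>" and z: "z0 \<in> L x" "z = z0 + l *\<^sub>R \<zeta>"
      unfolding V_def by blast
    note F = subsetD[OF L_fibre y(1)] subsetD[OF L_fibre z(1)]
    have zF: "z \<in> E1_fibre A x" unfolding z(2)
      by (intro subspace_add[OF subspace_fibre] subspace_scale[OF subspace_fibre] F \<zeta>F)
    have "E1_pairing u z = 0" if u: "u \<in> E1_fibre A x" "E1_pairing z0 u = 0" "E1_pairing \<zeta> u = 0" for u
      unfolding pairing_sym[of u] z(2) pairing_add_scale[OF F(2) \<zeta>F u(1)] using u by simp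
    then have "E1_pairing y0 z = 0" "E1_pairing \<zeta> z = 0"
      using F(1) \<zeta>F L_pairing[OF z(1) y(1)] \<zeta>L[OF y(1)] \<zeta>L[OF z(1)] \<zeta>\<zeta> pairing_sym by metis+
    then show "E1_pairing y z = 0" unfolding y(2) pairing_add_scale[OF F(1) \<zeta>F zF] by simp
  qed
  moreover have "L x \<subseteq> V" unfolding V_def by (force intro: exI[of _ 0])
  ultimately have "V = L x" by (rule L_maximal)
  moreover have "\<zeta> \<in> V"
    unfolding V_def using subspace_0[OF L_subspace, of x] by (intro CollectI exI[of _ 0] exI[of _ 1]) simp
  ultimately have "((0, 0), (\<xi>, c)) \<in> L x" by (simp add: \<zeta>_def)
  then have "\<xi> = 0" "c = 0" using L_vertical by blast+
  moreover have "\<xi> v = g (v, 0)" using v by (simp add: \<xi>_def)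
  ultimately have "g (v, a) = 0" using split[of v a] by simp
  then show False using g(2)[of "(v, a)"] by simp
qed

text \<open>The form \<open>\<eta>\<close> is read off from the function component over \<open>(v, 0)\<close>,
  with the sign of \<open>L\<^sub>\<eta>\<close>.\<close>

definition eta :: "'m \<Rightarrow> 'm covec" where
  "eta x v = (if v \<in> T x then - (SOME b. \<exists>\<xi>. ((v, 0), (\<xi>, b)) \<in> L x) else 0)"

definition omega :: "'m \<Rightarrow> 'm tvec \<Rightarrow> 'm covec" where
  "omega x v = (if v \<in> T x then (SOME \<xi>. \<exists>b. ((v, 0), (\<xi>, b)) \<in> L x) else 0)"

lemma graph0:
  assumes v: "v \<in> T x"
  shows "((v, 0), (omega x v, - eta x v)) \<in> L x"
proof -
  obtain \<xi> b where L: "((v, 0), (\<xi>, b)) \<in> L x" using L_total[OF v] by blast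
  have "(SOME b. \<exists>\<xi>. ((v, 0), (\<xi>, b)) \<in> L x) = b"
    by (rule some_equality) (use L L_unique(2) in blast)+
  moreover have "(SOME \<xi>. \<exists>b. ((v, 0), (\<xi>, b)) \<in> L x) = \<xi>"
    by (rule some_equality) (use L L_unique(1) in blast)+
  ultimately show ?thesis using L v by (simp add: eta_def omega_def)
qed

lemma graph0_eq:
  assumes "((v, 0), (\<xi>, b)) \<in> L x"
  shows "\<xi> = omega x v" "b = - eta x v"
proof -
  have "v \<in> T x" using assms L_fibre by (auto simp: E1_fibre_def)
  from L_unique[OF assms graph0[OF this]] show "\<xi> = omega x v" "b = - eta x v" .
qed

lemma eta_omega_linear:
  assumes v: "v \<in> T x" and w: "w \<in> T x"
  shows "omega x (v + w) = omega x v + omega x w" "eta x (v + w) = eta x v + eta x w"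
    "omega x (c *\<^sub>R v) = c *\<^sub>R omega x v" "eta x (c *\<^sub>R v) = c * eta x v"
proof -
  have "((v, 0), (omega x v, - eta x v)) + ((w, 0), (omega x w, - eta x w)) \<in> L x"
    by (rule subspace_add[OF L_subspace graph0[OF v] graph0[OF w]])
  then have "((v + w, 0), (omega x v + omega x w, - eta x v + - eta x w)) \<in> L x" by simp
  from graph0_eq[OF this] show "omega x (v + w) = omega x v + omega x w" "eta x (v + w) = eta x v + eta x w"
    by simp_all
  have "c *\<^sub>R ((v, 0), (omega x v, - eta x v)) \<in> L x"
    by (rule subspace_scale[OF L_subspace graph0[OF v]])
  then have "((c *\<^sub>R v, 0), (c *\<^sub>R omega x v, c * - eta x v)) \<in> L x" by simp
  from graph0_eq[OF this] show "omega x (c *\<^sub>R v) = c *\<^sub>R omega x v" "eta x (c *\<^sub>R v) = c * eta x v"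
    by simp_all
qed

lemma eta_covector: "eta x \<in> coT x"
proof (rule covectorI)
  show "eta x (v + w) = eta x v + eta x w" if "v \<in> T x" "w \<in> T x" for v w
    by (rule eta_omega_linear(2)[OF that])
  show "eta x (c *\<^sub>R v) = c * eta x v" if "v \<in> T x" for c v
    by (rule eta_omega_linear(4)[OF that that])
qed (simp add: eta_def)

lemma omega_covector:
  assumes "v \<in> T x"
  shows "omega x v \<in> coT x"
  using graph0[OF assms] L_fibre by (auto simp: E1_fibre_def)

lemma omega_skew:
  assumes "v \<in> T x" "w \<in> T x"
  shows "omega x v w = - omega x w v"
  using L_pairing[OF graph0[OF assms(1)] graph0[OF assms(2)]] by simp

text \<open>Isotropy determines the fibre over \<open>(0, 1)\<close> by the fibres over the vectors \<open>(v,
  0)\<close>.\<close>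

lemma graph1: "((0, 1), (eta x, 0)) \<in> L x"
proof -
  obtain \<xi> b where L: "((0, 1), (\<xi>, b)) \<in> L x" using L_total[OF tangent_0] by blast
  have \<xi>: "\<xi> \<in> coT x" using L L_fibre by (auto simp: E1_fibre_def)
  have "b = 0" using L_pairing[OF L L] covector_0[OF \<xi>] by simp
  moreover have "\<xi> = eta x"
  proof (rule covector_eqI[OF \<xi> eta_covector])
    fix v assume v: "v \<in> T x"
    show "\<xi> v = eta x v" using L_pairing[OF L graph0[OF v]] covector_0[OF omega_covector[OF v]] by simp
  qed
  ultimately show ?thesis using L by simp
qed

lemma graph:
  assumes "v \<in> T x"
  shows "((v, a), (omega x v + a *\<^sub>R eta x, - eta x v)) \<in> L x"
  using subspace_add[OF L_subspace graph0[OF assms] subspace_scale[OF L_subspace graph1, of a]]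
  by simp

lemma L_eq_graph: "L x = {((v, a), (omega x v + a *\<^sub>R eta x, - eta x v)) | v a. v \<in> T x}"
proof (intro set_eqI iffI)
  fix z assume z: "z \<in> L x"
  obtain v a \<xi> b where e: "z = ((v, a), (\<xi>, b))" by (metis prod.exhaust)
  have v: "v \<in> T x" using z L_fibre by (auto simp: e E1_fibre_def)
  have "\<xi> = omega x v + a *\<^sub>R eta x" "b = - eta x v"
    using L_unique[OF z[unfolded e] graph[OF v]] by blast+
  then show "z \<in> {((v, a), (omega x v + a *\<^sub>R eta x, - eta x v)) | v a. v \<in> T x}"
    unfolding e using v by blast
next
  fix z assume "z \<in> {((v, a), (omega x v + a *\<^sub>R eta x, - eta x v)) | v a. v \<in> T x}"
  then show "z \<in> L x" by (elim CollectE exE conjE) (simp only: graph)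
qed

text \<open>Expand the section over \<open>(X, 0)\<close> in a smooth frame of \<open>L\<close>. The
  coefficients are already determined by the tangent part, as \<open>L\<close> contains no nonzero
  covectors, so they solve a linear system with smooth data.\<close>

lemma smooth_graph:
  assumes X: "vector_field A X"
  shows "smooth_fun A (\<lambda>q. eta q (X q))"
    and "vector_field A Y \<Longrightarrow> smooth_fun A (\<lambda>q. omega q (X q) (Y q))"
proof -
  have loc: "\<exists>V. open V \<and> p \<in> V \<and> smooth_fun_on A V (\<lambda>q. eta q (X q)) \<and>
    (\<forall>Y. vector_field A Y \<longrightarrow> smooth_fun_on A V (\<lambda>q. omega q (X q) (Y q)))" for p
  proof -
    have "subbundle A L" using dirac by (simp only: dirac_structure_def)
    then obtain r :: nat where "\<forall>x. \<exists>W s. open W \<and> x \<in> W \<and>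
     (\<forall>i<r. s i \<in> E1_sections_on A W) \<and>
     (\<forall>y\<in>W. inj_on (\<lambda>i. value_at (s i) y) {..<r} \<and>
             independent ((\<lambda>i. value_at (s i) y) ` {..<r}) \<and>
             L y = span ((\<lambda>i. value_at (s i) y) ` {..<r}))"
      unfolding subbundle_def by (elim exE) (erule that)
    from spec[OF this, of p] obtain W s where Ws: "open W \<and> p \<in> W \<and>
     (\<forall>i<r. s i \<in> E1_sections_on A W) \<and>
     (\<forall>y\<in>W. inj_on (\<lambda>i. value_at (s i) y) {..<r} \<and>
             independent ((\<lambda>i. value_at (s i) y) ` {..<r}) \<and>
             L y = span ((\<lambda>i. value_at (s i) y) ` {..<r}))"
      by (elim exE) (erule that)
    then have W: "open W" "p \<in> W" and s: "\<And>i. i < r \<Longrightarrow> s i \<in> E1_sections_on A W"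
      and ind: "\<And>y. y \<in> W \<Longrightarrow> inj_on (\<lambda>i. value_at (s i) y) {..<r} \<and> independent ((\<lambda>i. value_at (s i) y) ` {..<r})"
      and sp: "\<And>y. y \<in> W \<Longrightarrow> L y = span ((\<lambda>i. value_at (s i) y) ` {..<r})"
      by simp_all
    obtain W' x E where "coordinate_frame W' x E" and p: "p \<in> W'" by (rule local_frame[of p])
    note F = coordinate_frameD(1)[OF this(1)] p coordinate_frameD(2-)[OF this(1)]
    define S where "S i = fst (fst (s i))" for i
    define f where "f i = snd (fst (s i))" for i
    define \<alpha> where "\<alpha> i = fst (snd (s i))" for i
    define g where "g i = snd (snd (s i))" for i
    have s_eq: "s i = ((S i, f i), (\<alpha> i, g i))" for i by (simp add: S_def f_def \<alpha>_def g_def)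
    have S: "vector_field_on A W (S i)" and f: "smooth_fun_on A W (f i)"
      and \<alpha>: "one_form_on A W (\<alpha> i)" and g: "smooth_fun_on A W (g i)" if "i < r" for i
      using s[OF that] unfolding s_eq E1_sections_on_def by (elim CollectE exE conjE, simp)+
    have "\<forall>q\<in>W. \<exists>c. ((X q, 0), (omega q (X q), - eta q (X q))) = (\<Sum>i<r. c i *\<^sub>R value_at (s i) q)"
    proof
      fix q assume q: "q \<in> W"
      have "((X q, 0), (omega q (X q), - eta q (X q))) \<in> {\<Sum>i<r. c i *\<^sub>R value_at (s i) q | c. True}"
        using graph0[OF vf_tangent[OF X], of q] unfolding sp[OF q] span_family[OF finite_lessThan] .
      then show "\<exists>c. ((X q, 0), (omega q (X q), - eta q (X q))) = (\<Sum>i<r. c i *\<^sub>R value_at (s i) q)"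
        by (elim CollectE exE conjE) (rule exI)
    qed
    from bchoice[OF this] obtain c where
      c0: "\<forall>q\<in>W. ((X q, 0), (omega q (X q), - eta q (X q))) = (\<Sum>i<r. c q i *\<^sub>R value_at (s i) q)"
      by (elim exE) (erule that)
    note c = bspec[OF c0]
    have comp: "X q = (\<Sum>i<r. c q i *\<^sub>R S i q)" "0 = (\<Sum>i<r. c q i * f i q)"
      "omega q (X q) = (\<Sum>i<r. c q i *\<^sub>R \<alpha> i q)" "- eta q (X q) = (\<Sum>i<r. c q i * g i q)" if "q \<in> W" for q
      using arg_cong[OF c[OF that], of "\<lambda>z. fst (fst z)"] arg_cong[OF c[OF that], of "\<lambda>z. snd (fst z)"]
        arg_cong[OF c[OF that], of "\<lambda>z. fst (snd z)"] arg_cong[OF c[OF that], of "\<lambda>z. snd (snd z)"]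
      by (simp_all add: s_eq fst_sum snd_sum)
    \<comment> \<open>Components: \<open>j \<in> Basis\<close> stands for the coordinates of the tangent part, and
      \<open>j = 0\<close>, which is not a basis vector, for the real part.\<close>
    define m where "m i j = (\<lambda>q. if j = 0 then f i q else S i q (x j))" for i and j :: 'e
    define u where "u j = (\<lambda>q. if j = 0 then 0 else X q (x j))" for j :: 'e
    have "\<exists>V. open V \<and> p \<in> V \<and> V \<subseteq> W \<and> (\<forall>i<r. smooth_fun_on A V (\<lambda>q. c q i))"
    proof (rule smooth_solution[OF W, of r m u])
      show "smooth_fun_on A W (m i j)" if "i < r" for i j
        unfolding m_def using f[OF that] S[OF that] F(3) by (cases "j = 0") (auto simp: vector_field_on_def)
      show "smooth_fun_on A W (u j)" for j
        unfolding u_def using smooth_fun_on_subset[OF vf_smooth[OF X], of W] W(1)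
        by (cases "j = 0") (auto simp: smooth_fun_on_const)
      show "u j q = (\<Sum>i<r. c q i * m i j q)" if "q \<in> W" for q j
      proof (cases "j = 0")
        case True
        then show ?thesis using comp(2)[OF that] by (simp add: u_def m_def)
      next
        case False
        then show ?thesis using fun_cong[OF comp(1)[OF that], of "x j"]
          by (simp add: u_def m_def sum_fun_apply)
      qed
      show "\<forall>i<r. d i = 0" if d: "\<And>j. (\<Sum>i<r. d i * m i j p) = 0" for d
      proof -
        let ?z = "\<Sum>i<r. d i *\<^sub>R value_at (s i) p"
        have f0: "(\<Sum>i<r. d i * f i p) = 0" using d[of 0] by (simp add: m_def)
        have t: "(\<Sum>i<r. d i *\<^sub>R S i p) \<in> T p"
          using S W(2) by (intro tangent_sum_mem tangent_scale) (auto simp: vector_field_on_def)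
        have "(\<Sum>i<r. d i *\<^sub>R S i p) (x b) = 0" if "b \<in> Basis" for b
          using d[of b] nonzero_Basis[OF that] by (simp add: m_def sum_fun_apply)
        then have S0: "(\<Sum>i<r. d i *\<^sub>R S i p) = 0"
          using F(6)[OF F(2) t] by simp
        have "?z \<in> L p" unfolding sp[OF W(2)] span_family[OF finite_lessThan] by blast
        moreover have "?z = ((0, 0), (\<Sum>i<r. d i *\<^sub>R \<alpha> i p, \<Sum>i<r. d i * g i p))"
          by (intro prod_eqI) (simp_all add: fst_sum snd_sum s_eq S0 f0)
        ultimately have "((0, 0), (\<Sum>i<r. d i *\<^sub>R \<alpha> i p, \<Sum>i<r. d i * g i p)) \<in> L p" by simp
        from L_vertical[OF this]
        have "?z = 0" using \<open>?z = _\<close> by (simp add: zero_prod_def)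
        then have "\<forall>i\<in>{..<r}. d i = 0"
          using ind[OF W(2)] unfolding independent_family[OF finite_lessThan] by blast
        then show ?thesis by simp
      qed
    qed
    then obtain V where V: "open V" "p \<in> V" "V \<subseteq> W" "\<And>i. i < r \<Longrightarrow> smooth_fun_on A V (\<lambda>q. c q i)" by blast
    have "smooth_fun_on A V (\<lambda>q. - (\<Sum>i<r. c q i * g i q))"
      by (intro smooth_fun_on_minus smooth_fun_on_sum smooth_fun_on_mult V(1) V(4)
          smooth_fun_on_subset[OF g V(3)]) auto
    then have "smooth_fun_on A V (\<lambda>q. eta q (X q))"
      by (rule smooth_fun_on_cong[OF V(1), rotated]) (use comp(4) V(3) in force)
    moreover have "smooth_fun_on A V (\<lambda>q. omega q (X q) (Y q))" if Y: "vector_field A Y" for Y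
    proof -
      have "smooth_fun_on A W (\<lambda>q. \<alpha> i q (Y q))" if "i < r" for i
        using \<alpha>[OF that] Y by (simp add: one_form_on_def)
      then have "smooth_fun_on A V (\<lambda>q. \<Sum>i<r. c q i * \<alpha> i q (Y q))"
        by (intro smooth_fun_on_sum smooth_fun_on_mult V(1) V(4) smooth_fun_on_subset[OF _ V(3)]) auto
      then show ?thesis
      proof (rule smooth_fun_on_cong[OF V(1), rotated])
        fix q assume "q \<in> V"
        then show "(\<Sum>i<r. c q i * \<alpha> i q (Y q)) = omega q (X q) (Y q)"
          using comp(3)[of q] V(3) by (auto simp: sum_fun_apply)
      qed
    qed
    ultimately show ?thesis using V(1,2) by blast
  qed
  show "smooth_fun A (\<lambda>q. eta q (X q))"
    by (rule smooth_fun_on_local) (use loc in blast)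
  show "smooth_fun A (\<lambda>q. omega q (X q) (Y q))" if "vector_field A Y"
    by (rule smooth_fun_on_local) (use loc that in blast)
qed

lemma one_form_eta: "one_form A eta"
  by (rule one_formI[OF eta_covector smooth_graph(1)])

lemma two_form_omega: "two_form A omega"
  unfolding two_form_def
proof (intro conjI allI ballI impI)
  fix p v assume v: "v \<in> T p"
  show "omega p v \<in> coT p" by (rule omega_covector[OF v])
  show "omega p v v = 0" using omega_skew[OF v v] by simp
  show "(\<lambda>w. omega p w v) \<in> coT p"
    by (rule covectorI) (simp_all add: eta_omega_linear, simp add: omega_def)
next
  fix p v assume "v \<notin> T p"
  then show "omega p v = 0" by (simp add: omega_def)
next
  fix X Y assume "vector_field A X" "vector_field A Y"
  then show "smooth_fun A (\<lambda>p. omega p (X p) (Y p))" by (rule smooth_graph(2))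
qed

text \<open>Compare the function component of the bracket of the sections over \<open>(X, 0)\<close> and
  \<open>(Y, 0)\<close> with that of the element of \<open>L\<close> over \<open>([X, Y],
  0)\<close>.\<close>

lemma d_eta: "d_form A eta = omega"
proof (rule d_form_eqI[OF one_form_eta two_form_omega])
  fix X Y p assume X: "vector_field A X" and Y: "vector_field A Y"
  have sec: "((X, \<lambda>_. 0), (\<lambda>p. omega p (X p), \<lambda>p. - eta p (X p))) \<in> sections_of A L"
    if X: "vector_field A X" for X
  proof -
    have "((X, \<lambda>_. 0), (\<lambda>p. omega p (X p), \<lambda>p. - eta p (X p))) \<in> E1_sections_on A UNIV"
      unfolding E1_sections_on_def
      using X smooth_fun_on_const[OF open_UNIV, of 0] one_form_contract[OF two_form_omega X]
        smooth_fun_on_minus[OF open_UNIV smooth_graph(1)[OF X]] by blast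
    then show ?thesis
      unfolding sections_of_def using graph0[OF vf_tangent[OF X]] by simp
  qed
  have "courant_bracket A ((X, \<lambda>_. 0), (\<lambda>p. omega p (X p), \<lambda>p. - eta p (X p)))
      ((Y, \<lambda>_. 0), (\<lambda>p. omega p (Y p), \<lambda>p. - eta p (Y p))) \<in> sections_of A L"
    using dirac sec[OF X] sec[OF Y] unfolding dirac_structure_def by blast
  then have "value_at (courant_bracket A ((X, \<lambda>_. 0), (\<lambda>p. omega p (X p), \<lambda>p. - eta p (X p)))
      ((Y, \<lambda>_. 0), (\<lambda>p. omega p (Y p), \<lambda>p. - eta p (Y p)))) p \<in> L p"
    unfolding sections_of_def by blast
  then have "X p (\<lambda>q. - eta q (Y q)) - Y p (\<lambda>q. - eta q (X q)) + omega p (X p) (Y p)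
      = - eta p (lie_bracket X Y p)"
    unfolding courant_bracket_eq[OF X Y] value_at.simps
    by (auto simp: vf_apply(6)[OF X] vf_apply(6)[OF Y] dest: graph0_eq(2))
  then show "omega p (X p) (Y p) = ext_d eta X Y p"
    unfolding vf_apply(3)[OF X smooth_graph(1)[OF Y]] vf_apply(3)[OF Y smooth_graph(1)[OF X]]
    by (simp add: ext_d_def)
qed

lemma L_eq_L_of: "L = L_of A eta"
  by (rule ext) (simp add: L_eq_graph L_of_eq[OF one_form_eta] d_eta)

end

section \<open>The correspondence\<close>

theorem theorem2p3:
  fixes A :: "('m::{t2_space,second_countable_topology}, 'e::euclidean_space) atlas"
    and n :: nat
  assumes "smooth_manifold A"
    and "DIM('e) = 2 * n + 1"
  shows "bij_betw (L_of A)
    {\<eta>. contact_form A n \<eta>}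
    {L. dirac_structure A L \<and>
        (\<forall>x. L x \<inter> ((tangent_space A x \<times> UNIV) \<times> {0}) = {0} \<and>
             L x \<inter> ({0} \<times> (cotangent_space A x \<times> UNIV)) = {0})}"
proof -
  interpret manifold A by unfold_locales (rule assms(1))
  have one: "one_form A \<eta>" if "contact_form A n \<eta>" for \<eta> using that by (simp add: contact_form_def)
  show ?thesis
    unfolding bij_betw_def
  proof (intro conjI set_eqI iffI)
    show "inj_on (L_of A) {\<eta>. contact_form A n \<eta>}"
      by (rule inj_onI) (use L_of_inj one in blast)
  next
    fix L assume "L \<in> L_of A ` {\<eta>. contact_form A n \<eta>}"
    then obtain \<eta> where \<eta>: "contact_form A n \<eta>" and L: "L = L_of A \<eta>" by blast
    note o = one[OF \<eta>]
    have "nondeg \<eta> p" for p using \<eta> contact_iff_nondeg[OF o assms(2)] by blast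
    then show "L \<in> {L. dirac_structure A L \<and>
        (\<forall>x. L x \<inter> ((tangent_space A x \<times> UNIV) \<times> {0}) = {0} \<and>
             L x \<inter> ({0} \<times> (cotangent_space A x \<times> UNIV)) = {0})}"
      unfolding L using L_of_dirac[OF o] L_of_transverse[OF o] by simp
  next
    fix L assume L: "L \<in> {L. dirac_structure A L \<and>
        (\<forall>x. L x \<inter> ((tangent_space A x \<times> UNIV) \<times> {0}) = {0} \<and>
             L x \<inter> ({0} \<times> (cotangent_space A x \<times> UNIV)) = {0})}"
    interpret transverse_dirac A L by unfold_locales (use L in auto)
    have "nondeg eta x" for x
      using L L_of_transverse(2)[OF one_form_eta, of x] unfolding L_eq_L_of[symmetric] by blast
    then have "contact_form A n eta" using contact_iff_nondeg[OF one_form_eta assms(2)] by blast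
    then show "L \<in> L_of A ` {\<eta>. contact_form A n \<eta>}" using L_eq_L_of by blast
  qed
qed

end
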